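(* Let $E$ be a second countable locally compact metric space equipped with a proper metric $d$, and let $\mu$ be a non-negative regular Borel measure on $E$. Let $\Pi$ be a determinantal point process on $E$ with kernel $K(\cdot,\cdot)$ and background measure $\mu$. Suppose that $K(\cdot,\cdot)$, as an integral operator from $L^2(\mu)$ to itself, is the projection onto a closed subspace $\mathcal{H}\subset L^2(\mu)$. Suppose that $\Pi$ is rigid, in the sense that for any open ball $B$ with a finite radius, the point configuration of $\Pi$ outside $B$ almost surely determines the number $N_B$ of points of $\Pi$ inside $B$. Then $\{K(\cdot,x):x\in\Pi\}$ is almost surely complete in $\mathcal{H}$, that is, almost surely this set of functions spans $\mathcal{H}$.
   Context: A metric space is proper if every closed ball of finite radius is compact. A point process (random locally finite point configuration) on $E$ is determinantal with background measure $\mu$ and kernel $K:E\times E\to\mathbb{C}$ if for every $n\ge1$ its $n$-point intensity function with respect to $\mu^{\otimes n}$ is $\rho_n(x_1,\dots,x_n)=\det\left(K(x_i,x_j)\right)_{i,j=1}^n$. The kernel is Hermitian, and the integral operator it induces on $L^2(\mu)$ is locally trace class and a non-negative contraction. In the projection case, $\mathcal{H}$ is regarded as a reproducing kernel Hilbert space with reproducing kernel $K$: for each $x\in E$, $K(\cdot,x)\in\mathcal{H}$, and each $f\in\mathcal{H}$ satisfies $f(x)=\langle f,K(\cdot,x)\rangle_{L^2(\mu)}$. "The configuration outside $B$ almost surely determines $N_B$" means that $N_B$ is almost surely equal to a measurable function of the restriction of $\Pi$ to $E\setminus B$. A set of vectors spans a Hilbert space if its closed linear span is the whole space. *)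

theory Defs
  imports
    "HOL-Probability.Probability"
    "Jordan_Normal_Form.Determinant"
begin

definition proper_space :: "'a::metric_space itself \<Rightarrow> bool" where
  "proper_space _ \<longleftrightarrow> (\<forall>(x::'a) r. compact (cball x r))"

definition regular_borel_measure :: "'a::topological_space measure \<Rightarrow> bool" where
  "regular_borel_measure \<mu> \<longleftrightarrow>
     sets \<mu> = sets borel \<and>
     (\<forall>C. compact C \<longrightarrow> emeasure \<mu> C < \<infinity>) \<and>
     (\<forall>A\<in>sets borel. emeasure \<mu> A = (INF U\<in>{U. open U \<and> A \<subseteq> U}. emeasure \<mu> U)) \<and>
     (\<forall>U. open U \<longrightarrow> emeasure \<mu> U = (SUP C\<in>{C. compact C \<and> C \<subseteq> U}. emeasure \<mu> C))"


section \<open>The Hilbert space of square-integrable functions\<close>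

text \<open>
  Elements of \<open>L2 \<mu>\<close> are functions, not classes modulo almost everywhere equality, so that
  point evaluation makes sense on a reproducing kernel Hilbert space. Equality, closedness and
  span in the Hilbert space of classes are expressed through \<open>L2_saturation\<close> and
  \<open>L2_closure\<close>, which, on subsets of \<open>L2 \<mu>\<close>, only depend on the classes and return unions of classes.
\<close>

definition L2 :: "'a measure \<Rightarrow> ('a \<Rightarrow> complex) set" where
  "L2 \<mu> = {f \<in> borel_measurable \<mu>. integrable \<mu> (\<lambda>x. (cmod (f x))\<^sup>2)}"

definition L2_inner :: "'a measure \<Rightarrow> ('a \<Rightarrow> complex) \<Rightarrow> ('a \<Rightarrow> complex) \<Rightarrow> complex" where
  "L2_inner \<mu> f g = (\<integral>x. f x * cnj (g x) \<partial>\<mu>)"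

definition L2_norm :: "'a measure \<Rightarrow> ('a \<Rightarrow> complex) \<Rightarrow> real" where
  "L2_norm \<mu> f = sqrt (\<integral>x. (cmod (f x))\<^sup>2 \<partial>\<mu>)"

definition L2_saturation :: "'a measure \<Rightarrow> ('a \<Rightarrow> complex) set \<Rightarrow> ('a \<Rightarrow> complex) set" where
  "L2_saturation \<mu> S = {f \<in> L2 \<mu>. \<exists>g\<in>S. AE x in \<mu>. f x = g x}"

definition L2_closure :: "'a measure \<Rightarrow> ('a \<Rightarrow> complex) set \<Rightarrow> ('a \<Rightarrow> complex) set" where
  "L2_closure \<mu> S = {f \<in> L2 \<mu>. \<forall>\<epsilon>>0. \<exists>g\<in>S. L2_norm \<mu> (\<lambda>x. f x - g x) < \<epsilon>}"

definition linear_span :: "('a \<Rightarrow> complex) set \<Rightarrow> ('a \<Rightarrow> complex) set" where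
  "linear_span S = {(\<lambda>x. \<Sum>f\<in>F. c f * f x) | F c. finite F \<and> F \<subseteq> S}"

definition L2_closed_span :: "'a measure \<Rightarrow> ('a \<Rightarrow> complex) set \<Rightarrow> ('a \<Rightarrow> complex) set" where
  "L2_closed_span \<mu> S = L2_closure \<mu> (linear_span S)"

definition L2_closed_subspace :: "'a measure \<Rightarrow> ('a \<Rightarrow> complex) set \<Rightarrow> bool" where
  "L2_closed_subspace \<mu> H \<longleftrightarrow>
     H \<subseteq> L2 \<mu> \<and>
     (\<lambda>x. 0) \<in> H \<and>
     (\<forall>f\<in>H. \<forall>g\<in>H. (\<lambda>x. f x + g x) \<in> H) \<and>
     (\<forall>c. \<forall>f\<in>H. (\<lambda>x. c * f x) \<in> H) \<and>
     L2_closure \<mu> H = L2_saturation \<mu> H"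

definition L2_spans :: "'a measure \<Rightarrow> ('a \<Rightarrow> complex) set \<Rightarrow> ('a \<Rightarrow> complex) set \<Rightarrow> bool" where
  "L2_spans \<mu> S H \<longleftrightarrow> S \<subseteq> H \<and> L2_closed_span \<mu> S = L2_saturation \<mu> H"

definition L2_orthonormal_basis :: "'a measure \<Rightarrow> ('a \<Rightarrow> complex) set \<Rightarrow> bool" where
  "L2_orthonormal_basis \<mu> S \<longleftrightarrow>
     (\<forall>e\<in>S. \<forall>f\<in>S. L2_inner \<mu> e f = (if e = f then 1 else 0)) \<and> L2_spans \<mu> S (L2 \<mu>)"


section \<open>Integral operators\<close>

definition integral_op ::
  "'a measure \<Rightarrow> ('a \<Rightarrow> 'a \<Rightarrow> complex) \<Rightarrow> ('a \<Rightarrow> complex) \<Rightarrow> 'a \<Rightarrow> complex" where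
  "integral_op \<mu> K f = (\<lambda>x. \<integral>y. K x y * f y \<partial>\<mu>)"

definition induces_L2_operator :: "'a measure \<Rightarrow> ('a \<Rightarrow> 'a \<Rightarrow> complex) \<Rightarrow> bool" where
  "induces_L2_operator \<mu> K \<longleftrightarrow>
     (\<forall>f\<in>L2 \<mu>. (AE x in \<mu>. integrable \<mu> (\<lambda>y. K x y * f y)) \<and> integral_op \<mu> K f \<in> L2 \<mu>)"

definition nonneg_contraction ::
  "'a measure \<Rightarrow> (('a \<Rightarrow> complex) \<Rightarrow> 'a \<Rightarrow> complex) \<Rightarrow> bool" where
  "nonneg_contraction \<mu> T \<longleftrightarrow>
     (\<forall>f\<in>L2 \<mu>. Im (L2_inner \<mu> (T f) f) = 0 \<and> 0 \<le> Re (L2_inner \<mu> (T f) f) \<and>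
                L2_norm \<mu> (T f) \<le> L2_norm \<mu> f)"

text \<open>
  This is the trace class condition only for non-negative \<open>T\<close>, where \<open>T\<close> is its own absolute
  value; the sum is then independent of the orthonormal basis.
\<close>

definition nonneg_trace_class ::
  "'a measure \<Rightarrow> (('a \<Rightarrow> complex) \<Rightarrow> 'a \<Rightarrow> complex) \<Rightarrow> bool" where
  "nonneg_trace_class \<mu> T \<longleftrightarrow>
     (\<exists>S. L2_orthonormal_basis \<mu> S \<and> (\<lambda>e. L2_inner \<mu> (T e) e) summable_on S)"

definition compressed_kernel :: "'a set \<Rightarrow> ('a \<Rightarrow> 'a \<Rightarrow> complex) \<Rightarrow> 'a \<Rightarrow> 'a \<Rightarrow> complex" where
  "compressed_kernel D K x y = indicator D x * K x y * indicator D y"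

definition determinantal_kernel ::
  "'a::topological_space measure \<Rightarrow> ('a \<Rightarrow> 'a \<Rightarrow> complex) \<Rightarrow> bool" where
  "determinantal_kernel \<mu> K \<longleftrightarrow>
     (\<lambda>(x, y). K x y) \<in> borel_measurable (\<mu> \<Otimes>\<^sub>M \<mu>) \<and>
     (\<forall>x y. K x y = cnj (K y x)) \<and>
     induces_L2_operator \<mu> K \<and>
     nonneg_contraction \<mu> (integral_op \<mu> K) \<and>
     (\<forall>D. compact D \<longrightarrow> nonneg_trace_class \<mu> (integral_op \<mu> (compressed_kernel D K)))"

definition orthogonal_projection_onto ::
  "'a measure \<Rightarrow> (('a \<Rightarrow> complex) \<Rightarrow> 'a \<Rightarrow> complex) \<Rightarrow> ('a \<Rightarrow> complex) set \<Rightarrow> bool" where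
  "orthogonal_projection_onto \<mu> T H \<longleftrightarrow>
     (\<forall>f\<in>L2 \<mu>. \<exists>h\<in>H. (AE x in \<mu>. T f x = h x) \<and>
                (\<forall>g\<in>H. L2_inner \<mu> (\<lambda>x. f x - h x) g = 0))"

definition reproducing_kernel ::
  "'a measure \<Rightarrow> ('a \<Rightarrow> 'a \<Rightarrow> complex) \<Rightarrow> ('a \<Rightarrow> complex) set \<Rightarrow> bool" where
  "reproducing_kernel \<mu> K H \<longleftrightarrow>
     (\<forall>x. (\<lambda>y. K y x) \<in> H) \<and> (\<forall>f\<in>H. \<forall>x. f x = L2_inner \<mu> f (\<lambda>y. K y x))"


section \<open>Point processes\<close>

definition locally_finite :: "'a::topological_space set \<Rightarrow> bool" where
  "locally_finite S \<longleftrightarrow> (\<forall>C. compact C \<longrightarrow> finite (S \<inter> C))"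

definition configurations :: "'a::topological_space set measure" where
  "configurations =
     sigma {S. locally_finite S}
       {{S. locally_finite S \<and> card (S \<inter> A) = k} | A k. A \<in> sets borel \<and> compact (closure A)}"

definition point_process :: "'w measure \<Rightarrow> ('w \<Rightarrow> 'a::topological_space set) \<Rightarrow> bool" where
  "point_process P X \<longleftrightarrow> prob_space P \<and> X \<in> measurable P configurations"

definition distinct_tuples :: "nat \<Rightarrow> 'a set \<Rightarrow> (nat \<Rightarrow> 'a) set" where
  "distinct_tuples n S = {x \<in> {..<n} \<rightarrow>\<^sub>E S. inj_on x {..<n}}"

text \<open>
  \<open>\<rho>\<close> is the density of the \<open>n\<close>-th factorial moment measure of \<open>X\<close>, the expected number of
  ordered \<open>n\<close>-tuples of distinct points in a given set.
\<close>

definition intensity_function ::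
  "'w measure \<Rightarrow> ('w \<Rightarrow> 'a set) \<Rightarrow> 'a measure \<Rightarrow> nat \<Rightarrow> ((nat \<Rightarrow> 'a) \<Rightarrow> real) \<Rightarrow> bool" where
  "intensity_function P X \<mu> n \<rho> \<longleftrightarrow>
     \<rho> \<in> borel_measurable (\<Pi>\<^sub>M i\<in>{..<n}. \<mu>) \<and>
     (\<forall>x. 0 \<le> \<rho> x) \<and>
     (\<forall>A\<in>sets (\<Pi>\<^sub>M i\<in>{..<n}. \<mu>).
        (\<integral>\<^sup>+\<omega>. emeasure (count_space UNIV) (distinct_tuples n (X \<omega>) \<inter> A) \<partial>P) =
        (\<integral>\<^sup>+x\<in>A. ennreal (\<rho> x) \<partial>(\<Pi>\<^sub>M i\<in>{..<n}. \<mu>)))"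

definition determinantal_process ::
  "'w measure \<Rightarrow> ('w \<Rightarrow> 'a::topological_space set) \<Rightarrow> 'a measure \<Rightarrow> ('a \<Rightarrow> 'a \<Rightarrow> complex) \<Rightarrow> bool"
where
  "determinantal_process P X \<mu> K \<longleftrightarrow>
     point_process P X \<and>
     determinantal_kernel \<mu> K \<and>
     (\<forall>n\<ge>1. \<exists>\<rho>. intensity_function P X \<mu> n \<rho> \<and>
        (AE x in (\<Pi>\<^sub>M i\<in>{..<n}. \<mu>).
           complex_of_real (\<rho> x) = Determinant.det (Matrix.mat n n (\<lambda>(i, j). K (x i) (x j)))))"

definition rigid :: "'w measure \<Rightarrow> ('w \<Rightarrow> 'a::metric_space set) \<Rightarrow> bool" where
  "rigid P X \<longleftrightarrow>
     (\<forall>x. \<forall>r>0. \<exists>F \<in> measurable configurations (count_space (UNIV :: nat set)).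
        AE \<omega> in P. card (X \<omega> \<inter> ball x r) = F (X \<omega> - ball x r))"

end

theory Submission
  imports Defs
begin

text \<open>
  Write \<open>K\<^sub>t = K(\<cdot>, t)\<close>. For a bounded window \<open>D\<close> let \<open>j\<^sub>n\<close> be the Janossy density of \<open>\<Pi> \<inter> D\<close>: the
  density of the event that \<open>\<Pi>\<close> has exactly the points \<open>x\<^sub>1, \<dots>, x\<^sub>n\<close> in \<open>D\<close>. The key estimate is
  insertion tolerance,
  \<open>j\<^sub>n\<^sub>+\<^sub>1(x, t) \<ge> dist(K\<^sub>t, span {K\<^sub>x\<^sub>1, \<dots>, K\<^sub>x\<^sub>n})\<^sup>2 j\<^sub>n(x)\<close>. To see it, take an orthonormal
  system of \<open>H\<close> obtained by Gram-Schmidt from \<open>K\<^sub>x\<^sub>1, \<dots>, K\<^sub>x\<^sub>n, K\<^sub>t\<close> and a countable total set. Then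
  \<open>j\<^sub>n(x) = det(K(x\<^sub>i, x\<^sub>j)) det(I - G)\<close>, where \<open>G\<close> is the Gram matrix over \<open>D\<close> of the members of the
  system after the first \<open>n\<close>. Dropping one further member does not decrease \<open>det(I - G)\<close>, because
  \<open>0 \<le> I - G \<le> I\<close>, and the quotient of the two determinants of \<open>K\<close> is the squared distance.

  Let \<open>A\<close> be the event that \<open>N\<^sub>B\<close> is the prescribed function of the configuration outside \<open>B\<close>.
  Deleting a point of \<open>B\<close> changes \<open>N\<^sub>B\<close> but not the outside, so by rigidity no configuration obtained
  from \<open>\<Pi>\<close> by such a deletion lies in \<open>A\<close>, although \<open>\<Pi>\<close> itself does. Insertion tolerance, integrated
  over the configurations in \<open>A\<close> and over \<open>t \<in> B\<close>, then forces the distance of \<open>K\<^sub>t\<close> from the closed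
  span of \<open>{K\<^sub>x : x \<in> \<Pi>}\<close> to vanish for almost every \<open>t\<close>. A function \<open>f\<close> in \<open>H\<close> orthogonal to that
  span thus has \<open>f(t) = \<langle>f, K\<^sub>t\<rangle> = 0\<close> for almost every \<open>t\<close>.
\<close>

section \<open>Determinants over finite index sets\<close>

text \<open>The textbook formula for Janossy densities uses the inverse of \<open>I - K_D\<close>,
  which need not exist for a projection. Splitting off \<open>det(I - G)\<close> for a system
  adapted to the points involves no inverse. For the same reason Schur complements are described by
  elimination coefficients, which exist for singular blocks too, and determinants are taken over
  arbitrary finite index sets, so that minors and enlarged blocks are again instances. Insertion
  tolerance is obtained only inside a bounded window and for events that this window decides,
  whereas the rigidity event looks at the whole configuration. That event is therefore approximated
  by local ones, in a measure that also charges configurations with one point deleted. The window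
  then depends on the approximation, so the conclusion concerns an infimum over windows of
  integrated squared distances. This is enough, because a kernel close to the span over the points
  of some window is close to the span over all points. Members of \<open>H\<close> are functions,
  and evaluation is an inner product with a kernel; so what holds for almost every \<open>t\<close>
  can be carried over to every \<open>t\<close>.\<close>

definition det_on :: "'i set \<Rightarrow> ('i \<Rightarrow> 'i \<Rightarrow> complex) \<Rightarrow> complex" where
  "det_on S a = (\<Sum>p | p permutes S. of_int (sign p) * (\<Prod>i\<in>S. a i (p i)))"

lemma det_on_empty [simp]: "det_on {} a = 1"
  by (simp add: det_on_def)

lemma det_on_cong:
  assumes "\<And>i j. i \<in> S \<Longrightarrow> j \<in> S \<Longrightarrow> a i j = b i j"
  shows "det_on S a = det_on S b"
  unfolding det_on_def
  by (intro sum.cong arg_cong2[where f="(*)"] prod.cong refl assms)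
     (auto simp: permutes_in_image)

text \<open>Composition with the transposition of \<open>s\<close> and \<open>t\<close> permutes the
  summands, keeps each product and reverses each sign, so the determinant equals its own
  negative.\<close>

lemma det_on_eq_rows:
  assumes "finite S" "s \<in> S" "t \<in> S" "s \<noteq> t" and eq: "\<And>j. j \<in> S \<Longrightarrow> a s j = a t j"
  shows "det_on S a = 0"
proof -
  let ?q = "Transposition.transpose s t"
  have q: "?q permutes S" using assms by (simp add: permutes_swap_id)
  have "det_on S a = (\<Sum>p | p permutes S. of_int (sign (p \<circ> ?q)) * (\<Prod>i\<in>S. a i ((p \<circ> ?q) i)))"
    unfolding det_on_def by (rule sum_permutations_compose_right[OF q])
  also have "\<dots> = (\<Sum>p | p permutes S. - (of_int (sign p) * (\<Prod>i\<in>S. a i (p i))))"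
  proof (rule sum.cong[OF refl])
    fix p assume "p \<in> {p. p permutes S}"
    then have p: "p permutes S" by simp
    have "sign (p \<circ> ?q) = sign p * sign ?q"
      by (intro sign_compose permutes_imp_permutation[OF \<open>finite S\<close>] p q)
    also have "sign ?q = -1" using \<open>s \<noteq> t\<close> by (simp add: sign_swap_id)
    finally have sg: "sign (p \<circ> ?q) = - sign p" by (simp only: mult_minus1_right mult_1_right)
    have "(\<Prod>i\<in>S. a i ((p \<circ> ?q) i)) = (\<Prod>i\<in>S. a (?q i) (p (?q i)))"
    proof (rule prod.cong[OF refl])
      fix i assume i: "i \<in> S"
      then have "p (?q i) \<in> S" by (simp add: permutes_in_image[OF p] permutes_in_image[OF q])
      then show "a i ((p \<circ> ?q) i) = a (?q i) (p (?q i))"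
        using eq by (auto simp: Transposition.transpose_def)
    qed
    also have "\<dots> = (\<Prod>i\<in>S. a i (p i))"
      by (rule prod.reindex_bij_betw[OF permutes_imp_bij[OF q], of "\<lambda>i. a i (p i)"])
    finally show "of_int (sign (p \<circ> ?q)) * (\<Prod>i\<in>S. a i ((p \<circ> ?q) i)) =
        - (of_int (sign p) * (\<Prod>i\<in>S. a i (p i)))" by (simp add: sg)
  qed
  also have "\<dots> = - det_on S a" by (simp add: det_on_def sum_negf)
  finally show ?thesis by simp
qed

lemma permutes_insert_fixed:
  assumes "t \<notin> J"
  shows "p permutes insert t J \<and> p t = t \<longleftrightarrow> p permutes J"
  using assms permutes_superset[of p "insert t J" J]
  by (auto intro: permutes_subset simp: permutes_not_in)

text \<open>Row reduction without inverting a block: subtracting the combination \<open>c\<close> of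
  the rows in \<open>J\<close> leaves row \<open>t\<close> with zeros on \<open>J\<close>. Using
  \<open>c\<close> in place of an inverse keeps the identity valid for a singular block.\<close>

lemma det_on_insert:
  assumes fin: "finite J" and t: "t \<notin> J"
    and c: "\<And>j. j \<in> J \<Longrightarrow> a t j = (\<Sum>s\<in>J. c s * a s j)"
  shows "det_on (insert t J) a = (a t t - (\<Sum>s\<in>J. c s * a s t)) * det_on J a"
proof -
  let ?J = "insert t J"
  \<comment> \<open>\<open>D r\<close> is the determinant with row \<open>t\<close> replaced by
    \<open>r\<close>; it is linear in \<open>r\<close>.\<close>
  define D where "D r = (\<Sum>p | p permutes ?J. of_int (sign p) * (r (p t) * (\<Prod>i\<in>J. a i (p i))))" for r
  have D_det: "det_on ?J (\<lambda>i. if i = t then r else a i) = D r" for r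
    unfolding det_on_def D_def
  proof (intro sum.cong refl arg_cong2[where f="(*)"])
    fix p
    have "(\<Prod>i\<in>?J. (if i = t then r else a i) (p i)) = r (p t) * (\<Prod>i\<in>J. (if i = t then r else a i) (p i))"
      using fin t by simp
    also have "(\<Prod>i\<in>J. (if i = t then r else a i) (p i)) = (\<Prod>i\<in>J. a i (p i))"
      using t by (intro prod.cong) auto
    finally show "(\<Prod>i\<in>?J. (if i = t then r else a i) (p i)) = r (p t) * (\<Prod>i\<in>J. a i (p i))" .
  qed
  have finp: "finite {p. p permutes ?J}" using fin by (simp add: finite_permutations)
  define r0 where "r0 j = a t j - (\<Sum>s\<in>J. c s * a s j)" for j
  have "det_on ?J a = D (a t)"
    unfolding D_det[symmetric] by (rule det_on_cong) simp
  also have "a t = (\<lambda>j. r0 j + (\<Sum>s\<in>J. c s * a s j))" by (auto simp: r0_def)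
  also have "D \<dots> = D r0 + (\<Sum>s\<in>J. c s * D (a s))"
  proof -
    have "D (\<lambda>j. r0 j + (\<Sum>s\<in>J. c s * a s j)) = D r0 + D (\<lambda>j. \<Sum>s\<in>J. c s * a s j)"
      unfolding D_def by (simp add: algebra_simps sum.distrib)
    also have "D (\<lambda>j. \<Sum>s\<in>J. c s * a s j) = (\<Sum>p | p permutes ?J. \<Sum>s\<in>J. c s * (of_int (sign p) * (a s (p t) * (\<Prod>i\<in>J. a i (p i)))))"
      unfolding D_def sum_distrib_right sum_distrib_left by (intro sum.cong refl) (simp add: ac_simps)
    also have "\<dots> = (\<Sum>s\<in>J. c s * D (a s))"
      unfolding D_def by (subst sum.swap) (simp add: sum_distrib_left)
    finally show ?thesis .
  qed
  also have "(\<Sum>s\<in>J. c s * D (a s)) = 0"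
  proof (intro sum.neutral ballI)
    fix s assume s: "s \<in> J"
    have "D (a s) = 0" unfolding D_det[symmetric]
      by (rule det_on_eq_rows[of _ s t]) (use s t fin in auto)
    then show "c s * D (a s) = 0" by simp
  qed
  \<comment> \<open>\<open>r0\<close> vanishes on \<open>J\<close>, so a permutation contributes
    only if it fixes \<open>t\<close>.\<close>
  also have "D r0 = (\<Sum>p | p permutes J. of_int (sign p) * (r0 (p t) * (\<Prod>i\<in>J. a i (p i))))"
    unfolding D_def
  proof (rule sum.mono_neutral_right[OF finp])
    show "{p. p permutes J} \<subseteq> {p. p permutes insert t J}" by (auto intro: permutes_subset)
    show "\<forall>p\<in>{p. p permutes insert t J} - {p. p permutes J}.
       complex_of_int (sign p) * (r0 (p t) * (\<Prod>i\<in>J. a i (p i))) = 0"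
    proof
      fix p assume p: "p \<in> {p. p permutes insert t J} - {p. p permutes J}"
      then have "p t \<noteq> t" using permutes_insert_fixed[OF t, of p] by auto
      moreover have "p t \<in> ?J" using p permutes_in_image[of p ?J t] by simp
      ultimately have "p t \<in> J" by simp
      then have "r0 (p t) = 0" using c by (simp add: r0_def)
      then show "complex_of_int (sign p) * (r0 (p t) * (\<Prod>i\<in>J. a i (p i))) = 0" by simp
    qed
  qed
  also have "\<dots> = r0 t * det_on J a"
    unfolding det_on_def sum_distrib_left
    by (intro sum.cong refl) (use t in \<open>auto simp: permutes_not_in\<close>)
  finally show ?thesis by (simp add: r0_def)
qed

section \<open>Invariance of determinants under injective relabelling\<close>

lemma bij_imp_permutes_fix:
  assumes "bij f" "\<And>x. x \<notin> S \<Longrightarrow> f x = x"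
  shows "f permutes S"
  using assms unfolding permutes_def by (metis bij_pointE)

text \<open>Conjugation by \<open>f\<close> matches the permutations of \<open>J\<close> with those
  of \<open>S\<close>; the signs of \<open>f\<close> and of its inverse cancel.\<close>

lemma det_on_reindex_permutes:
  assumes "finite S" "f permutes U" "finite U" "f ` J = S"
  shows "det_on S a = det_on J (\<lambda>i j. a (f i) (f j))"
proof -
  have f: "bij f" using assms(2) by (simp add: permutes_bij)
  have inj: "inj f" using f by (simp add: bij_is_inj)
  have finJ: "finite J" using assms(1,4) inj by (metis finite_imageD inj_on_subset subset_UNIV)
  have fp: "permutation f" using assms by (auto simp: permutation_permutes)
  have fip: "permutation (inv_into UNIV f)" using fp by (simp add: permutation_inverse)
  have sf: "sign (inv_into UNIV f) = sign f" using fp by (rule sign_inverse)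
  have ff: "f (inv_into UNIV f x) = x" "inv_into UNIV f (f x) = x" for x
    using f by (auto simp: bij_is_surj surj_f_inv_f inj inv_f_f)
  have S: "S = f ` J" using assms by simp
  show ?thesis unfolding det_on_def
  proof (rule sum.reindex_bij_witness[where i="\<lambda>p. f \<circ> p \<circ> inv_into UNIV f" and j="\<lambda>p. inv_into UNIV f \<circ> p \<circ> f"])
    fix p assume "p \<in> {p. p permutes S}"
    then have p: "p permutes S" by simp
    show "f \<circ> (inv_into UNIV f \<circ> p \<circ> f) \<circ> inv_into UNIV f = p" by (auto simp: ff fun_eq_iff)
    have pp: "permutation p" using p assms(1) by (auto simp: permutation_permutes)
    show "inv_into UNIV f \<circ> p \<circ> f \<in> {p. p permutes J}"
    proof (simp, rule bij_imp_permutes_fix)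
      show "bij (inv_into UNIV f \<circ> p \<circ> f)"
        by (intro bij_comp f bij_imp_bij_inv permutes_bij[OF p])
      fix x assume "x \<notin> J"
      then have "f x \<notin> S" using inj by (auto simp: S inj_def)
      then show "(inv_into UNIV f \<circ> p \<circ> f) x = x" by (simp add: permutes_not_in[OF p] ff)
    qed
    have "sign (inv_into UNIV f \<circ> p \<circ> f) = sign (inv_into UNIV f) * sign p * sign f"
      using fp fip pp by (simp add: sign_compose permutation_compose)
    also have "\<dots> = sign p" unfolding sf by (simp add: sign_def)
    finally have sg: "sign (inv_into UNIV f \<circ> p \<circ> f) = sign p" .
    have "(\<Prod>i\<in>S. a i (p i)) = (\<Prod>i\<in>J. a (f i) (p (f i)))"
      unfolding S by (subst prod.reindex) (use inj in \<open>auto intro: inj_on_subset\<close>)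
    then show "of_int (sign (inv_into UNIV f \<circ> p \<circ> f)) * (\<Prod>i\<in>J. a (f i) (f ((inv_into UNIV f \<circ> p \<circ> f) i))) = of_int (sign p) * (\<Prod>i\<in>S. a i (p i))"
      by (simp add: sg ff)
  next
    fix p assume "p \<in> {p. p permutes J}"
    then have p: "p permutes J" by simp
    show "inv_into UNIV f \<circ> (f \<circ> p \<circ> inv_into UNIV f) \<circ> f = p" by (auto simp: ff fun_eq_iff)
    show "f \<circ> p \<circ> inv_into UNIV f \<in> {p. p permutes S}"
    proof (simp, rule bij_imp_permutes_fix)
      show "bij (f \<circ> p \<circ> inv_into UNIV f)"
        by (intro bij_comp f bij_imp_bij_inv permutes_bij[OF p])
      fix x assume "x \<notin> S"
      then have "inv_into UNIV f x \<notin> J" using ff(1)[of x] by (metis S imageI)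
      then show "(f \<circ> p \<circ> inv_into UNIV f) x = x" by (simp add: permutes_not_in[OF p] ff)
    qed
  qed
qed

text \<open>Conjugation needs a permutation of the whole type with finite support. An injection on
  \<open>J\<close> extends to one because \<open>J\<close> and its image have complements of equal
  size in their union.\<close>

lemma inj_on_extends_permutes:
  assumes "finite J" "inj_on f J"
  obtains g U where "g permutes U" "finite U" "\<And>x. x \<in> J \<Longrightarrow> g x = f x"
proof -
  let ?U = "J \<union> f ` J"
  have fin: "finite ?U" using assms by simp
  have "card (?U - J) = card (?U - f ` J)"
    using assms by (simp add: card_Diff_subset card_image finite_subset)
  then obtain h where h: "bij_betw h (?U - J) (?U - f ` J)"
    using fin by (meson finite_Diff finite_same_card_bij)
  define g where "g x = (if x \<in> J then f x else if x \<in> ?U then h x else x)" for x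
  have "bij_betw g (J \<union> (?U - J)) (f ` J \<union> (?U - f ` J))"
  proof (rule bij_betw_combine)
    show "bij_betw g J (f ` J)" using assms by (simp add: g_def bij_betw_def inj_on_def)
    show "bij_betw g (?U - J) (?U - f ` J)"
      using h by (rule bij_betw_cong[THEN iffD1, rotated]) (auto simp: g_def)
  qed auto
  then have "bij_betw g ?U ?U" by (simp add: Un_absorb1 Un_absorb2 Un_commute)
  then have "g permutes ?U" by (rule bij_imp_permutes) (auto simp: g_def)
  then show ?thesis using fin that[of g ?U] by (auto simp: g_def)
qed

lemma det_on_reindex:
  fixes f :: "'i \<Rightarrow> 'i"
  assumes "finite J" "inj_on f J"
  shows "det_on (f ` J) a = det_on J (\<lambda>i j. a (f i) (f j))"
proof -
  obtain g U where g: "g permutes U" "finite U" "\<And>x. x \<in> J \<Longrightarrow> g x = f x"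
    using inj_on_extends_permutes[OF assms] by metis
  have "det_on (f ` J) a = det_on J (\<lambda>i j. a (g i) (g j))"
    by (rule det_on_reindex_permutes[OF _ g(1,2)]) (use assms g(3) in auto)
  also have "\<dots> = det_on J (\<lambda>i j. a (f i) (f j))" by (rule det_on_cong) (simp add: g(3))
  finally show ?thesis .
qed

text \<open>In the expanded product over the rows, \<open>S\<close> is the set of rows from which
  \<open>- a\<close> is taken; the identity entries of the other rows annihilate every permutation
  that moves a point outside \<open>S\<close>.\<close>

lemma det_on_minus_identity:
  assumes "finite I"
  shows "det_on I (\<lambda>i j. of_bool (i = j) - a i j) = (\<Sum>S\<in>Pow I. (-1) ^ card S * det_on S a)"
proof -
  have fP: "finite {p. p permutes I}" using assms by (simp add: finite_permutations)
  have "det_on I (\<lambda>i j. of_bool (i = j) - a i j) =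
    (\<Sum>p | p permutes I. \<Sum>S\<in>Pow I. of_int (sign p) * ((\<Prod>i\<in>S. - a i (p i)) * (\<Prod>i\<in>I - S. of_bool (i = p i))))"
    unfolding det_on_def
  proof (intro sum.cong refl)
    fix p
    have "(\<Prod>i\<in>I. of_bool (i = p i) - a i (p i)) = (\<Prod>i\<in>I. - a i (p i) + of_bool (i = p i))" by simp
    also have "\<dots> = (\<Sum>S\<in>Pow I. (\<Prod>i\<in>S. - a i (p i)) * (\<Prod>i\<in>I - S. of_bool (i = p i)))"
      by (rule prod_add[OF assms])
    finally show "of_int (sign p) * (\<Prod>i\<in>I. of_bool (i = p i) - a i (p i)) =
      (\<Sum>S\<in>Pow I. of_int (sign p) * ((\<Prod>i\<in>S. - a i (p i)) * (\<Prod>i\<in>I - S. of_bool (i = p i))))"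
      by (simp add: sum_distrib_left)
  qed
  also have "\<dots> = (\<Sum>S\<in>Pow I. \<Sum>p | p permutes I. of_int (sign p) * ((\<Prod>i\<in>S. - a i (p i)) * (\<Prod>i\<in>I - S. of_bool (i = p i))))"
    by (rule sum.swap)
  also have "\<dots> = (\<Sum>S\<in>Pow I. (-1) ^ card S * det_on S a)"
  proof (intro sum.cong refl)
    fix S assume "S \<in> Pow I"
    then have SI: "S \<subseteq> I" by simp
    have "(\<Sum>p | p permutes I. of_int (sign p) * ((\<Prod>i\<in>S. - a i (p i)) * (\<Prod>i\<in>I - S. of_bool (i = p i)))) =
      (\<Sum>p | p permutes S. of_int (sign p) * ((\<Prod>i\<in>S. - a i (p i)) * (\<Prod>i\<in>I - S. of_bool (i = p i))) :: complex)"
    proof (rule sum.mono_neutral_right[OF fP])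
      show "{p. p permutes S} \<subseteq> {p. p permutes I}" using SI by (auto intro: permutes_subset)
      show "\<forall>p\<in>{p. p permutes I} - {p. p permutes S}.
         of_int (sign p) * ((\<Prod>i\<in>S. - a i (p i)) * (\<Prod>i\<in>I - S. of_bool (i = p i))) = (0::complex)"
      proof
        fix p assume p: "p \<in> {p. p permutes I} - {p. p permutes S}"
        then obtain x where x: "x \<in> I - S" "p x \<noteq> x"
          using permutes_superset[of p I S] by auto
        then have "(\<Prod>i\<in>I - S. of_bool (i = p i)) = (0::complex)"
          using assms by (intro prod_zero) (auto intro!: bexI[of _ x])
        then show "of_int (sign p) * ((\<Prod>i\<in>S. - a i (p i)) * (\<Prod>i\<in>I - S. of_bool (i = p i))) = (0::complex)" by simp
      qed
    qed
    also have "\<dots> = (\<Sum>p | p permutes S. (-1) ^ card S * (of_int (sign p) * (\<Prod>i\<in>S. a i (p i))))"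
    proof (rule sum.cong[OF refl])
      fix p assume "p \<in> {p. p permutes S}"
      then have "(\<Prod>i\<in>I - S. of_bool (i = p i)) = (1::complex)"
        by (intro prod.neutral) (auto simp: permutes_not_in)
      then show "of_int (sign p) * ((\<Prod>i\<in>S. - a i (p i)) * (\<Prod>i\<in>I - S. of_bool (i = p i))) =
        (-1) ^ card S * (of_int (sign p) * (\<Prod>i\<in>S. a i (p i)))"
        by (simp add: prod_uminus)
    qed
    finally show "(\<Sum>p | p permutes I. of_int (sign p) * ((\<Prod>i\<in>S. - a i (p i)) * (\<Prod>i\<in>I - S. of_bool (i = p i)))) =
      (-1) ^ card S * det_on S a"
      by (simp add: det_on_def sum_distrib_left)
  qed
  finally show ?thesis .
qed

section \<open>Positive semidefinite kernels\<close>

text \<open>The index type may be infinite, so that one notion covers kernels on the space, Gram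
  matrices of sequences and their finite restrictions.\<close>

definition psd :: "('i \<Rightarrow> 'i \<Rightarrow> complex) \<Rightarrow> bool" where
  "psd a \<longleftrightarrow> (\<forall>i j. a i j = cnj (a j i)) \<and>
     (\<forall>S c. finite S \<longrightarrow> 0 \<le> Re (\<Sum>i\<in>S. \<Sum>j\<in>S. c i * cnj (c j) * a i j))"

lemma psd_cnj: "psd a \<Longrightarrow> cnj (a j i) = a i j"
  unfolding psd_def by (metis (full_types))

lemma psd_form: "psd a \<Longrightarrow> finite S \<Longrightarrow> 0 \<le> Re (\<Sum>i\<in>S. \<Sum>j\<in>S. c i * cnj (c j) * a i j)"
  unfolding psd_def by blast

lemma psd_diag: assumes "psd a" shows "Im (a i i) = 0" "0 \<le> Re (a i i)"
proof -
  show "Im (a i i) = 0" using psd_cnj[OF assms, of i i] by (simp add: complex_eq_iff)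
  show "0 \<le> Re (a i i)" using psd_form[OF assms, of "{i}" "\<lambda>_. 1"] by simp
qed

lemma psd_diag_of_real: assumes "psd a" shows "a i i = of_real (Re (a i i))"
  using psd_diag[OF assms, of i] by (simp add: complex_eq_iff)

lemma psd_zero_diag:
  assumes "psd a" "a i i = 0" shows "a i j = 0"
proof (cases "i = j")
  case False
  show ?thesis
  proof (rule ccontr)
    assume nz: "a i j \<noteq> 0"
    define N where "N = Re (a j j)"
    have N: "N \<ge> 0" using psd_diag[OF assms(1)] by (simp add: N_def)
    \<comment> \<open>The test vector \<open>c\<close> gives the form the value
      \<open>N - 2 T |a i j|^2\<close>; this \<open>T\<close> makes it \<open>- N - 2\<close>, which
      is negative.\<close>
    define T where "T = (N + 1) / (cmod (a i j))\<^sup>2"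
    define c where "c k = (if k = i then - of_real T * cnj (a i j) else 1)" for k
    have ajj: "a j j = of_real N" unfolding N_def by (rule psd_diag_of_real[OF assms(1)])
    have aji: "a j i = cnj (a i j)" using psd_cnj[OF assms(1), of i j] by simp
    have sq: "cnj (a i j) * a i j = of_real ((cmod (a i j))\<^sup>2)"
      by (metis complex_norm_square mult.commute)
    have "(\<Sum>k\<in>{i,j}. \<Sum>l\<in>{i,j}. c k * cnj (c l) * a k l) =
       - of_real T * (cnj (a i j) * a i j) - of_real T * (cnj (a i j) * a i j) + of_real N"
      using False assms(2) by (simp add: c_def ajj aji algebra_simps)
    also have "\<dots> = of_real (N - 2 * (N + 1))"
      unfolding sq using nz by (simp add: T_def field_simps flip: of_real_power)
    finally have "Re (\<Sum>k\<in>{i,j}. \<Sum>l\<in>{i,j}. c k * cnj (c l) * a k l) = N - 2 * (N + 1)"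
      by (metis Re_complex_of_real)
    then show False using psd_form[OF assms(1), of "{i,j}" c] N by simp
  qed
qed (use assms in simp)

text \<open>\<open>C\<close> takes the part of the rows of \<open>a\<close> over \<open>S\<close>
  multiplied by the inverse of the block. The residual form at \<open>w\<close> is the form of
  \<open>a\<close> at \<open>w\<close> minus the combination that \<open>C\<close> moves onto
  \<open>S\<close>, hence nonnegative.\<close>

lemma psd_schur:
  assumes a: "psd a" and fin: "finite S"
    and C: "\<And>i j. j \<in> S \<Longrightarrow> a i j = (\<Sum>s\<in>S. C i s * a s j)"
  shows "psd (\<lambda>i j. a i j - (\<Sum>s\<in>S. C i s * a s j))" (is "psd ?b")
proof -
  have b_zero: "?b i j = 0" if "j \<in> S" for i j using C[OF that, of i] by simp
  \<comment> \<open>Using the relation for \<open>C\<close> in both arguments writes the correction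
    as a form in the rows of \<open>C\<close>, from which its Hermitian symmetry can be read
    off.\<close>
  have corr: "(\<Sum>s\<in>S. C i s * a s j) = (\<Sum>s\<in>S. \<Sum>t\<in>S. C i s * cnj (C j t) * a s t)" for i j
  proof -
    have "(\<Sum>s\<in>S. C i s * a s j) = (\<Sum>s\<in>S. C i s * cnj (a j s))"
      by (simp add: psd_cnj[OF a])
    also have "\<dots> = (\<Sum>s\<in>S. C i s * cnj (\<Sum>t\<in>S. C j t * a t s))"
      by (intro sum.cong refl) (simp flip: C)
    also have "\<dots> = (\<Sum>s\<in>S. \<Sum>t\<in>S. C i s * cnj (C j t) * a s t)"
      by (simp add: sum_distrib_left psd_cnj[OF a] ac_simps)
    finally show ?thesis .
  qed
  have herm: "?b i j = cnj (?b j i)" for i j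
  proof -
    have "cnj (\<Sum>s\<in>S. \<Sum>t\<in>S. C j s * cnj (C i t) * a s t) = (\<Sum>s\<in>S. \<Sum>t\<in>S. C i s * cnj (C j t) * a s t)"
      by (subst sum.swap) (simp add: psd_cnj[OF a] ac_simps)
    then show ?thesis unfolding corr by (simp add: psd_cnj[OF a])
  qed
  have pos: "0 \<le> Re (\<Sum>i\<in>T. \<Sum>j\<in>T. w i * cnj (w j) * ?b i j)" if T: "finite T" for T w
  proof -
    \<comment> \<open>\<open>u\<close> corrects \<open>w\<close> on \<open>S\<close> so that its
      image \<open>L\<close> under \<open>a\<close> vanishes there; in the other argument only the
      values of \<open>w\<close> then survive.\<close>
    define u where "u s = (if s \<in> T then w s else 0) - (if s \<in> S then \<Sum>i\<in>T. w i * C i s else 0)" for s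
    define L where "L j = (\<Sum>i\<in>T \<union> S. u i * a i j)" for j
    have L: "L j = (\<Sum>i\<in>T. w i * ?b i j)" for j
    proof -
      have "L j = (\<Sum>i\<in>T \<union> S. (if i \<in> T then w i else 0) * a i j) - (\<Sum>s\<in>T \<union> S. (if s \<in> S then \<Sum>i\<in>T. w i * C i s else 0) * a s j)"
        unfolding L_def u_def by (simp add: left_diff_distrib sum_subtractf)
      also have "(\<Sum>i\<in>T \<union> S. (if i \<in> T then w i else 0) * a i j) = (\<Sum>i\<in>T. w i * a i j)"
        by (rule sum.mono_neutral_cong_right) (use T fin in auto)
      also have "(\<Sum>s\<in>T \<union> S. (if s \<in> S then \<Sum>i\<in>T. w i * C i s else 0) * a s j) = (\<Sum>s\<in>S. (\<Sum>i\<in>T. w i * C i s) * a s j)"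
        by (rule sum.mono_neutral_cong_right) (use T fin in auto)
      also have "\<dots> = (\<Sum>i\<in>T. w i * (\<Sum>s\<in>S. C i s * a s j))"
        unfolding sum_distrib_right sum_distrib_left by (subst sum.swap) (simp add: ac_simps)
      finally show ?thesis by (simp add: right_diff_distrib sum_subtractf)
    qed
    have "(\<Sum>i\<in>T \<union> S. \<Sum>j\<in>T \<union> S. u i * cnj (u j) * a i j) = (\<Sum>j\<in>T \<union> S. cnj (u j) * L j)"
      unfolding L_def sum_distrib_left by (subst sum.swap) (simp add: ac_simps)
    also have "\<dots> = (\<Sum>j\<in>T. cnj (w j) * L j)"
    proof (rule sum.mono_neutral_cong_right)
      have LS: "L j = 0" if "j \<in> S" for j unfolding L by (simp only: b_zero[OF that] mult_zero_right sum.neutral_const)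
      show "\<forall>i\<in>T \<union> S - T. cnj (u i) * L i = 0" using LS by auto
      show "cnj (u x) * L x = cnj (w x) * L x" if "x \<in> T" for x
        using LS[of x] that by (cases "x \<in> S") (auto simp: u_def)
    qed (use T fin in auto)
    also have "\<dots> = (\<Sum>i\<in>T. \<Sum>j\<in>T. w i * cnj (w j) * ?b i j)"
      unfolding L sum_distrib_left by (subst sum.swap) (simp add: ac_simps)
    finally show ?thesis using psd_form[OF a, of "T \<union> S" u] T fin by simp
  qed
  show ?thesis unfolding psd_def using herm pos by blast
qed

text \<open>The subtracted term is the form of \<open>a\<close> at \<open>c\<close>, hence
  nonnegative.\<close>

lemma psd_schur_diag_le:
  assumes a: "psd a" and fin: "finite S"
    and C: "\<And>j. j \<in> S \<Longrightarrow> a i j = (\<Sum>s\<in>S. c s * a s j)"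
  shows "Re (a i i - (\<Sum>s\<in>S. c s * a s i)) \<le> Re (a i i)"
proof -
  have "(\<Sum>s\<in>S. c s * a s i) = (\<Sum>s\<in>S. c s * cnj (a i s))"
    by (simp add: psd_cnj[OF a])
  also have "\<dots> = (\<Sum>s\<in>S. c s * cnj (\<Sum>t\<in>S. c t * a t s))"
    by (intro sum.cong refl) (simp flip: C)
  also have "\<dots> = (\<Sum>s\<in>S. \<Sum>t\<in>S. c s * cnj (c t) * a s t)"
    by (simp add: sum_distrib_left psd_cnj[OF a] ac_simps)
  finally show ?thesis using psd_form[OF a fin, of c] by simp
qed

text \<open>Elimination one index at a time with pivot \<open>b t t\<close>. A vanishing pivot is
  harmless: positivity then forces the whole column \<open>b i t\<close> to vanish.\<close>

lemma psd_residual: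
  assumes a: "psd a" and fin: "finite S"
  shows "\<exists>C. \<forall>i. \<forall>j\<in>S. a i j = (\<Sum>s\<in>S. C i s * a s j)"
  using fin
proof (induction S)
  case (insert t S)
  then obtain C where C: "\<And>i j. j \<in> S \<Longrightarrow> a i j = (\<Sum>s\<in>S. C i s * a s j)" by blast
  define b where "b i j = a i j - (\<Sum>s\<in>S. C i s * a s j)" for i j
  have b: "psd b" unfolding b_def by (rule psd_schur[OF a insert(1) C])
  have bS: "b i j = 0" if "j \<in> S" for i j using C[OF that, of i] by (simp add: b_def)
  \<comment> \<open>Division by a zero pivot yields 0, which is the right coefficient in that
    case.\<close>
  define l where "l i = b i t / b t t" for i
  have l: "b i t = l i * b t t" for i
  proof (cases "b t t = 0")
    case True
    then have "b t i = 0" by (rule psd_zero_diag[OF b])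
    then have "b i t = 0" using psd_cnj[OF b, of t i] by simp
    then show ?thesis using True by simp
  qed (simp add: l_def)
  define E where "E i s = (if s = t then l i else C i s - l i * C t s)" for i s
  have "a i j = (\<Sum>s\<in>insert t S. E i s * a s j)" if "j \<in> insert t S" for i j
  proof -
    have "(\<Sum>s\<in>insert t S. E i s * a s j) = l i * a t j + (\<Sum>s\<in>S. E i s * a s j)"
      using insert by (simp add: E_def)
    also have "(\<Sum>s\<in>S. E i s * a s j) = (\<Sum>s\<in>S. C i s * a s j) - l i * (\<Sum>s\<in>S. C t s * a s j)"
      using insert(2) unfolding sum_distrib_left sum_subtractf[symmetric]
      by (intro sum.cong) (auto simp: E_def algebra_simps)
    also have "l i * a t j + \<dots> = l i * b t j + (a i j - b i j)" by (simp add: b_def algebra_simps)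
    also have "b i j = l i * b t j" using that l bS by auto
    finally show ?thesis by simp
  qed
  then show ?case by blast
qed simp

text \<open>Schur's determinant formula, by induction on \<open>J'\<close>: adding \<open>t\<close>
  multiplies both sides by the same pivot.\<close>

lemma det_on_block:
  assumes a: "psd a" and fin: "finite J" "finite J'" and disj: "J \<inter> J' = {}"
    and C: "\<And>i j. j \<in> J \<Longrightarrow> a i j = (\<Sum>s\<in>J. C i s * a s j)"
  shows "det_on (J \<union> J') a = det_on J a * det_on J' (\<lambda>i j. a i j - (\<Sum>s\<in>J. C i s * a s j))"
  using fin(2) disj
proof (induction J')
  case (insert t J')
  define b where "b i j = a i j - (\<Sum>s\<in>J. C i s * a s j)" for i j
  have b: "psd b" unfolding b_def by (rule psd_schur[OF a fin(1) C])
  have bJ: "b i j = 0" if "j \<in> J" for i j using C[OF that, of i] by (simp add: b_def)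
  obtain E where E: "\<And>i j. j \<in> J' \<Longrightarrow> b i j = (\<Sum>s\<in>J'. E i s * b s j)"
    using psd_residual[OF b insert(1)] by blast
  \<comment> \<open>Elimination of row \<open>t\<close> over \<open>J \<union> J'\<close>:
    \<open>C\<close> removes the part over \<open>J\<close>, \<open>E\<close> the residual part over
    \<open>J'\<close>, and the multiples of rows in \<open>J\<close> hidden in the residual rows
    used by \<open>E\<close> are given back.\<close>
  define c where "c s = (if s \<in> J' then E t s else C t s - (\<Sum>q\<in>J'. E t q * C q s))" for s
  have csum: "(\<Sum>s\<in>J \<union> J'. c s * a s j) = a t j - b t j + (\<Sum>s\<in>J'. E t s * b s j)" for j
  proof -
    have "(\<Sum>s\<in>J \<union> J'. c s * a s j) = (\<Sum>s\<in>J. c s * a s j) + (\<Sum>s\<in>J'. c s * a s j)"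
      by (rule sum.union_disjoint) (use insert fin in auto)
    also have "(\<Sum>s\<in>J'. c s * a s j) = (\<Sum>s\<in>J'. E t s * a s j)"
      by (intro sum.cong) (auto simp: c_def)
    also have "(\<Sum>s\<in>J. c s * a s j) = (\<Sum>s\<in>J. (C t s - (\<Sum>q\<in>J'. E t q * C q s)) * a s j)"
      using insert by (intro sum.cong) (auto simp: c_def)
    also have "\<dots> = (\<Sum>s\<in>J. C t s * a s j) - (\<Sum>q\<in>J'. E t q * (\<Sum>s\<in>J. C q s * a s j))"
      unfolding left_diff_distrib sum_subtractf sum_distrib_left sum_distrib_right
      by (subst (2) sum.swap) (simp add: ac_simps)
    finally show ?thesis by (simp add: b_def algebra_simps sum_subtractf)
  qed
  have "det_on (insert t (J \<union> J')) a = (a t t - (\<Sum>s\<in>J \<union> J'. c s * a s t)) * det_on (J \<union> J') a"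
  proof (rule det_on_insert)
    fix j assume "j \<in> J \<union> J'"
    then show "a t j = (\<Sum>s\<in>J \<union> J'. c s * a s j)"
      unfolding csum using bJ E by (cases "j \<in> J") auto
  qed (use insert fin in auto)
  moreover have "det_on (insert t J') b = (b t t - (\<Sum>s\<in>J'. E t s * b s t)) * det_on J' b"
    by (rule det_on_insert) (use insert E in auto)
  ultimately show ?case using insert unfolding csum b_def[symmetric] by simp
qed simp

text \<open>\<open>r\<close> is the diagonal entry at \<open>t\<close> of the Schur complement of
  \<open>J\<close>.\<close>

lemma det_on_insert_psd:
  assumes a: "psd a" and fin: "finite J" and t: "t \<notin> J"
  obtains r where "0 \<le> r" "r \<le> Re (a t t)" "det_on (insert t J) a = of_real r * det_on J a"
proof -
  obtain C where C: "\<And>i j. j \<in> J \<Longrightarrow> a i j = (\<Sum>s\<in>J. C i s * a s j)"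
    using psd_residual[OF a fin] by blast
  define b where "b i j = a i j - (\<Sum>s\<in>J. C i s * a s j)" for i j
  have b: "psd b" unfolding b_def by (rule psd_schur[OF a fin C])
  have "det_on (insert t J) a = b t t * det_on J a"
    unfolding b_def by (rule det_on_insert[OF fin t C])
  moreover have "Re (b t t) \<le> Re (a t t)"
    unfolding b_def by (rule psd_schur_diag_le[OF a fin, of t "C t", OF C])
  ultimately show ?thesis
    using that[of "Re (b t t)"] psd_diag[OF b, of t] psd_diag_of_real[OF b, of t] by simp
qed

text \<open>The determinant is a product of successive pivots, each between 0 and the diagonal
  entry. The lower bound makes the densities below nonnegative, the upper bound supplies the
  dominating functions.\<close>

lemma psd_det_on_hadamard:
  assumes a: "psd a" and fin: "finite J"
  shows "Im (det_on J a) = 0 \<and> 0 \<le> Re (det_on J a) \<and> Re (det_on J a) \<le> (\<Prod>i\<in>J. Re (a i i))"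
  using fin
proof (induction J)
  case (insert t J)
  obtain r where r: "0 \<le> r" "r \<le> Re (a t t)" "det_on (insert t J) a = of_real r * det_on J a"
    using det_on_insert_psd[OF a insert(1,2)] by blast
  have "r * Re (det_on J a) \<le> Re (a t t) * (\<Prod>i\<in>J. Re (a i i))"
    using insert r by (intro mult_mono) auto
  then show ?case using r insert by simp
qed simp

text \<open>\<open>f\<close> may fail to be injective, as points of a tuple may repeat: the
  coefficients over a fibre are added up to one coefficient \<open>d p\<close>.\<close>

lemma psd_pullback:
  assumes a: "psd a" shows "psd (\<lambda>i j. a (f i) (f j))"
  unfolding psd_def
proof (intro conjI allI impI)
  fix S :: "'b set" and c :: "'b \<Rightarrow> complex" assume S: "finite S"
  define d where "d p = (\<Sum>i\<in>{i\<in>S. f i = p}. c i)" for p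
  have one: "(\<Sum>i\<in>S. c i * g (f i)) = (\<Sum>p\<in>f ` S. d p * g p)" for g
  proof -
    have "(\<Sum>i\<in>S. c i * g (f i)) = (\<Sum>p\<in>f ` S. \<Sum>i\<in>{i\<in>S. f i = p}. c i * g (f i))"
      by (rule sum.image_gen[OF S])
    also have "\<dots> = (\<Sum>p\<in>f ` S. d p * g p)"
      unfolding d_def sum_distrib_right by (intro sum.cong) auto
    finally show ?thesis .
  qed
  have "(\<Sum>i\<in>S. \<Sum>j\<in>S. c i * cnj (c j) * a (f i) (f j)) = (\<Sum>i\<in>S. c i * (\<Sum>j\<in>S. cnj (c j) * a (f i) (f j)))"
    by (simp add: sum_distrib_left ac_simps)
  also have "\<dots> = (\<Sum>p\<in>f`S. d p * (\<Sum>j\<in>S. cnj (c j) * a p (f j)))"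
    by (rule one)
  also have "\<dots> = (\<Sum>p\<in>f`S. d p * cnj (\<Sum>j\<in>S. c j * cnj (a p (f j))))" by simp
  also have "\<dots> = (\<Sum>p\<in>f`S. d p * cnj (\<Sum>q\<in>f`S. d q * cnj (a p q)))"
    by (simp only: one[of "\<lambda>q. cnj (a _ q)"])
  also have "\<dots> = (\<Sum>p\<in>f`S. \<Sum>q\<in>f`S. d p * cnj (d q) * a p q)"
    by (simp add: sum_distrib_left ac_simps)
  finally show "0 \<le> Re (\<Sum>i\<in>S. \<Sum>j\<in>S. c i * cnj (c j) * a (f i) (f j))"
    using psd_form[OF a, of "f ` S" d] S by simp
qed (simp add: psd_cnj[OF a])

section \<open>Fredholm series and Gram determinants\<close>

lemma card_inj_PiE:
  assumes "finite J" "finite T"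
  shows "finite {f \<in> J \<rightarrow>\<^sub>E T. inj_on f J}"
    and "card {f \<in> J \<rightarrow>\<^sub>E T. inj_on f J} = fact (card J) * (card T choose card J)"
proof -
  have fin: "finite {f \<in> J \<rightarrow>\<^sub>E T. inj_on f J}" if "finite J" for J :: "'a set"
    using that assms by (simp add: finite_PiE)
  show "finite {f \<in> J \<rightarrow>\<^sub>E T. inj_on f J}" by (rule fin[OF assms(1)])
  show "card {f \<in> J \<rightarrow>\<^sub>E T. inj_on f J} = fact (card J) * (card T choose card J)"
    using assms(1)
  proof (induction J)
    case empty
    have "{f \<in> {} \<rightarrow>\<^sub>E T. inj_on f {}} = {\<lambda>_. undefined}" by auto
    then show ?case by simp
  next
    case (insert t J)
    let ?I = "{f \<in> J \<rightarrow>\<^sub>E T. inj_on f J}"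
    have upd: "inj_on (f(t := v)) (insert t J) \<longleftrightarrow> inj_on f J \<and> v \<notin> f ` J" for f :: "'a \<Rightarrow> 'b" and v
    proof -
      have "inj_on (f(t := v)) J = inj_on f J" "(f(t := v)) ` J = f ` J"
        using insert(2) by (auto intro!: inj_on_cong)
      then show ?thesis using insert(2) by (simp add: inj_on_insert)
    qed
    have eq: "{f \<in> insert t J \<rightarrow>\<^sub>E T. inj_on f (insert t J)} = (\<lambda>(f, v). f(t := v)) ` (SIGMA f:?I. T - f ` J)"
      unfolding PiE_insert_eq
    proof (intro equalityI subsetI)
      fix f assume "f \<in> {f \<in> (\<lambda>(y, g). g(t := y)) ` (T \<times> (J \<rightarrow>\<^sub>E T)). inj_on f (insert t J)}"
      then obtain v g where "f = g(t := v)" "v \<in> T" "g \<in> J \<rightarrow>\<^sub>E T" "inj_on (g(t := v)) (insert t J)" by auto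
      then show "f \<in> (\<lambda>(f, v). f(t := v)) ` (SIGMA f:?I. T - f ` J)"
        unfolding upd by (intro image_eqI[of _ _ "(g, v)"]) auto
    next
      fix f assume "f \<in> (\<lambda>(f, v). f(t := v)) ` (SIGMA f:?I. T - f ` J)"
      then obtain g v where "f = g(t := v)" "g \<in> ?I" "v \<in> T - g ` J" by auto
      then show "f \<in> {f \<in> (\<lambda>(y, g). g(t := y)) ` (T \<times> (J \<rightarrow>\<^sub>E T)). inj_on f (insert t J)}"
        using upd[of g v] by auto
    qed
    have "inj_on (\<lambda>(f, v). f(t := v)) (SIGMA f:?I. T - f ` J)"
    proof (rule inj_onI)
      fix p q assume p: "p \<in> (SIGMA f:?I. T - f ` J)" and q: "q \<in> (SIGMA f:?I. T - f ` J)"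
        and e: "(\<lambda>(f, v). f(t := v)) p = (\<lambda>(f, v). f(t := v)) q"
      obtain f v g w where [simp]: "p = (f, v)" "q = (g, w)" by fastforce
      have e': "f(t := v) = g(t := w)" using e by simp
      have "v = w" using fun_cong[OF e', of t] by simp
      moreover have "f = g"
      proof (rule PiE_ext[of f J "\<lambda>_. T" g])
        show "f i = g i" if "i \<in> J" for i using fun_cong[OF e', of i] that insert(2) by (auto split: if_splits)
      qed (use p q in auto)
      ultimately show "p = q" by simp
    qed
    then have "card {f \<in> insert t J \<rightarrow>\<^sub>E T. inj_on f (insert t J)} = card (SIGMA f:?I. T - f ` J)"
      unfolding eq by (rule card_image)
    also have "\<dots> = (\<Sum>f\<in>?I. card (T - f ` J))"
      using fin[OF insert(1)] assms(2) by (intro card_SigmaI) auto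
    also have "\<dots> = (\<Sum>f\<in>?I. card T - card J)"
      using insert(1) by (intro sum.cong refl) (auto simp: card_Diff_subset card_image PiE_def Pi_def image_subset_iff)
    also have "\<dots> = fact (card J) * ((card T - card J) * (card T choose card J))"
      using insert by simp
    also have "(card T - card J) * (card T choose card J) = Suc (card J) * (card T choose Suc (card J))"
      by (simp only: binomial_absorb_comp binomial_absorption)
    finally show ?case using insert(1,2) by (simp add: algebra_simps)
  qed
qed

text \<open>A non-injective \<open>f\<close> repeats a row and contributes 0. An injective one
  contributes the minor over its image, and every \<open>S\<close> of the right size is the image of
  \<open>fact (card J)\<close> injections.\<close>

lemma sum_det_on_PiE:
  fixes I :: "'i set" and J :: "'i set"
  assumes "finite I" "finite J"
  shows "(\<Sum>f\<in>J \<rightarrow>\<^sub>E I. det_on J (\<lambda>i j. G (f i) (f j))) =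
    fact (card J) * (\<Sum>S | S \<subseteq> I \<and> card S = card J. det_on S G)"
proof -
  let ?F = "{f \<in> J \<rightarrow>\<^sub>E I. inj_on f J}"
  have finF: "finite ?F" using assms by (simp add: finite_PiE)
  have "(\<Sum>f\<in>J \<rightarrow>\<^sub>E I. det_on J (\<lambda>i j. G (f i) (f j))) = (\<Sum>f\<in>?F. det_on J (\<lambda>i j. G (f i) (f j)))"
  proof (rule sum.mono_neutral_right)
    show "\<forall>f\<in>(J \<rightarrow>\<^sub>E I) - ?F. det_on J (\<lambda>i j. G (f i) (f j)) = 0"
    proof
      fix f assume "f \<in> (J \<rightarrow>\<^sub>E I) - ?F"
      then obtain s t where "s \<in> J" "t \<in> J" "s \<noteq> t" "f s = f t" by (auto simp: inj_on_def)
      then show "det_on J (\<lambda>i j. G (f i) (f j)) = 0" using assms by (intro det_on_eq_rows[of _ s t]) auto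
    qed
  qed (use assms in \<open>auto simp: finite_PiE\<close>)
  also have "\<dots> = (\<Sum>f\<in>?F. det_on (f ` J) G)"
    using assms by (intro sum.cong) (auto simp: det_on_reindex)
  also have "\<dots> = (\<Sum>S | S \<subseteq> I \<and> card S = card J. \<Sum>f | f \<in> ?F \<and> f ` J = S. det_on (f ` J) G)"
    by (rule sum.group[symmetric]) (use assms finF in \<open>auto simp: card_image PiE_def Pi_def\<close>)
  also have "\<dots> = (\<Sum>S | S \<subseteq> I \<and> card S = card J. fact (card J) * det_on S G)"
  proof (intro sum.cong refl)
    fix S assume "S \<in> {S. S \<subseteq> I \<and> card S = card J}"
    then have S: "S \<subseteq> I" "card S = card J" "finite S" using assms(1) finite_subset by auto
    have "{f. f \<in> ?F \<and> f ` J = S} = {f \<in> J \<rightarrow>\<^sub>E S. inj_on f J}"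
    proof (intro Set.set_eqI iffI)
      fix f assume "f \<in> {f \<in> J \<rightarrow>\<^sub>E S. inj_on f J}"
      then have f: "f \<in> J \<rightarrow>\<^sub>E S" "inj_on f J" by auto
      have "f ` J \<subseteq> S" using f by auto
      moreover have "card (f ` J) = card S" using f S by (simp add: card_image)
      ultimately have "f ` J = S" using S(3) by (simp add: card_subset_eq)
      then show "f \<in> {f. f \<in> ?F \<and> f ` J = S}" using f S by auto
    qed (auto simp: PiE_def Pi_def)
    then have "(\<Sum>f | f \<in> ?F \<and> f ` J = S. det_on (f ` J) G) = (\<Sum>f\<in>{f \<in> J \<rightarrow>\<^sub>E S. inj_on f J}. det_on S G)"
      by (intro sum.cong) auto
    also have "\<dots> = fact (card J) * det_on S G"
      using card_inj_PiE(2)[OF assms(2) S(3)] S(2) by simp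
    finally show "(\<Sum>f | f \<in> ?F \<and> f ` J = S. det_on (f ` J) G) = fact (card J) * det_on S G" .
  qed
  finally show ?thesis by (simp add: sum_distrib_left)
qed

text \<open>Andreief's identity. Each entry is a sum over \<open>s\<close>, so the determinant
  expands over the maps \<open>f\<close> from \<open>J\<close> to \<open>I\<close>; by Fubini every
  resulting integral of a product factors into entries of the Gram matrix.\<close>

lemma andreief:
  fixes \<mu> :: "'a measure" and g :: "'s \<Rightarrow> 'a \<Rightarrow> complex"
  assumes sf: "product_sigma_finite (\<lambda>_::'i. \<mu>)" and fin: "finite I" "finite J"
    and int: "\<And>s t. s \<in> I \<Longrightarrow> t \<in> I \<Longrightarrow> integrable \<mu> (\<lambda>x. g s x * cnj (g t x))"
  shows "integrable (PiM J (\<lambda>_::'i. \<mu>)) (\<lambda>y. det_on J (\<lambda>i j. \<Sum>s\<in>I. g s (y i) * cnj (g s (y j))))" (is ?thesis1)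
    and "(\<integral>y. det_on J (\<lambda>i j. \<Sum>s\<in>I. g s (y i) * cnj (g s (y j))) \<partial>PiM J (\<lambda>_::'i. \<mu>)) =
    (\<Sum>f\<in>J \<rightarrow>\<^sub>E I. det_on J (\<lambda>i j. \<integral>x. g (f i) x * cnj (g (f j) x) \<partial>\<mu>))"
proof -
  interpret product_sigma_finite "\<lambda>_::'i. \<mu>" by fact
  let ?G = "\<lambda>s t. \<integral>x. g s x * cnj (g t x) \<partial>\<mu>"
  let ?h = "\<lambda>p f i x. g (f i) x * cnj (g (f (inv_into UNIV p i)) x)"
  let ?P = "{p. p permutes J}"
  have expand: "det_on J (\<lambda>i j. \<Sum>s\<in>I. g s (y i) * cnj (g s (y j))) =
     (\<Sum>p\<in>?P. \<Sum>f\<in>J \<rightarrow>\<^sub>E I. of_int (sign p) * (\<Prod>i\<in>J. ?h p f i (y i)))" for y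
    unfolding det_on_def
  proof (rule sum.cong[OF refl])
    fix p assume "p \<in> ?P"
    then have p: "p permutes J" by simp
    have "(\<Prod>i\<in>J. \<Sum>s\<in>I. g s (y i) * cnj (g s (y (p i)))) =
       (\<Sum>f\<in>J \<rightarrow>\<^sub>E I. \<Prod>i\<in>J. g (f i) (y i) * cnj (g (f i) (y (p i))))"
      by (rule prod_sum_PiE) (use fin in auto)
    also have "\<dots> = (\<Sum>f\<in>J \<rightarrow>\<^sub>E I. \<Prod>i\<in>J. ?h p f i (y i))"
    proof (rule sum.cong[OF refl])
      fix f
      \<comment> \<open>Reindexing by \<open>p\<close> collects the two factors that contain the
        same variable \<open>y i\<close>, so that the product splits over the coordinates.\<close>
      have "(\<Prod>i\<in>J. cnj (g (f i) (y (p i)))) = (\<Prod>i\<in>J. cnj (g (f (inv_into UNIV p (p i))) (y (p i))))"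
        using permutes_inverses[OF p] by simp
      also have "\<dots> = (\<Prod>i\<in>J. cnj (g (f (inv_into UNIV p i)) (y i)))"
        by (rule prod.reindex_bij_betw[OF permutes_imp_bij[OF p], of "\<lambda>i. cnj (g (f (inv_into UNIV p i)) (y i))"])
      finally show "(\<Prod>i\<in>J. g (f i) (y i) * cnj (g (f i) (y (p i)))) = (\<Prod>i\<in>J. ?h p f i (y i))"
        by (simp add: prod.distrib)
    qed
    finally show "of_int (sign p) * (\<Prod>i\<in>J. \<Sum>s\<in>I. g s (y i) * cnj (g s (y (p i)))) =
      (\<Sum>f\<in>J \<rightarrow>\<^sub>E I. of_int (sign p) * (\<Prod>i\<in>J. ?h p f i (y i)))"
      by (simp add: sum_distrib_left)
  qed
  have hint: "integrable \<mu> (?h p f i)" if "p \<in> ?P" "f \<in> J \<rightarrow>\<^sub>E I" "i \<in> J" for p f i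
  proof -
    have "inv_into UNIV p permutes J" using that by (simp add: permutes_inv)
    then have "inv_into UNIV p i \<in> J" using that(3) permutes_in_image[of "inv_into UNIV p" J i] by simp
    then show ?thesis using that by (intro int) auto
  qed
  have Pint: "integrable (PiM J (\<lambda>_. \<mu>)) (\<lambda>y. \<Prod>i\<in>J. ?h p f i (y i))" if "p \<in> ?P" "f \<in> J \<rightarrow>\<^sub>E I" for p f
    using hint[OF that] by (intro product_integrable_prod fin)
  show ?thesis1 unfolding expand using Pint by auto
  have "(\<integral>y. det_on J (\<lambda>i j. \<Sum>s\<in>I. g s (y i) * cnj (g s (y j))) \<partial>PiM J (\<lambda>_. \<mu>)) =
    (\<Sum>p\<in>?P. \<Sum>f\<in>J \<rightarrow>\<^sub>E I. of_int (sign p) * (\<integral>y. (\<Prod>i\<in>J. ?h p f i (y i)) \<partial>PiM J (\<lambda>_. \<mu>)))"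
    unfolding expand using Pint by (simp add: Bochner_Integration.integral_sum)
  also have "\<dots> = (\<Sum>p\<in>?P. \<Sum>f\<in>J \<rightarrow>\<^sub>E I. of_int (sign p) * (\<Prod>i\<in>J. ?G (f i) (f (inv_into UNIV p i))))"
    by (intro sum.cong refl arg_cong2[where f="(*)"] product_integral_prod fin(2) hint)
  also have "\<dots> = (\<Sum>f\<in>J \<rightarrow>\<^sub>E I. \<Sum>p\<in>?P. of_int (sign p) * (\<Prod>i\<in>J. ?G (f i) (f (inv_into UNIV p i))))"
    by (rule sum.swap)
  also have "\<dots> = (\<Sum>f\<in>J \<rightarrow>\<^sub>E I. det_on J (\<lambda>i j. ?G (f i) (f j)))"
  proof (rule sum.cong[OF refl])
    fix f
    have "(\<Sum>p\<in>?P. of_int (sign p) * (\<Prod>i\<in>J. ?G (f i) (f (inv_into UNIV p i)))) =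
       (\<Sum>p\<in>?P. of_int (sign (inv_into UNIV p)) * (\<Prod>i\<in>J. ?G (f i) (f (inv_into UNIV p i))))"
      by (intro sum.cong refl) (use fin in \<open>auto simp: sign_inverse permutes_imp_permutation\<close>)
    also have "\<dots> = det_on J (\<lambda>i j. ?G (f i) (f j))"
      unfolding det_on_def by (rule sum_permutations_inverse[symmetric])
    finally show "(\<Sum>p\<in>?P. of_int (sign p) * (\<Prod>i\<in>J. ?G (f i) (f (inv_into UNIV p i)))) = det_on J (\<lambda>i j. ?G (f i) (f j))" .
  qed
  finally show "(\<integral>y. det_on J (\<lambda>i j. \<Sum>s\<in>I. g s (y i) * cnj (g s (y j))) \<partial>PiM J (\<lambda>_. \<mu>)) =
    (\<Sum>f\<in>J \<rightarrow>\<^sub>E I. det_on J (\<lambda>i j. ?G (f i) (f j)))" .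
qed

lemma cnj_measurable [measurable (raw)]:
  "f \<in> borel_measurable M \<Longrightarrow> (\<lambda>x. cnj (f x)) \<in> borel_measurable M"
  by (rule measurable_compose[OF _ borel_measurable_continuous_onI]) (auto intro: continuous_intros)

lemma det_on_measurable [measurable (raw)]:
  assumes "\<And>i j. i \<in> J \<Longrightarrow> j \<in> J \<Longrightarrow> (\<lambda>y. a y i j) \<in> borel_measurable M"
  shows "(\<lambda>y. det_on J (a y)) \<in> borel_measurable M"
  unfolding det_on_def
  by (intro borel_measurable_sum borel_measurable_times borel_measurable_const borel_measurable_prod assms)
     (auto simp: permutes_in_image)

lemma kernel_coord_measurable:
  assumes k: "case_prod k \<in> borel_measurable (\<mu> \<Otimes>\<^sub>M \<mu>)" and "i \<in> J" "j \<in> J"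
  shows "(\<lambda>y. k (y i) (y j)) \<in> borel_measurable (PiM J (\<lambda>_. \<mu>))"
proof -
  have "(\<lambda>y. (y i, y j)) \<in> PiM J (\<lambda>_. \<mu>) \<rightarrow>\<^sub>M \<mu> \<Otimes>\<^sub>M \<mu>"
    using assms by measurable
  from measurable_compose[OF this k] show ?thesis by simp
qed

section \<open>Fredholm determinants as limits of finite-rank ones\<close>

text \<open>
  The Fredholm determinant of \<open>I - k\<close>, i.e. the probability that a determinantal process with kernel
  \<open>k\<close> has no point at all. The index \<open>n\<close> only shifts the names of the integration variables.
\<close>

definition gap :: "'a measure \<Rightarrow> ('a \<Rightarrow> 'a \<Rightarrow> complex) \<Rightarrow> nat \<Rightarrow> real" where
  "gap \<mu> k n = (\<Sum>m. (-1) ^ m / fact m *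
     (\<integral>y. Re (det_on {n..<n+m} (\<lambda>i j. k (y i) (y j))) \<partial>PiM {n..<n+m} (\<lambda>_. \<mu>)))"

context
  fixes \<mu> :: "'a measure" and \<kappa> :: "'a \<Rightarrow> real"
  assumes sf: "sigma_finite_measure \<mu>" and \<kappa>: "integrable \<mu> \<kappa>"
begin

interpretation product_sigma_finite "\<lambda>_::nat. \<mu>"
  by (simp add: product_sigma_finite_def sf)

text \<open>Hadamard's bound by a product of values of \<open>\<kappa>\<close> integrates to a power
  of the integral of \<open>\<kappa>\<close>. Together with the factor \<open>1 / fact m\<close>
  this gives an exponential majorant for the series in \<open>m\<close>.\<close>

lemma det_on_psd_integral_bound:
  assumes k: "psd k" "case_prod k \<in> borel_measurable (\<mu> \<Otimes>\<^sub>M \<mu>)" "\<And>x. Re (k x x) \<le> \<kappa> x" and J: "finite (J :: nat set)"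
  shows "integrable (PiM J (\<lambda>_. \<mu>)) (\<lambda>y. Re (det_on J (\<lambda>i j. k (y i) (y j))))"
    and "integrable (PiM J (\<lambda>_. \<mu>)) (\<lambda>y. \<Prod>i\<in>J. \<kappa> (y i))"
    and "\<And>y. \<bar>Re (det_on J (\<lambda>i j. k (y i) (y j)))\<bar> \<le> (\<Prod>i\<in>J. \<kappa> (y i))"
    and "(\<integral>y. (\<Prod>i\<in>J. \<kappa> (y i)) \<partial>PiM J (\<lambda>_. \<mu>)) = integral\<^sup>L \<mu> \<kappa> ^ card J"
proof -
  show i2: "integrable (PiM J (\<lambda>_. \<mu>)) (\<lambda>y. \<Prod>i\<in>J. \<kappa> (y i))"
    by (rule product_integrable_prod[OF J, of "\<lambda>_. \<kappa>"]) (rule \<kappa>)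
  show b: "\<bar>Re (det_on J (\<lambda>i j. k (y i) (y j)))\<bar> \<le> (\<Prod>i\<in>J. \<kappa> (y i))" for y
  proof -
    have p: "psd (\<lambda>i j. k (y i) (y j))" by (rule psd_pullback[OF k(1)])
    have "Re (det_on J (\<lambda>i j. k (y i) (y j))) \<le> (\<Prod>i\<in>J. Re (k (y i) (y i)))"
      using psd_det_on_hadamard[OF p J] by simp
    also have "\<dots> \<le> (\<Prod>i\<in>J. \<kappa> (y i))"
      using psd_diag[OF k(1)] k(3) by (intro prod_mono) auto
    finally show ?thesis using psd_det_on_hadamard[OF p J] by simp
  qed
  show "(\<integral>y. (\<Prod>i\<in>J. \<kappa> (y i)) \<partial>PiM J (\<lambda>_. \<mu>)) = integral\<^sup>L \<mu> \<kappa> ^ card J"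
    using product_integral_prod[OF J, of "\<lambda>_. \<kappa>"] \<kappa> by simp
  show "integrable (PiM J (\<lambda>_. \<mu>)) (\<lambda>y. Re (det_on J (\<lambda>i j. k (y i) (y j))))"
  proof (rule Bochner_Integration.integrable_bound[OF i2])
    show "(\<lambda>y. Re (det_on J (\<lambda>i j. k (y i) (y j)))) \<in> borel_measurable (PiM J (\<lambda>_. \<mu>))"
      by (intro borel_measurable_Re[THEN measurable_compose[rotated]] det_on_measurable kernel_coord_measurable k)
    show "AE y in PiM J (\<lambda>_. \<mu>). norm (Re (det_on J (\<lambda>i j. k (y i) (y j)))) \<le> norm (\<Prod>i\<in>J. \<kappa> (y i))"
      using b by (auto intro!: AE_I2 order_trans[OF _ abs_ge_self])
  qed
qed

lemma gap_term_bound: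
  assumes k: "psd k" "case_prod k \<in> borel_measurable (\<mu> \<Otimes>\<^sub>M \<mu>)" "\<And>x. Re (k x x) \<le> \<kappa> x"
  shows "\<bar>\<integral>y. Re (det_on {n..<n+m} (\<lambda>i j. k (y i) (y j))) \<partial>PiM {n..<n+m} (\<lambda>_. \<mu>)\<bar> \<le> integral\<^sup>L \<mu> \<kappa> ^ m"
proof -
  let ?J = "{n..<n+m}"
  have "\<bar>\<integral>y. Re (det_on ?J (\<lambda>i j. k (y i) (y j))) \<partial>PiM ?J (\<lambda>_. \<mu>)\<bar> \<le> (\<integral>y. (\<Prod>i\<in>?J. \<kappa> (y i)) \<partial>PiM ?J (\<lambda>_. \<mu>))"
    using det_on_psd_integral_bound[OF k, of ?J]
    by (intro order_trans[OF integral_abs_bound] integral_mono) auto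
  then show ?thesis using det_on_psd_integral_bound(4)[OF k, of ?J] by simp
qed

text \<open>Dominated convergence in each integral and then in the series, with an exponential
  majorant that does not depend on \<open>N\<close>.\<close>

lemma gap_tendsto:
  assumes k: "\<And>N::nat. psd (k N)" "\<And>N. case_prod (k N) \<in> borel_measurable (\<mu> \<Otimes>\<^sub>M \<mu>)" "\<And>N x. Re (k N x x) \<le> \<kappa> x"
    and lim: "\<And>x y. (\<lambda>N. k N x y) \<longlonglongrightarrow> l x y"
    and l: "psd l" "case_prod l \<in> borel_measurable (\<mu> \<Otimes>\<^sub>M \<mu>)" "\<And>x. Re (l x x) \<le> \<kappa> x"
  shows "(\<lambda>N. gap \<mu> (k N) n) \<longlonglongrightarrow> gap \<mu> l n"
proof -
  have detlim: "(\<lambda>N. Re (det_on J (\<lambda>i j. k N (y i) (y j)))) \<longlonglongrightarrow> Re (det_on J (\<lambda>i j. l (y i) (y j)))" for J :: "nat set" and y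
    unfolding det_on_def by (intro tendsto_intros lim)
  have intlim: "(\<lambda>N. \<integral>y. Re (det_on J (\<lambda>i j. k N (y i) (y j))) \<partial>PiM J (\<lambda>_. \<mu>)) \<longlonglongrightarrow>
     (\<integral>y. Re (det_on J (\<lambda>i j. l (y i) (y j))) \<partial>PiM J (\<lambda>_. \<mu>))" if J: "finite J" for J :: "nat set"
  proof (rule integral_dominated_convergence[where w="\<lambda>y. \<Prod>i\<in>J. \<kappa> (y i)"])
    show "integrable (PiM J (\<lambda>_. \<mu>)) (\<lambda>y. \<Prod>i\<in>J. \<kappa> (y i))" by (rule det_on_psd_integral_bound(2)[OF l J])
    show "(\<lambda>y. Re (det_on J (\<lambda>i j. l (y i) (y j)))) \<in> borel_measurable (PiM J (\<lambda>_. \<mu>))"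
      using det_on_psd_integral_bound(1)[OF l J] by simp
    show "(\<lambda>y. Re (det_on J (\<lambda>i j. k N (y i) (y j)))) \<in> borel_measurable (PiM J (\<lambda>_. \<mu>))" for N
      using det_on_psd_integral_bound(1)[OF k J] by simp
    show "AE y in PiM J (\<lambda>_. \<mu>). norm (Re (det_on J (\<lambda>i j. k N (y i) (y j)))) \<le> (\<Prod>i\<in>J. \<kappa> (y i))" for N
      using det_on_psd_integral_bound(3)[OF k J] by simp
    show "AE y in PiM J (\<lambda>_. \<mu>). (\<lambda>N. Re (det_on J (\<lambda>i j. k N (y i) (y j)))) \<longlonglongrightarrow> Re (det_on J (\<lambda>i j. l (y i) (y j)))"
      by (intro AE_I2 detlim)
  qed
  let ?M = "\<lambda>m. integral\<^sup>L \<mu> \<kappa> ^ m / fact m"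
  have M: "summable ?M"
    using summable_exp[of "integral\<^sup>L \<mu> \<kappa>"] by (simp add: field_simps)
  show ?thesis
    unfolding gap_def
  proof (rule tannerys_theorem[THEN conjunct2, THEN conjunct2, OF _ _ M])
    show "(\<lambda>N. (- 1) ^ m / fact m * (\<integral>y. Re (det_on {n..<n + m} (\<lambda>i j. k N (y i) (y j))) \<partial>PiM {n..<n+m} (\<lambda>_. \<mu>)))
       \<longlonglongrightarrow> (- 1) ^ m / fact m * (\<integral>y. Re (det_on {n..<n + m} (\<lambda>i j. l (y i) (y j))) \<partial>PiM {n..<n+m} (\<lambda>_. \<mu>))" for m
      by (intro tendsto_intros intlim) simp
    show "\<forall>\<^sub>F (m, N) in at_top \<times>\<^sub>F sequentially. norm ((- 1) ^ m / fact m * (\<integral>y. Re (det_on {n..<n + m} (\<lambda>i j. k N (y i) (y j))) \<partial>PiM {n..<n+m} (\<lambda>_. \<mu>))) \<le> ?M m"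
      using gap_term_bound[OF k, of n] by (intro always_eventually) (auto simp: abs_mult power_abs divide_right_mono)
  qed simp
qed

end

lemma Re_of_real_mult: "Re (of_real r * z) = r * Re z"
  by simp

lemma Re_minus_one_power_mult: "Re ((-1) ^ m * z) = (-1) ^ m * Re z"
  by (cases "even m") auto

text \<open>By Andreief's identity the \<open>m\<close>-th term is \<open>(-1) ^ m\<close> times the
  sum of the principal minors of size \<open>m\<close> of the Gram matrix, and these terms add up to
  the expansion of \<open>det(I - G)\<close>.\<close>

lemma gap_finite_rank:
  fixes \<mu> :: "'a measure" and g :: "nat \<Rightarrow> 'a \<Rightarrow> complex"
  assumes sf: "sigma_finite_measure \<mu>" and fin: "finite I"
    and int: "\<And>s t. integrable \<mu> (\<lambda>x. g s x * cnj (g t x))"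
  shows "gap \<mu> (\<lambda>x y. \<Sum>s\<in>I. g s x * cnj (g s y)) n =
    Re (det_on I (\<lambda>s t. of_bool (s = t) - (\<integral>x. g s x * cnj (g t x) \<partial>\<mu>)))"
proof -
  have psf: "product_sigma_finite (\<lambda>_::nat. \<mu>)" by (simp add: product_sigma_finite_def sf)
  let ?G = "\<lambda>s t. \<integral>x. g s x * cnj (g t x) \<partial>\<mu>"
  let ?D = "\<lambda>m. \<Sum>S | S \<subseteq> I \<and> card S = m. det_on S ?G"
  have summand: "(-1) ^ m / fact m * (\<integral>y. Re (det_on {n..<n+m} (\<lambda>i j. \<Sum>s\<in>I. g s (y i) * cnj (g s (y j)))) \<partial>PiM {n..<n+m} (\<lambda>_. \<mu>)) =
     (-1) ^ m * Re (?D m)" for m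
  proof -
    have "(\<integral>y. Re (det_on {n..<n+m} (\<lambda>i j. \<Sum>s\<in>I. g s (y i) * cnj (g s (y j)))) \<partial>PiM {n..<n+m} (\<lambda>_. \<mu>)) =
       Re (\<Sum>f\<in>{n..<n+m} \<rightarrow>\<^sub>E I. det_on {n..<n+m} (\<lambda>i j. ?G (f i) (f j)))"
      by (rule trans[OF integral_Re[OF andreief(1)[OF psf fin finite_atLeastLessThan int]]
            arg_cong[where f=Re, OF andreief(2)[OF psf fin finite_atLeastLessThan int]]])
    also have "\<dots> = Re (of_real (fact m) * ?D m)"
      by (subst sum_det_on_PiE[OF fin finite_atLeastLessThan]) simp
    also have "\<dots> = fact m * Re (?D m)"
      by (simp only: Re_of_real_mult)
    finally show ?thesis by simp
  qed
  have "gap \<mu> (\<lambda>x y. \<Sum>s\<in>I. g s x * cnj (g s y)) n = (\<Sum>m. (-1) ^ m * Re (?D m))"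
    unfolding gap_def summand ..
  also have "\<dots> = (\<Sum>m\<le>card I. (-1) ^ m * Re (?D m))"
  proof (rule suminf_finite)
    fix m assume "m \<notin> {..card I}"
    then have e: "{S. S \<subseteq> I \<and> card S = m} = {}" using card_mono[OF fin] by auto
    show "(-1) ^ m * Re (?D m) = 0" unfolding e by simp
  qed simp
  also have "\<dots> = (\<Sum>m\<le>card I. \<Sum>S | S \<in> Pow I \<and> card S = m. Re ((-1) ^ card S * det_on S ?G))"
    by (intro sum.cong refl) (simp add: sum_distrib_left Re_minus_one_power_mult)
  also have "\<dots> = (\<Sum>S\<in>Pow I. Re ((-1) ^ card S * det_on S ?G))"
    by (rule sum.group) (use fin in \<open>auto intro: card_mono\<close>)
  also have "\<dots> = Re (det_on I (\<lambda>s t. of_bool (s = t) - ?G s t))"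
    unfolding det_on_minus_identity[OF fin] by simp
  finally show ?thesis .
qed


lemma psd_limit:
  fixes k :: "nat \<Rightarrow> 'i \<Rightarrow> 'i \<Rightarrow> complex"
  assumes "\<And>N::nat. psd (k N)" and lim: "\<And>x y. (\<lambda>N. k N x y) \<longlonglongrightarrow> l x y"
  shows "psd l"
  unfolding psd_def
proof (intro conjI allI impI)
  fix i j
  have "(\<lambda>N. cnj (k N j i)) \<longlonglongrightarrow> cnj (l j i)" by (intro tendsto_intros lim)
  then have "(\<lambda>N. k N i j) \<longlonglongrightarrow> cnj (l j i)" by (simp add: psd_cnj[OF assms(1)])
  then show "l i j = cnj (l j i)" using lim LIMSEQ_unique by blast
next
  fix S :: "'i set" and c :: "'i \<Rightarrow> complex" assume S: "finite S"
  have "(\<lambda>N. Re (\<Sum>i\<in>S. \<Sum>j\<in>S. c i * cnj (c j) * k N i j)) \<longlonglongrightarrow> Re (\<Sum>i\<in>S. \<Sum>j\<in>S. c i * cnj (c j) * l i j)"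
    by (intro tendsto_intros lim)
  then show "0 \<le> Re (\<Sum>i\<in>S. \<Sum>j\<in>S. c i * cnj (c j) * l i j)"
    by (rule LIMSEQ_le_const) (use psd_form[OF assms(1) S] in blast)
qed

lemma psd_finite_rank:
  fixes g :: "'s \<Rightarrow> 'a \<Rightarrow> complex"
  assumes "finite I"
  shows "psd (\<lambda>x y. \<Sum>s\<in>I. g s x * cnj (g s y))"
  unfolding psd_def
proof (intro conjI allI impI)
  fix S :: "'a set" and c :: "'a \<Rightarrow> complex" assume S: "finite S"
  have "(\<Sum>i\<in>S. \<Sum>j\<in>S. c i * cnj (c j) * (\<Sum>s\<in>I. g s i * cnj (g s j))) =
     (\<Sum>i\<in>S. \<Sum>s\<in>I. \<Sum>j\<in>S. (c i * g s i) * cnj (c j * g s j))"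
    unfolding sum_distrib_left
    by (intro sum.cong refl, subst sum.swap) (simp add: ac_simps)
  also have "\<dots> = (\<Sum>s\<in>I. \<Sum>i\<in>S. \<Sum>j\<in>S. (c i * g s i) * cnj (c j * g s j))"
    by (rule sum.swap)
  also have "\<dots> = (\<Sum>s\<in>I. (\<Sum>i\<in>S. c i * g s i) * cnj (\<Sum>i\<in>S. c i * g s i))"
    by (simp add: sum_product)
  also have "\<dots> = (\<Sum>s\<in>I. of_real ((cmod (\<Sum>i\<in>S. c i * g s i))\<^sup>2))"
    by (simp only: complex_norm_square)
  finally show "0 \<le> Re (\<Sum>i\<in>S. \<Sum>j\<in>S. c i * cnj (c j) * (\<Sum>s\<in>I. g s i * cnj (g s j)))"
    by (simp add: sum_nonneg flip: of_real_sum)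
qed (simp add: ac_simps)

lemma Re_mult_cnj_self: "Re (z * cnj z) = (cmod z)\<^sup>2"
  by (metis Re_complex_of_real complex_norm_square)

text \<open>Reduces summability and integrability of products to those of squares.\<close>

lemma norm_mult_cnj_le: "cmod (a * cnj b) \<le> (cmod a)\<^sup>2 + (cmod b)\<^sup>2"
proof -
  have "2 * (cmod a * cmod b) \<le> (cmod a)\<^sup>2 + (cmod b)\<^sup>2"
    using sum_squares_bound[of "cmod a" "cmod b"] by simp
  moreover have "0 \<le> cmod a * cmod b" by (intro mult_nonneg_nonneg norm_ge_zero)
  ultimately show ?thesis unfolding norm_mult complex_mod_cnj by linarith
qed

text \<open>
  By \<open>gap_finite_rank\<close>, truncations of \<open>gap \<mu> (\<tau> n)\<close> are determinants of \<open>I - G\<close> over indices \<open>\<ge> n\<close>.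
  The index \<open>n\<close> contributes a factor, a diagonal entry of a Schur complement, that lies in \<open>[0, 1]\<close>.
\<close>

lemma gap_tail:
  fixes \<mu> :: "'a measure" and g :: "nat \<Rightarrow> 'a \<Rightarrow> complex"
  assumes sf: "sigma_finite_measure \<mu>" and \<kappa>: "integrable \<mu> \<kappa>"
    and g: "\<And>s. g s \<in> borel_measurable \<mu>"
    and sq: "\<And>x. summable (\<lambda>s. (cmod (g s x))\<^sup>2)" "\<And>x. (\<Sum>s. (cmod (g s x))\<^sup>2) \<le> \<kappa> x"
    and contr: "psd (\<lambda>s t. of_bool (s = t) - (\<integral>x. g s x * cnj (g t x) \<partial>\<mu>))"
  defines "\<tau> \<equiv> \<lambda>n x y. \<Sum>s. g (n + s) x * cnj (g (n + s) y)"
  shows "(\<lambda>s. g (n + s) x * cnj (g (n + s) y)) sums \<tau> n x y"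
    and "psd (\<tau> n)" and "case_prod (\<tau> n) \<in> borel_measurable (\<mu> \<Otimes>\<^sub>M \<mu>)" and "Re (\<tau> n x x) \<le> \<kappa> x"
    and "0 \<le> gap \<mu> (\<tau> n) i" and "gap \<mu> (\<tau> n) i \<le> gap \<mu> (\<tau> (Suc n)) j"
proof -
  define k where "k n N x y = (\<Sum>s\<in>{n..<n+N}. g s x * cnj (g s y))" for n N x y
  let ?G = "\<lambda>s t. \<integral>x. g s x * cnj (g t x) \<partial>\<mu>"
  let ?a = "\<lambda>s t. of_bool (s = t) - ?G s t"
  have part: "(\<Sum>s\<in>I. (cmod (g s x))\<^sup>2) \<le> \<kappa> x" if "finite I" for I x
    using sum_le_suminf[OF sq(1) that] sq(2) by (meson order_trans zero_le_power2)
  have sm: "summable (\<lambda>s. g (n + s) x * cnj (g (n + s) y))" for n x y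
  proof (rule summable_comparison_test'[where N=0])
    have "summable (\<lambda>s. (cmod (g (n + s) x))\<^sup>2)" for x
      using summable_ignore_initial_segment[OF sq(1), of n] by (simp add: add.commute)
    then show "summable (\<lambda>s. (cmod (g (n + s) x))\<^sup>2 + (cmod (g (n + s) y))\<^sup>2)"
      by (intro summable_add)
  qed (rule norm_mult_cnj_le)
  show sums: "(\<lambda>s. g (n + s) x * cnj (g (n + s) y)) sums \<tau> n x y" for n x y
    unfolding \<tau>_def using sm by (rule summable_sums)
  have lim: "(\<lambda>N. k n N x y) \<longlonglongrightarrow> \<tau> n x y" for n x y
  proof -
    have "k n N x y = (\<Sum>s<N. g (n + s) x * cnj (g (n + s) y))" for N
      unfolding k_def by (rule sum.reindex_bij_witness[where i="\<lambda>s. n + s" and j="\<lambda>s. s - n"]) auto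
    then show ?thesis using sums[of n x y] by (simp add: sums_def)
  qed
  have k_psd: "psd (k n N)" for n N unfolding k_def by (rule psd_finite_rank) simp
  have k_meas: "case_prod (k n N) \<in> borel_measurable (\<mu> \<Otimes>\<^sub>M \<mu>)" for n N
    unfolding k_def case_prod_beta using g by measurable
  have k_diag: "Re (k n N x x) \<le> \<kappa> x" for n N x
    unfolding k_def using part[of "{n..<n+N}" x] by (simp only: Re_sum Re_mult_cnj_self) simp
  show t_psd: "psd (\<tau> n)" for n by (rule psd_limit[OF k_psd lim])
  show t_meas: "case_prod (\<tau> n) \<in> borel_measurable (\<mu> \<Otimes>\<^sub>M \<mu>)" for n
    by (rule borel_measurable_LIMSEQ_metric[OF k_meas[of n]]) (auto simp: case_prod_beta intro: lim)
  show t_diag: "Re (\<tau> n x x) \<le> \<kappa> x" for n x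
    by (rule LIMSEQ_le_const2[OF tendsto_Re[OF lim[of n x x]]]) (use k_diag in blast)
  have gl: "(\<lambda>N. gap \<mu> (k n N) i) \<longlonglongrightarrow> gap \<mu> (\<tau> n) i" for n i
    by (rule gap_tendsto[OF sf \<kappa> k_psd k_meas k_diag lim t_psd t_meas t_diag])
  have int: "integrable \<mu> (\<lambda>x. g s x * cnj (g t x))" for s t
  proof (rule Bochner_Integration.integrable_bound)
    show "integrable \<mu> (\<lambda>x. 2 * \<kappa> x)" using \<kappa> by simp
    show "AE x in \<mu>. norm (g s x * cnj (g t x)) \<le> norm (2 * \<kappa> x)"
    proof (rule AE_I2)
      fix x
      show "norm (g s x * cnj (g t x)) \<le> norm (2 * \<kappa> x)"
        using norm_mult_cnj_le[of "g s x" "g t x"] part[of "{s}" x] part[of "{t}" x] by simp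
    qed
  qed (use g in measurable)
  have gap_k: "gap \<mu> (k n N) i = Re (det_on {n..<n+N} ?a)" for n N i
    unfolding k_def by (rule gap_finite_rank[OF sf _ int]) simp
  show "0 \<le> gap \<mu> (\<tau> n) i"
    by (rule LIMSEQ_le_const[OF gl]) (use psd_det_on_hadamard[OF contr] in \<open>auto simp: gap_k\<close>)
  \<comment> \<open>Both truncations end at the index \<open>n + N\<close> and differ only by the
    member \<open>n\<close>. Its pivot is at most 1, because the diagonal of a Gram matrix is
    nonnegative.\<close>
  have step: "gap \<mu> (k n (Suc N)) i \<le> gap \<mu> (k (Suc n) N) j" for N
  proof -
    have "Re (?a n n) \<le> 1"
    proof -
      have "?G n n = (\<integral>x. of_real ((cmod (g n x))\<^sup>2) \<partial>\<mu>)" by (simp only: complex_norm_square)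
      also have "\<dots> = of_real (\<integral>x. (cmod (g n x))\<^sup>2 \<partial>\<mu>)" by (rule integral_complex_of_real)
      finally show ?thesis by simp
    qed
    moreover obtain r where r: "0 \<le> r" "r \<le> Re (?a n n)"
        "det_on (insert n {Suc n..<Suc n + N}) ?a = of_real r * det_on {Suc n..<Suc n + N} ?a"
      by (rule det_on_insert_psd[OF contr, of "{Suc n..<Suc n + N}" n]) auto
    moreover have "insert n {Suc n..<Suc n + N} = {n..<n + Suc N}" by auto
    ultimately show ?thesis
      using psd_det_on_hadamard[OF contr, of "{Suc n..<Suc n + N}"] unfolding gap_k
      by (simp add: mult_left_le_one_le)
  qed
  show "gap \<mu> (\<tau> n) i \<le> gap \<mu> (\<tau> (Suc n)) j"
    by (rule LIMSEQ_le[OF LIMSEQ_Suc[OF gl] gl]) (use step in blast)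
qed

section \<open>Square-integrable functions and reproducing kernels\<close>

lemma L2_integrable_mult:
  assumes "f \<in> L2 \<mu>" "g \<in> L2 \<mu>"
  shows "integrable \<mu> (\<lambda>x. f x * cnj (g x))"
proof (rule Bochner_Integration.integrable_bound)
  show "integrable \<mu> (\<lambda>x. (cmod (f x))\<^sup>2 + (cmod (g x))\<^sup>2)"
    using assms by (auto simp: L2_def)
  show "(\<lambda>x. f x * cnj (g x)) \<in> borel_measurable \<mu>"
    using assms by (auto simp: L2_def)
  show "AE x in \<mu>. norm (f x * cnj (g x)) \<le> norm ((cmod (f x))\<^sup>2 + (cmod (g x))\<^sup>2)"
    using norm_mult_cnj_le by (auto intro!: AE_I2 simp del: norm_mult)
qed

lemma L2_scale: "f \<in> L2 \<mu> \<Longrightarrow> (\<lambda>x. c * f x) \<in> L2 \<mu>"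
  by (auto simp: L2_def norm_mult power_mult_distrib)

lemma L2_add:
  assumes "f \<in> L2 \<mu>" "g \<in> L2 \<mu>"
  shows "(\<lambda>x. f x + g x) \<in> L2 \<mu>"
proof -
  have "integrable \<mu> (\<lambda>x. (cmod (f x + g x))\<^sup>2)"
  proof (rule Bochner_Integration.integrable_bound)
    show "integrable \<mu> (\<lambda>x. 2 * ((cmod (f x))\<^sup>2 + (cmod (g x))\<^sup>2))"
      using assms by (auto simp: L2_def)
    show "(\<lambda>x. (cmod (f x + g x))\<^sup>2) \<in> borel_measurable \<mu>"
      using assms by (auto simp: L2_def)
    show "AE x in \<mu>. norm ((cmod (f x + g x))\<^sup>2) \<le> norm (2 * ((cmod (f x))\<^sup>2 + (cmod (g x))\<^sup>2))"
    proof (rule AE_I2)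
      fix x
      have "(cmod (f x + g x))\<^sup>2 \<le> (cmod (f x) + cmod (g x))\<^sup>2"
        by (intro power_mono norm_triangle_ineq) simp
      also have "\<dots> \<le> 2 * ((cmod (f x))\<^sup>2 + (cmod (g x))\<^sup>2)"
        using sum_squares_bound[of "cmod (f x)" "cmod (g x)"] by (simp add: power2_sum)
      finally show "norm ((cmod (f x + g x))\<^sup>2) \<le> norm (2 * ((cmod (f x))\<^sup>2 + (cmod (g x))\<^sup>2))" by simp
    qed
  qed
  then show ?thesis using assms by (auto simp: L2_def)
qed

lemma L2_diff: "f \<in> L2 \<mu> \<Longrightarrow> g \<in> L2 \<mu> \<Longrightarrow> (\<lambda>x. f x - g x) \<in> L2 \<mu>"
  using L2_add[OF _ L2_scale[of g \<mu> "-1"], of f] by simp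

lemma L2_inner_diff: "f \<in> L2 \<mu> \<Longrightarrow> g \<in> L2 \<mu> \<Longrightarrow> h \<in> L2 \<mu> \<Longrightarrow>
    L2_inner \<mu> (\<lambda>x. f x - g x) h = L2_inner \<mu> f h - L2_inner \<mu> g h"
  unfolding L2_inner_def
  by (simp add: left_diff_distrib Bochner_Integration.integral_diff L2_integrable_mult)

lemma L2_inner_scale: "L2_inner \<mu> (\<lambda>x. c * f x) h = c * L2_inner \<mu> f h"
  unfolding L2_inner_def by (simp add: mult.assoc)

lemma L2_inner_cnj: "cnj (L2_inner \<mu> f g) = L2_inner \<mu> g f"
  unfolding L2_inner_def by (simp add: mult.commute flip: Bochner_Integration.integral_cnj)

lemma L2_inner_sum: "finite I \<Longrightarrow> (\<And>i. i \<in> I \<Longrightarrow> f i \<in> L2 \<mu>) \<Longrightarrow> h \<in> L2 \<mu> \<Longrightarrow>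
    L2_inner \<mu> (\<lambda>x. \<Sum>i\<in>I. c i * f i x) h = (\<Sum>i\<in>I. c i * L2_inner \<mu> (f i) h)"
  unfolding L2_inner_def
  by (simp add: sum_distrib_right mult.assoc Bochner_Integration.integral_sum L2_integrable_mult)

lemma L2_norm_nonneg [simp]: "0 \<le> L2_norm \<mu> f"
  by (simp add: L2_norm_def)

lemma L2_norm_sq: "(L2_norm \<mu> f)\<^sup>2 = (\<integral>x. (cmod (f x))\<^sup>2 \<partial>\<mu>)"
  by (simp add: L2_norm_def)

lemma L2_inner_self: "L2_inner \<mu> f f = of_real ((L2_norm \<mu> f)\<^sup>2)"
  unfolding L2_norm_sq L2_inner_def by (simp only: integral_complex_of_real flip: complex_norm_square)

lemma L2_norm_diff_sq:
  assumes "f \<in> L2 \<mu>" "g \<in> L2 \<mu>"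
  shows "(L2_norm \<mu> (\<lambda>x. f x - g x))\<^sup>2 = (L2_norm \<mu> f)\<^sup>2 - 2 * Re (L2_inner \<mu> f g) + (L2_norm \<mu> g)\<^sup>2"
proof -
  let ?d = "\<lambda>x. f x - g x"
  have d: "?d \<in> L2 \<mu>" by (rule L2_diff[OF assms])
  have "of_real ((L2_norm \<mu> ?d)\<^sup>2) = L2_inner \<mu> ?d ?d" by (simp only: L2_inner_self)
  also have "\<dots> = L2_inner \<mu> f ?d - L2_inner \<mu> g ?d" by (rule L2_inner_diff[OF assms d])
  also have "\<dots> = cnj (L2_inner \<mu> ?d f) - cnj (L2_inner \<mu> ?d g)" by (simp only: L2_inner_cnj)
  also have "\<dots> = cnj (L2_inner \<mu> f f - L2_inner \<mu> g f) - cnj (L2_inner \<mu> f g - L2_inner \<mu> g g)"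
    using assms by (simp only: L2_inner_diff)
  also have "\<dots> = of_real ((L2_norm \<mu> f)\<^sup>2) - L2_inner \<mu> f g - cnj (L2_inner \<mu> f g) + of_real ((L2_norm \<mu> g)\<^sup>2)"
    by (simp add: L2_inner_cnj L2_inner_self)
  finally have "Re (of_real ((L2_norm \<mu> ?d)\<^sup>2)) = Re \<dots>" by (rule arg_cong)
  then show ?thesis by simp
qed

text \<open>\<open>f\<close> is compared with the multiples \<open>t c\<close> of \<open>g\<close>,
  where \<open>c\<close> is the inner product itself, so that the cross term is real. The optimal
  \<open>t\<close> is \<open>1 / N\<close>; for \<open>N = 0\<close> a large \<open>t\<close> forces
  \<open>c = 0\<close>.\<close>

lemma L2_Cauchy_Schwarz:
  assumes f: "f \<in> L2 \<mu>" and g: "g \<in> L2 \<mu>"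
  shows "cmod (L2_inner \<mu> f g) \<le> L2_norm \<mu> f * L2_norm \<mu> g"
proof -
  define c where "c = L2_inner \<mu> f g"
  define N where "N = (L2_norm \<mu> g)\<^sup>2"
  have main: "0 \<le> (L2_norm \<mu> f)\<^sup>2 - 2 * t * (cmod c)\<^sup>2 + t\<^sup>2 * (cmod c)\<^sup>2 * N" for t :: real
  proof -
    let ?g = "\<lambda>x. (of_real t * c) * g x"
    have g': "?g \<in> L2 \<mu>" by (rule L2_scale[OF g])
    have "L2_inner \<mu> f ?g = cnj (of_real t * c) * c"
      using L2_inner_scale[of \<mu> "of_real t * c" g f] unfolding c_def by (metis L2_inner_cnj complex_cnj_mult)
    also have "\<dots> = of_real t * (c * cnj c)" by (simp add: ac_simps)
    finally have "Re (L2_inner \<mu> f ?g) = t * (cmod c)\<^sup>2"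
      by (simp only: Re_of_real_mult Re_mult_cnj_self)
    moreover have "(L2_norm \<mu> ?g)\<^sup>2 = t\<^sup>2 * (cmod c)\<^sup>2 * N"
      by (simp add: L2_norm_sq N_def norm_mult power_mult_distrib)
    moreover have "0 \<le> (L2_norm \<mu> (\<lambda>x. f x - ?g x))\<^sup>2" by simp
    ultimately show ?thesis unfolding L2_norm_diff_sq[OF f g'] by simp
  qed
  have "(cmod c)\<^sup>2 \<le> (L2_norm \<mu> f)\<^sup>2 * N"
  proof (cases "N = 0")
    case True
    have "(cmod c)\<^sup>2 = 0"
    proof (rule ccontr)
      assume nz: "(cmod c)\<^sup>2 \<noteq> 0"
      have "(L2_norm \<mu> f)\<^sup>2 - 2 * (((L2_norm \<mu> f)\<^sup>2 + 1) / (cmod c)\<^sup>2) * (cmod c)\<^sup>2 = - (L2_norm \<mu> f)\<^sup>2 - 2"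
        using nz by (simp add: field_simps)
      moreover have "0 \<le> (L2_norm \<mu> f)\<^sup>2 - 2 * (((L2_norm \<mu> f)\<^sup>2 + 1) / (cmod c)\<^sup>2) * (cmod c)\<^sup>2"
        using main[of "((L2_norm \<mu> f)\<^sup>2 + 1) / (cmod c)\<^sup>2"] True by simp
      ultimately show False using zero_le_power2[of "L2_norm \<mu> f"] by linarith
    qed
    then show ?thesis using True by simp
  next
    case False
    then have N: "N > 0" by (simp add: N_def)
    have "0 \<le> (L2_norm \<mu> f)\<^sup>2 - (cmod c)\<^sup>2 / N"
      using main[of "1 / N"] N by (simp add: power2_eq_square field_simps)
    then show ?thesis using N by (simp add: field_simps)
  qed
  then have "(cmod c)\<^sup>2 \<le> (L2_norm \<mu> f * L2_norm \<mu> g)\<^sup>2" by (simp add: N_def power_mult_distrib)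
  then show ?thesis unfolding c_def by (rule power2_le_imp_le) simp
qed

section \<open>Reproducing kernel Hilbert spaces with pointwise evaluation\<close>

locale rkhs =
  fixes \<mu> :: "'a measure" and K :: "'a \<Rightarrow> 'a \<Rightarrow> complex" and H :: "('a \<Rightarrow> complex) set"
  assumes H_L2: "H \<subseteq> L2 \<mu>"
    and H_zero: "(\<lambda>x. 0) \<in> H"
    and H_add: "\<And>f g. f \<in> H \<Longrightarrow> g \<in> H \<Longrightarrow> (\<lambda>x. f x + g x) \<in> H"
    and H_scale: "\<And>c f. f \<in> H \<Longrightarrow> (\<lambda>x. c * f x) \<in> H"
    and H_closed: "\<And>f. f \<in> L2 \<mu> \<Longrightarrow> (\<And>\<epsilon>. \<epsilon> > 0 \<Longrightarrow> \<exists>g\<in>H. L2_norm \<mu> (\<lambda>x. f x - g x) < \<epsilon>) \<Longrightarrow>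
        \<exists>h\<in>H. AE x in \<mu>. f x = h x"
    and ker_H: "\<And>x. (\<lambda>y. K y x) \<in> H"
    and reproducing: "\<And>f x. f \<in> H \<Longrightarrow> f x = L2_inner \<mu> f (\<lambda>y. K y x)"
begin

abbreviation "ker x \<equiv> (\<lambda>y. K y x)"
abbreviation "ip \<equiv> L2_inner \<mu>"
abbreviation "nrm \<equiv> L2_norm \<mu>"

lemma in_L2 [simp]: "f \<in> H \<Longrightarrow> f \<in> L2 \<mu>"
  using H_L2 by auto

lemma H_sum: "finite I \<Longrightarrow> (\<And>i. i \<in> I \<Longrightarrow> f i \<in> H) \<Longrightarrow> (\<lambda>x. \<Sum>i\<in>I. c i * f i x) \<in> H"
proof (induction I rule: finite_induct)
  case (insert i I)
  then show ?case using H_add[OF H_scale[of "f i" "c i"], of "\<lambda>x. \<Sum>i\<in>I. c i * f i x"] by simp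
qed (simp add: H_zero)

lemma H_diff: "f \<in> H \<Longrightarrow> g \<in> H \<Longrightarrow> (\<lambda>x. f x - g x) \<in> H"
  using H_add[OF _ H_scale[of g "-1"], of f] by simp

lemma ker_inner: "K x y = ip (ker y) (ker x)"
  using reproducing[OF ker_H[of y], of x] .

lemma ker_cnj: "cnj (K x y) = K y x"
  unfolding ker_inner[of x y] ker_inner[of y x] by (rule L2_inner_cnj)

lemma ker_diag: "K x x = of_real ((nrm (ker x))\<^sup>2)"
  unfolding ker_inner[of x x] by (rule L2_inner_self)

text \<open>Cauchy-Schwarz against the kernel at \<open>y\<close> bounds the value at
  \<open>y\<close> by the norm.\<close>

lemma eq_0_if_norm_0:
  assumes "f \<in> H" "nrm f = 0" shows "f y = 0"
proof -
  have "cmod (f y) \<le> nrm f * nrm (ker y)"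
    by (subst reproducing[OF assms(1)]) (rule L2_Cauchy_Schwarz, use assms ker_H in auto)
  then show ?thesis using assms by simp
qed

lemma ip_0_if_norm_0:
  assumes "f \<in> H" "g \<in> H" "nrm g = 0" shows "ip f g = 0"
  using L2_Cauchy_Schwarz[of f \<mu> g] assms by simp

text \<open>Evaluation is an inner product with a kernel and does not see null sets; this turns
  almost-everywhere conclusions within \<open>H\<close> into pointwise ones.\<close>

lemma eq_if_AE_eq:
  assumes "f \<in> H" "g \<in> H" "AE x in \<mu>. f x = g x" shows "f y = g y"
proof -
  have "ip f (ker y) = ip g (ker y)"
    unfolding L2_inner_def
  proof (rule integral_cong_AE)
    show "AE x in \<mu>. f x * cnj (K x y) = g x * cnj (K x y)" using assms(3) by eventually_elim simp
  qed (intro borel_measurable_integrable L2_integrable_mult in_L2 assms ker_H)+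
  then show ?thesis using reproducing assms by metis
qed

definition ortho :: "(nat \<Rightarrow> 'a \<Rightarrow> complex) \<Rightarrow> bool" where
  "ortho e \<longleftrightarrow> (\<forall>i. e i \<in> H) \<and> (\<forall>i j. i \<noteq> j \<longrightarrow> ip (e i) (e j) = 0) \<and> (\<forall>i. nrm (e i) = 0 \<or> nrm (e i) = 1)"

lemma orthoD:
  assumes "ortho e"
  shows "e i \<in> H" "i \<noteq> j \<Longrightarrow> ip (e i) (e j) = 0" "nrm (e i) = 0 \<or> nrm (e i) = 1"
  using assms by (auto simp: ortho_def)

lemma ortho_norm_sum:
  assumes e: "ortho e" and I: "finite I"
  shows "(nrm (\<lambda>x. \<Sum>i\<in>I. c i * e i x))\<^sup>2 = (\<Sum>i\<in>I. (cmod (c i))\<^sup>2 * (nrm (e i))\<^sup>2)"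
proof -
  let ?s = "\<lambda>x. \<Sum>i\<in>I. c i * e i x"
  have s: "?s \<in> H" by (intro H_sum I orthoD[OF e])
  have ips: "ip ?s (e i) = c i * of_real ((nrm (e i))\<^sup>2)" if "i \<in> I" for i
  proof -
    have "ip ?s (e i) = (\<Sum>j\<in>I. c j * ip (e j) (e i))"
      by (rule L2_inner_sum) (use I orthoD[OF e] in auto)
    also have "\<dots> = (\<Sum>j\<in>I. if j = i then c i * of_real ((nrm (e i))\<^sup>2) else 0)"
      by (intro sum.cong refl) (simp add: orthoD[OF e] L2_inner_self)
    finally show ?thesis using I that by simp
  qed
  have "of_real ((nrm ?s)\<^sup>2) = ip ?s ?s" by (simp only: L2_inner_self)
  also have "\<dots> = (\<Sum>i\<in>I. c i * ip (e i) ?s)"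
    by (rule L2_inner_sum) (use I orthoD[OF e] s in auto)
  also have "\<dots> = (\<Sum>i\<in>I. c i * cnj (ip ?s (e i)))" by (simp add: L2_inner_cnj)
  also have "\<dots> = (\<Sum>i\<in>I. of_real ((cmod (c i))\<^sup>2 * (nrm (e i))\<^sup>2))"
  proof (rule sum.cong[OF refl])
    fix i assume "i \<in> I"
    show "c i * cnj (ip ?s (e i)) = of_real ((cmod (c i))\<^sup>2 * (nrm (e i))\<^sup>2)"
      unfolding ips[OF \<open>i \<in> I\<close>] by (simp add: complex_norm_square del: of_real_power)
  qed
  finally show ?thesis by (simp only: of_real_eq_iff flip: of_real_sum)
qed

text \<open>A coefficient against a member of norm 0 vanishes, so such members can be treated as if
  they were normalised.\<close>

lemma ortho_coeff:
  assumes e: "ortho e" and f: "f \<in> H"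
  shows "(cmod (ip f (e i)))\<^sup>2 * (nrm (e i))\<^sup>2 = (cmod (ip f (e i)))\<^sup>2"
    and "ip f (e i) * of_real ((nrm (e i))\<^sup>2) = ip f (e i)"
  using orthoD(3)[OF e, of i] ip_0_if_norm_0[OF f orthoD(1)[OF e], of i] by auto

lemma ortho_residual:
  assumes e: "ortho e" and f: "f \<in> H" and I: "finite I"
  shows "(nrm (\<lambda>x. f x - (\<Sum>i\<in>I. ip f (e i) * e i x)))\<^sup>2 = (nrm f)\<^sup>2 - (\<Sum>i\<in>I. (cmod (ip f (e i)))\<^sup>2)"
proof -
  let ?s = "\<lambda>x. \<Sum>i\<in>I. ip f (e i) * e i x"
  have s: "?s \<in> H" by (intro H_sum I orthoD[OF e])
  have "ip f ?s = cnj (ip ?s f)" by (simp add: L2_inner_cnj)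
  also have "ip ?s f = (\<Sum>i\<in>I. ip f (e i) * ip (e i) f)"
    by (rule L2_inner_sum) (use I orthoD[OF e] f in auto)
  also have "\<dots> = (\<Sum>i\<in>I. ip f (e i) * cnj (ip f (e i)))" by (simp add: L2_inner_cnj)
  also have "cnj \<dots> = of_real (\<Sum>i\<in>I. (cmod (ip f (e i)))\<^sup>2)"
    by (simp add: complex_norm_square mult.commute del: of_real_power)
  finally have "Re (ip f ?s) = (\<Sum>i\<in>I. (cmod (ip f (e i)))\<^sup>2)" by simp
  moreover have "(nrm ?s)\<^sup>2 = (\<Sum>i\<in>I. (cmod (ip f (e i)))\<^sup>2)"
    unfolding ortho_norm_sum[OF e I] ortho_coeff(1)[OF e f] ..
  ultimately show ?thesis
    using L2_norm_diff_sq[of f \<mu> ?s] f s by simp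
qed

lemma bessel:
  assumes e: "ortho e" and f: "f \<in> H"
  shows "summable (\<lambda>i. (cmod (ip f (e i)))\<^sup>2)" "(\<Sum>i. (cmod (ip f (e i)))\<^sup>2) \<le> (nrm f)\<^sup>2"
proof -
  have b: "(\<Sum>i\<in>I. (cmod (ip f (e i)))\<^sup>2) \<le> (nrm f)\<^sup>2" if "finite I" for I
    using ortho_residual[OF e f that] zero_le_power2[of "nrm (\<lambda>x. f x - (\<Sum>i\<in>I. ip f (e i) * e i x))"]
    by linarith
  show "summable (\<lambda>i. (cmod (ip f (e i)))\<^sup>2)"
    by (rule summableI_nonneg_bounded[of _ "(nrm f)\<^sup>2", OF zero_le_power2 b[OF finite_lessThan]])
  then show "(\<Sum>i. (cmod (ip f (e i)))\<^sup>2) \<le> (nrm f)\<^sup>2"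
    by (rule suminf_le_const) (rule b[OF finite_lessThan])
qed

lemma ortho_eval: "ortho e \<Longrightarrow> e i y = cnj (ip (ker y) (e i))"
  unfolding L2_inner_cnj by (rule reproducing[OF orthoD(1)])

text \<open>Bessel's inequality for the kernel at \<open>y\<close>, whose coefficients are the
  conjugates of the values \<open>e i y\<close>.\<close>

lemma ortho_eval_bound:
  assumes e: "ortho e"
  shows "summable (\<lambda>i. (cmod (e i y))\<^sup>2)" "(\<Sum>i. (cmod (e i y))\<^sup>2) \<le> Re (K y y)"
proof -
  have eq: "(\<lambda>i. (cmod (e i y))\<^sup>2) = (\<lambda>i. (cmod (ip (ker y) (e i)))\<^sup>2)"
    by (rule ext) (simp only: ortho_eval[OF e, of _ y] complex_mod_cnj)
  show "summable (\<lambda>i. (cmod (e i y))\<^sup>2)" "(\<Sum>i. (cmod (e i y))\<^sup>2) \<le> Re (K y y)"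
    unfolding eq ker_diag Re_complex_of_real by (rule bessel[OF e ker_H])+
qed

text \<open>The limit is built as a pointwise series, so that it is a function and not only a class.
  Fatou's lemma bounds its distance from the partial sums by the tails of the squared coefficients;
  closedness of \<open>H\<close> and reproduction then place it in \<open>H\<close>.\<close>

lemma projection:
  assumes e: "ortho e" and f: "f \<in> H"
  obtains s where "s \<in> H" "\<And>y. (\<lambda>i. ip f (e i) * e i y) sums s y"
    "(\<lambda>N. nrm (\<lambda>x. s x - (\<Sum>i<N. ip f (e i) * e i x))) \<longlonglongrightarrow> 0"
    "\<And>i. ip s (e i) = ip f (e i)"
proof -
  define c where "c i = ip f (e i)" for i
  define p where "p N x = (\<Sum>i<N. c i * e i x)" for N x
  define s where "s y = (\<Sum>i. c i * e i y)" for y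
  have c_sum: "summable (\<lambda>i. (cmod (c i))\<^sup>2)" using bessel(1)[OF e f] by (simp add: c_def)
  define T where "T N = (\<Sum>i. (cmod (c (i + N)))\<^sup>2)" for N
  have "summable (\<lambda>i. c i * e i y)" for y
  proof (rule summable_comparison_test'[where N=0])
    show "summable (\<lambda>i. (cmod (c i))\<^sup>2 + (cmod (e i y))\<^sup>2)"
      by (intro summable_add c_sum ortho_eval_bound(1)[OF e])
    show "norm (c i * e i y) \<le> (cmod (c i))\<^sup>2 + (cmod (e i y))\<^sup>2" for i
      using norm_mult_cnj_le[of "c i" "cnj (e i y)"] by simp
  qed
  then have sums: "(\<lambda>i. c i * e i y) sums s y" for y unfolding s_def by (rule summable_sums)
  then have p_lim: "(\<lambda>N. p N y) \<longlonglongrightarrow> s y" for y by (simp add: sums_def p_def)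
  have pH: "p N \<in> H" for N unfolding p_def by (intro H_sum orthoD[OF e]) simp
  have p_meas: "p N \<in> borel_measurable \<mu>" for N using in_L2[OF pH[of N]] by (simp add: L2_def)
  have s_meas: "s \<in> borel_measurable \<mu>" by (rule borel_measurable_LIMSEQ_metric[OF p_meas p_lim])
  note [measurable] = p_meas s_meas
  have T_lim: "T \<longlonglongrightarrow> 0"
    unfolding T_def using suminf_exist_split2[OF c_sum] .
  have T_nonneg: "0 \<le> T N" for N
    unfolding T_def using summable_ignore_initial_segment[OF c_sum, of N] by (intro suminf_nonneg) auto
  have fatou: "(\<integral>\<^sup>+x. ennreal ((cmod (s x - p N x))\<^sup>2) \<partial>\<mu>) \<le> ennreal (T N)" for N
  proof -
    have "(\<integral>\<^sup>+x. ennreal ((cmod (s x - p N x))\<^sup>2) \<partial>\<mu>) =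
      (\<integral>\<^sup>+x. liminf (\<lambda>M. ennreal ((cmod (p M x - p N x))\<^sup>2)) \<partial>\<mu>)"
    proof (intro nn_integral_cong)
      fix x
      have "(\<lambda>M. ennreal ((cmod (p M x - p N x))\<^sup>2)) \<longlonglongrightarrow> ennreal ((cmod (s x - p N x))\<^sup>2)"
        by (intro tendsto_ennrealI tendsto_intros p_lim)
      then show "ennreal ((cmod (s x - p N x))\<^sup>2) = liminf (\<lambda>M. ennreal ((cmod (p M x - p N x))\<^sup>2))"
        by (rule lim_imp_Liminf[OF trivial_limit_sequentially, THEN sym])
    qed
    also have "\<dots> \<le> liminf (\<lambda>M. \<integral>\<^sup>+x. ennreal ((cmod (p M x - p N x))\<^sup>2) \<partial>\<mu>)"
      by (intro nn_integral_liminf) measurable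
    also have "\<dots> \<le> ennreal (T N)"
    proof (rule Liminf_le)
      show "\<forall>\<^sub>F M in sequentially. (\<integral>\<^sup>+x. ennreal ((cmod (p M x - p N x))\<^sup>2) \<partial>\<mu>) \<le> ennreal (T N)"
        using eventually_ge_at_top[of N]
      proof eventually_elim
        case (elim M)
        have d: "(\<lambda>x. p M x - p N x) = (\<lambda>x. \<Sum>i\<in>{N..<M}. c i * e i x)"
          unfolding p_def
          by (rule ext) (rule sum_diff_nat_ivl[OF le0 elim, unfolded atLeast0LessThan])
        have "(\<lambda>x. p M x - p N x) \<in> L2 \<mu>" using pH by (intro L2_diff in_L2)
        then have "(\<integral>\<^sup>+x. ennreal ((cmod (p M x - p N x))\<^sup>2) \<partial>\<mu>) = ennreal ((nrm (\<lambda>x. p M x - p N x))\<^sup>2)"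
          unfolding L2_norm_sq by (intro nn_integral_eq_integral) (auto simp: L2_def)
        also have "(nrm (\<lambda>x. p M x - p N x))\<^sup>2 = (\<Sum>i\<in>{N..<M}. (cmod (c i))\<^sup>2)"
          unfolding d ortho_norm_sum[OF e finite_atLeastLessThan] c_def ortho_coeff(1)[OF e f] ..
        also have "\<dots> = (\<Sum>i<M - N. (cmod (c (i + N)))\<^sup>2)"
          by (rule sum.reindex_bij_witness[where i="\<lambda>i. i + N" and j="\<lambda>i. i - N"]) auto
        also have "\<dots> \<le> T N"
          unfolding T_def by (rule sum_le_suminf[OF summable_ignore_initial_segment[OF c_sum]]) auto
        finally show ?case by (simp add: ennreal_leI)
      qed
    qed simp
    finally show ?thesis .
  qed
  have sp_L2: "(\<lambda>x. s x - p N x) \<in> L2 \<mu>" for N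
  proof -
    have "integrable \<mu> (\<lambda>x. (cmod (s x - p N x))\<^sup>2)"
    proof (rule integrableI_nonneg)
      show "(\<integral>\<^sup>+x. ennreal ((cmod (s x - p N x))\<^sup>2) \<partial>\<mu>) < \<infinity>"
        by (rule le_less_trans[OF fatou]) simp
    next
      show "(\<lambda>x. (cmod (s x - p N x))\<^sup>2) \<in> borel_measurable \<mu>" by measurable
    qed simp
    then show ?thesis using borel_measurable_diff[OF s_meas p_meas] unfolding L2_def by blast
  qed
  have s_L2: "s \<in> L2 \<mu>" using sp_L2[of 0] by (simp add: p_def)
  have norm_le: "(nrm (\<lambda>x. s x - p N x))\<^sup>2 \<le> T N" for N
  proof -
    have "ennreal ((nrm (\<lambda>x. s x - p N x))\<^sup>2) = (\<integral>\<^sup>+x. ennreal ((cmod (s x - p N x))\<^sup>2) \<partial>\<mu>)"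
      unfolding L2_norm_sq using sp_L2[of N] unfolding L2_def
    by (intro nn_integral_eq_integral[symmetric]) simp_all
    also have "\<dots> \<le> ennreal (T N)" by (rule fatou)
    finally show ?thesis by (simp only: ennreal_le_iff[OF T_nonneg])
  qed
  have "(\<lambda>N. (nrm (\<lambda>x. s x - p N x))\<^sup>2) \<longlonglongrightarrow> 0"
    by (rule tendsto_sandwich[OF _ _ tendsto_const T_lim]) (intro always_eventually allI zero_le_power2 norm_le)+
  then have nlim: "(\<lambda>N. nrm (\<lambda>x. s x - p N x)) \<longlonglongrightarrow> 0"
    by (drule_tac tendsto_real_sqrt) simp
  have inner_lim: "(\<lambda>N. ip (p N) g) \<longlonglongrightarrow> ip s g" if g: "g \<in> H" for g
  proof (rule LIM_zero_cancel, rule tendsto_norm_zero_cancel, rule tendsto_sandwich[OF _ _ tendsto_const])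
    show "\<forall>\<^sub>F N in sequentially. norm (ip (p N) g - ip s g) \<le> nrm (\<lambda>x. s x - p N x) * nrm g"
    proof (rule always_eventually, rule allI)
      fix N
      have "ip (p N) g - ip s g = - ip (\<lambda>x. s x - p N x) g"
        unfolding L2_inner_diff[OF s_L2 in_L2[OF pH] in_L2[OF g]] by simp
      then show "norm (ip (p N) g - ip s g) \<le> nrm (\<lambda>x. s x - p N x) * nrm g"
        using L2_Cauchy_Schwarz[OF sp_L2 in_L2[OF g]] by (simp only: norm_minus_cancel)
    qed
    show "(\<lambda>N. nrm (\<lambda>x. s x - p N x) * nrm g) \<longlonglongrightarrow> 0"
      using tendsto_mult_right[OF nlim, of "nrm g"] by simp
  qed auto
  have "\<exists>h\<in>H. AE x in \<mu>. s x = h x"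
  proof (rule H_closed[OF s_L2])
    fix \<epsilon> :: real assume "\<epsilon> > 0"
    then have "\<forall>\<^sub>F N in sequentially. nrm (\<lambda>x. s x - p N x) < \<epsilon>"
      using order_tendstoD(2)[OF nlim] by blast
    then obtain N where "nrm (\<lambda>x. s x - p N x) < \<epsilon>" using eventually_happens by fastforce
    then show "\<exists>g\<in>H. nrm (\<lambda>x. s x - g x) < \<epsilon>" using pH by blast
  qed
  then obtain h where h: "h \<in> H" "AE x in \<mu>. s x = h x" by blast
  \<comment> \<open>Closedness gives only agreement almost everywhere with some \<open>h\<close>.
    Both \<open>h y\<close> and \<open>s y\<close> are inner products with the kernel at
    \<open>y\<close>, the latter as a limit over the partial sums.\<close>
  have "h = s"
  proof
    fix y
    have "h y = ip h (ker y)" by (rule reproducing[OF h(1)])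
    also have "\<dots> = ip s (ker y)" unfolding L2_inner_def
    proof (rule integral_cong_AE)
      show "AE x in \<mu>. h x * cnj (K x y) = s x * cnj (K x y)" using h(2) by eventually_elim simp
    qed (intro borel_measurable_integrable L2_integrable_mult in_L2 h(1) ker_H s_L2)+
    also have "\<dots> = s y"
    proof (rule LIMSEQ_unique[OF inner_lim[OF ker_H]])
      show "(\<lambda>N. ip (p N) (ker y)) \<longlonglongrightarrow> s y"
        using p_lim[of y] by (simp only: reproducing[OF pH, symmetric])
    qed
    finally show "h y = s y" .
  qed
  then have sH: "s \<in> H" using h by simp
  have "ip s (e i) = c i" for i
  proof (rule LIMSEQ_unique[OF inner_lim[OF orthoD(1)[OF e]]])
    have "ip (p N) (e i) = c i" if "N > i" for N
    proof -
      have "ip (p N) (e i) = (\<Sum>j<N. c j * ip (e j) (e i))"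
        unfolding p_def by (rule L2_inner_sum) (use orthoD[OF e] in auto)
      also have "\<dots> = (\<Sum>j<N. if j = i then c i * of_real ((nrm (e i))\<^sup>2) else 0)"
        by (intro sum.cong refl) (simp add: orthoD[OF e] L2_inner_self)
      also have "\<dots> = c i" using that ortho_coeff(2)[OF e f] by (simp add: c_def)
      finally show ?thesis .
    qed
    then show "(\<lambda>N. ip (p N) (e i)) \<longlonglongrightarrow> c i"
      by (intro tendsto_eventually) (auto simp: eventually_at_top_dense)
  qed
  then have ipc: "ip s (e i) = ip f (e i)" for i by (simp only: c_def)
  show ?thesis
    by (rule that[OF sH sums[unfolded c_def] nlim[unfolded p_def c_def] ipc])
qed

section \<open>Gram-Schmidt orthogonalisation and the Mercer expansion\<close>

text \<open>
  As \<open>inverse 0 = 0\<close>, a vector depending linearly on its predecessors is sent to a function of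
  norm \<open>0\<close>; \<open>ortho\<close> allows such members.
\<close>

fun gram_schmidt :: "(nat \<Rightarrow> 'a \<Rightarrow> complex) \<Rightarrow> nat \<Rightarrow> 'a \<Rightarrow> complex" where
  "gram_schmidt v n =
     (let r = (\<lambda>y. v n y - (\<Sum>i\<in>{..<n}. ip (v n) (gram_schmidt v i) * gram_schmidt v i y))
      in (\<lambda>y. of_real (inverse (nrm r)) * r y))"

declare gram_schmidt.simps [simp del]

definition gs_residual :: "(nat \<Rightarrow> 'a \<Rightarrow> complex) \<Rightarrow> nat \<Rightarrow> 'a \<Rightarrow> complex" where
  "gs_residual v n y = v n y - (\<Sum>i\<in>{..<n}. ip (v n) (gram_schmidt v i) * gram_schmidt v i y)"

lemma gram_schmidt_residual:
  "gram_schmidt v n = (\<lambda>y. of_real (inverse (nrm (gs_residual v n))) * gs_residual v n y)"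
  by (subst gram_schmidt.simps) (simp add: Let_def gs_residual_def[abs_def])

lemma gram_schmidt_H:
  assumes v: "\<And>n. v n \<in> H"
  shows "gram_schmidt v n \<in> H" "gs_residual v n \<in> H"
proof -
  have r: "gs_residual v n \<in> H" if "\<And>i. i < n \<Longrightarrow> gram_schmidt v i \<in> H" for n
    unfolding gs_residual_def[abs_def] using that by (intro H_diff v H_sum) auto
  show e: "gram_schmidt v n \<in> H" for n
  proof (induction n rule: less_induct)
    case (less n)
    show ?case by (subst gram_schmidt_residual) (intro H_scale r less)
  qed
  show "gs_residual v n \<in> H" by (rule r[OF e])
qed

lemma L2_norm_scale: "nrm (\<lambda>x. c * f x) = cmod c * nrm f"
  by (simp add: L2_norm_def norm_mult power_mult_distrib real_sqrt_mult)

lemma gram_schmidt_ortho: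
  assumes v: "\<And>n. v n \<in> H"
  shows "ortho (gram_schmidt v)"
proof -
  let ?e = "gram_schmidt v"
  note eH = gram_schmidt_H(1)[of v, OF v]
  have n01: "nrm (?e n) = 0 \<or> nrm (?e n) = 1" for n
    unfolding gram_schmidt_residual[of v n] L2_norm_scale
    by (cases "nrm (gs_residual v n) = 0") (auto simp: norm_inverse)
  have orth: "ip (?e n) (?e i) = 0" if "i < n" for n i
    using that
  proof (induction n arbitrary: i rule: less_induct)
    case (less n)
    have orth': "ip (?e j) (?e i) = 0" if "j < n" "i < n" "j \<noteq> i" for i j
    proof (cases "i < j")
      case True then show ?thesis using less.IH that by blast
    next
      case False
      then have "ip (?e i) (?e j) = 0" using less.IH[of i j] that by auto
      then show ?thesis using L2_inner_cnj[of \<mu> "?e i" "?e j"] by simp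
    qed
    have "ip (gs_residual v n) (?e i) = ip (v n) (?e i) - ip (\<lambda>y. \<Sum>j\<in>{..<n}. ip (v n) (?e j) * ?e j y) (?e i)"
      unfolding gs_residual_def[abs_def] by (intro L2_inner_diff in_L2 v eH H_sum) auto
    also have "ip (\<lambda>y. \<Sum>j\<in>{..<n}. ip (v n) (?e j) * ?e j y) (?e i) = (\<Sum>j\<in>{..<n}. ip (v n) (?e j) * ip (?e j) (?e i))"
      by (intro L2_inner_sum in_L2 eH) auto
    also have "\<dots> = (\<Sum>j\<in>{..<n}. if j = i then ip (v n) (?e i) * of_real ((nrm (?e i))\<^sup>2) else 0)"
      by (intro sum.cong refl) (use orth' less.prems in \<open>auto simp: L2_inner_self\<close>)
    also have "\<dots> = ip (v n) (?e i) * of_real ((nrm (?e i))\<^sup>2)" using less.prems by simp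
    also have "\<dots> = ip (v n) (?e i)"
      using n01[of i] ip_0_if_norm_0[OF v[of n] eH[of i]] by (elim disjE) (simp_all only: of_real_1 of_real_0 power_one mult_1_right mult_zero_left)
    finally have "ip (gs_residual v n) (?e i) = 0" by simp
    then show ?case
      unfolding gram_schmidt_residual[of v n] L2_inner_scale by simp
  qed
  have "ip (?e i) (?e j) = 0" if "i \<noteq> j" for i j
    using orth[of i j] orth[of j i] L2_inner_cnj[of \<mu> "?e j" "?e i"] that by (cases i j rule: linorder_cases) auto
  then show ?thesis unfolding ortho_def using eH n01 by blast
qed

text \<open>A residual of norm 0 vanishes identically, so that the vector is then a combination of
  the earlier members alone.\<close>

lemma gram_schmidt_expand:
  assumes v: "\<And>n. v n \<in> H"
  shows "\<exists>a. \<forall>y. v n y = (\<Sum>i\<in>{..n}. a i * gram_schmidt v i y)"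
proof -
  let ?r = "gs_residual v n"
  have r: "?r y = of_real (nrm ?r) * gram_schmidt v n y" for y
  proof (cases "nrm ?r = 0")
    case True
    then show ?thesis using eq_0_if_norm_0[OF gram_schmidt_H(2)[of v, OF v]] by simp
  next
    case False
    then show ?thesis unfolding gram_schmidt_residual[of v n] by simp
  qed
  define a where "a i = (if i = n then of_real (nrm ?r) else ip (v n) (gram_schmidt v i))" for i
  have "v n y = (\<Sum>i\<in>{..n}. a i * gram_schmidt v i y)" for y
  proof -
    have "v n y = ?r y + (\<Sum>i\<in>{..<n}. ip (v n) (gram_schmidt v i) * gram_schmidt v i y)"
      by (simp add: gs_residual_def)
    also have "\<dots> = a n * gram_schmidt v n y + (\<Sum>i\<in>{..<n}. a i * gram_schmidt v i y)"
      using r[of y] by (simp add: a_def)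
    also have "\<dots> = (\<Sum>i\<in>{..n}. a i * gram_schmidt v i y)"
      by (simp flip: lessThan_Suc_atMost)
    finally show ?thesis .
  qed
  then show ?thesis by blast
qed

lemma gram_schmidt_span:
  "\<exists>b. \<forall>y. gram_schmidt v n y = (\<Sum>i\<in>{..n}. b i * v i y)"
proof (induction n rule: less_induct)
  case (less n)
  then have "\<forall>j\<in>{..<n}. \<exists>b. \<forall>y. gram_schmidt v j y = (\<Sum>i\<in>{..j}. b i * v i y)" by blast
  then obtain B where B: "\<And>j y. j < n \<Longrightarrow> gram_schmidt v j y = (\<Sum>i\<in>{..j}. B j i * v i y)"
    by (metis lessThan_iff)
  define l where "l = complex_of_real (inverse (nrm (gs_residual v n)))"
  define c where "c j = ip (v n) (gram_schmidt v j)" for j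
  define b where "b i = l * ((if i = n then 1 else 0) - (\<Sum>j\<in>{..<n}. c j * (if i \<le> j then B j i else 0)))" for i
  have "gram_schmidt v n y = (\<Sum>i\<in>{..n}. b i * v i y)" for y
  proof -
    have Bn: "gram_schmidt v j y = (\<Sum>i\<in>{..n}. (if i \<le> j then B j i else 0) * v i y)" if "j < n" for j
      unfolding B[OF that] by (rule sum.mono_neutral_cong_left) (use that in auto)
    have "gram_schmidt v n y = l * (v n y - (\<Sum>j\<in>{..<n}. c j * gram_schmidt v j y))"
      by (subst gram_schmidt_residual) (simp add: gs_residual_def l_def c_def)
    also have "(\<Sum>j\<in>{..<n}. c j * gram_schmidt v j y) = (\<Sum>j\<in>{..<n}. c j * (\<Sum>i\<in>{..n}. (if i \<le> j then B j i else 0) * v i y))"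
      by (intro sum.cong refl) (simp only: Bn lessThan_iff)
    also have "\<dots> = (\<Sum>i\<in>{..n}. (\<Sum>j\<in>{..<n}. c j * (if i \<le> j then B j i else 0)) * v i y)"
      unfolding sum_distrib_left sum_distrib_right by (subst sum.swap) (simp only: mult.assoc)
    also have "v n y = (\<Sum>i\<in>{..n}. (if i = n then 1 else 0) * v i y)"
      by (subst sum.cong[OF refl, of _ _ "\<lambda>i. if i = n then v n y else 0"]) auto
    also have "l * ((\<Sum>i\<in>{..n}. (if i = n then 1 else 0) * v i y) - (\<Sum>i\<in>{..n}. (\<Sum>j\<in>{..<n}. c j * (if i \<le> j then B j i else 0)) * v i y))
       = (\<Sum>i\<in>{..n}. b i * v i y)"
      unfolding b_def sum_subtractf[symmetric] left_diff_distrib[symmetric] sum_distrib_left by (simp only: mult.assoc)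
    finally show ?thesis .
  qed
  then show ?case by blast
qed

text \<open>The kernel at \<open>y\<close> minus its projection is orthogonal to every
  \<open>e i\<close> and vanishes by totality; the coefficients of that kernel are the numbers
  \<open>cnj (e i y)\<close>.\<close>

lemma mercer:
  assumes e: "ortho e" and total: "\<And>f y. f \<in> H \<Longrightarrow> (\<And>i. ip f (e i) = 0) \<Longrightarrow> f y = 0"
  shows "(\<lambda>i. e i x * cnj (e i y)) sums K x y"
proof -
  obtain s where s: "s \<in> H" "\<And>x. (\<lambda>i. ip (ker y) (e i) * e i x) sums s x" "\<And>i. ip s (e i) = ip (ker y) (e i)"
    using projection[OF e ker_H[of y]] by metis
  have "ker y x - s x = 0" for x
  proof (rule total[of "\<lambda>x. ker y x - s x"])
    show "(\<lambda>x. K x y - s x) \<in> H" by (intro H_diff ker_H s)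
    show "ip (\<lambda>x. K x y - s x) (e i) = 0" for i
      unfolding L2_inner_diff[OF in_L2[OF ker_H] in_L2[OF s(1)] in_L2[OF orthoD(1)[OF e]]] s(3) by simp
  qed
  then have "s x = K x y" by simp
  moreover have "ip (ker y) (e i) = cnj (e i y)" for i
    using ortho_eval[OF e, of i y] by simp
  ultimately show ?thesis using s(2)[of x] by (simp add: mult.commute)
qed

end

section \<open>Janossy densities\<close>

lemma det_on_zero_row:
  assumes "finite S" "i \<in> S" "\<And>j. j \<in> S \<Longrightarrow> a i j = 0"
  shows "det_on S a = 0"
  unfolding det_on_def
proof (intro sum.neutral ballI)
  fix p assume "p \<in> {p. p permutes S}"
  then have "a i (p i) = 0" using assms by (simp add: permutes_in_image)
  then have "(\<Prod>i\<in>S. a i (p i)) = 0" using assms(1,2) by (intro prod_zero) auto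
  then show "of_int (sign p) * (\<Prod>i\<in>S. a i (p i)) = 0" by simp
qed

text \<open>
  Inclusion-exclusion over the \<open>m\<close> points \<open>y\<^sub>n, \<dots>, y\<^sub>n\<^sub>+\<^sub>m\<^sub>-\<^sub>1\<close> that may be present besides the \<open>x\<^sub>i\<close>.
\<close>

definition janossy :: "'a measure \<Rightarrow> ('a \<Rightarrow> 'a \<Rightarrow> complex) \<Rightarrow> nat \<Rightarrow> (nat \<Rightarrow> 'a) \<Rightarrow> real" where
  "janossy \<mu> k n x = (\<Sum>m. (-1) ^ m / fact m *
     (\<integral>y. Re (det_on {..<n+m} (\<lambda>i j. k (if i < n then x i else y i) (if j < n then x j else y j)))
        \<partial>PiM {n..<n+m} (\<lambda>_. \<mu>)))"

text \<open>\<open>h\<close> expresses separability of \<open>H\<close>. Appended to finitely many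
  kernels, it makes the adapted orthonormal system total.\<close>

locale rkhs_total = rkhs +
  fixes h :: "nat \<Rightarrow> 'a \<Rightarrow> complex"
  assumes sf: "sigma_finite_measure \<mu>"
    and K_measurable: "case_prod K \<in> borel_measurable (\<mu> \<Otimes>\<^sub>M \<mu>)"
    and h_H: "\<And>i. h i \<in> H"
    and h_total: "\<And>f y. f \<in> H \<Longrightarrow> (\<And>i. L2_inner \<mu> f (h i) = 0) \<Longrightarrow> f y = 0"
begin

lemma ker_psd: "psd K"
  unfolding psd_def
proof (intro conjI allI impI)
  fix x y show "K x y = cnj (K y x)" by (simp add: ker_cnj)
next
  fix S :: "'a set" and c :: "'a \<Rightarrow> complex" assume S: "finite S"
  let ?f = "\<lambda>z. \<Sum>x\<in>S. cnj (c x) * K z x"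
  have f: "?f \<in> H" by (rule H_sum[OF S ker_H])
  have "of_real ((nrm ?f)\<^sup>2) = ip ?f ?f" by (simp only: L2_inner_self)
  also have "\<dots> = (\<Sum>x\<in>S. cnj (c x) * ip (ker x) ?f)"
    by (rule L2_inner_sum[OF S]) (use ker_H f in auto)
  also have "\<dots> = (\<Sum>x\<in>S. cnj (c x) * cnj (?f x))"
  proof (rule sum.cong[OF refl])
    fix x
    have "ip (ker x) ?f = cnj (ip ?f (ker x))" by (simp only: L2_inner_cnj)
    also have "ip ?f (ker x) = ?f x" by (rule reproducing[OF f, symmetric])
    finally show "cnj (c x) * ip (ker x) ?f = cnj (c x) * cnj (?f x)" by simp
  qed
  also have "\<dots> = (\<Sum>x\<in>S. \<Sum>y\<in>S. c y * cnj (c x) * K y x)"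
    by (simp add: sum_distrib_left ker_cnj ac_simps)
  also have "\<dots> = (\<Sum>x\<in>S. \<Sum>y\<in>S. c x * cnj (c y) * K x y)"
    by (rule sum.swap)
  finally have "Re (\<Sum>x\<in>S. \<Sum>y\<in>S. c x * cnj (c y) * K x y) = Re (of_real ((nrm ?f)\<^sup>2))" by simp
  then show "0 \<le> Re (\<Sum>x\<in>S. \<Sum>y\<in>S. c x * cnj (c y) * K x y)" by simp
qed

lemma compressed_psd: "psd (compressed_kernel D K)"
proof -
  have "psd (\<lambda>x y. indicator D x * K x y * indicator D y)"
    unfolding psd_def
  proof (intro conjI allI impI)
    fix x y :: 'a show "indicator D x * K x y * indicator D y = cnj (indicator D y * K y x * indicator D x)"
      by (simp add: ker_cnj indicator_def)
  next
    fix S :: "'a set" and c :: "'a \<Rightarrow> complex" assume S: "finite S"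
    have "(\<Sum>x\<in>S. \<Sum>y\<in>S. c x * cnj (c y) * (indicator D x * K x y * indicator D y)) =
      (\<Sum>x\<in>S. \<Sum>y\<in>S. (c x * indicator D x) * cnj (c y * indicator D y) * K x y)"
      by (intro sum.cong refl) (auto simp: indicator_def)
    then show "0 \<le> Re (\<Sum>x\<in>S. \<Sum>y\<in>S. c x * cnj (c y) * (indicator D x * K x y * indicator D y))"
      using psd_form[OF ker_psd S, of "\<lambda>x. c x * indicator D x"] by simp
  qed
  then show ?thesis by (simp add: compressed_kernel_def[abs_def])
qed

lemma compressed_measurable:
  assumes D: "D \<in> sets \<mu>"
  shows "case_prod (compressed_kernel D K) \<in> borel_measurable (\<mu> \<Otimes>\<^sub>M \<mu>)"
proof -
  have [measurable]: "(\<lambda>p. K (fst p) (snd p)) \<in> borel_measurable (\<mu> \<Otimes>\<^sub>M \<mu>)"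
    using K_measurable by (simp add: case_prod_beta)
  have [measurable]: "(indicator D :: 'a \<Rightarrow> complex) \<in> borel_measurable \<mu>" using D by simp
  show ?thesis unfolding compressed_kernel_def case_prod_beta by measurable
qed

text \<open>The form of \<open>I - G\<close> at \<open>c\<close> is the squared length of
  \<open>c\<close> minus the integral over \<open>D\<close> of the squared modulus of the
  combination. Enlarging \<open>D\<close> to the whole space and applying Pythagoras bounds that
  integral by the squared length.\<close>

lemma ortho_contraction:
  assumes e: "ortho e" and D: "D \<in> sets \<mu>"
  shows "psd (\<lambda>s t. of_bool (s = t) - (\<integral>x. (indicator D x * e s x) * cnj (indicator D x * e t x) \<partial>\<mu>))"
    (is "psd (\<lambda>s t. of_bool (s = t) - ?G s t)")
  unfolding psd_def
proof (intro conjI allI impI)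
  fix s t
  have "cnj (?G t s) = ?G s t" by (simp add: ac_simps flip: Bochner_Integration.integral_cnj)
  then show "of_bool (s = t) - ?G s t = cnj (of_bool (t = s) - ?G t s)" by auto
next
  fix S :: "nat set" and c :: "nat \<Rightarrow> complex" assume S: "finite S"
  have D_L2: "(\<lambda>x. indicator D x * f x) \<in> L2 \<mu>" if "f \<in> L2 \<mu>" for f
  proof -
    have [measurable]: "f \<in> borel_measurable \<mu>" and i: "integrable \<mu> (\<lambda>x. (cmod (f x))\<^sup>2)" using that by (auto simp: L2_def)
    have [measurable]: "(indicator D :: 'a \<Rightarrow> complex) \<in> borel_measurable \<mu>" using D by simp
    have m: "(\<lambda>x. indicator D x * f x) \<in> borel_measurable \<mu>" by measurable
    have "integrable \<mu> (\<lambda>x. (cmod (indicator D x * f x))\<^sup>2)"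
    proof (rule Bochner_Integration.integrable_bound[OF i])
      show "(\<lambda>x. (cmod (indicator D x * f x))\<^sup>2) \<in> borel_measurable \<mu>" using m by measurable
    qed (auto simp: indicator_def)
    then show ?thesis using m by (simp add: L2_def)
  qed
  let ?f = "\<lambda>x. \<Sum>s\<in>S. c s * e s x"
  have f: "?f \<in> L2 \<mu>" by (intro in_L2 H_sum S orthoD(1)[OF e])
  have g: "(\<lambda>x. indicator D x * e s x) \<in> L2 \<mu>" for s by (intro D_L2 in_L2 orthoD(1)[OF e])
  have "(\<Sum>s\<in>S. \<Sum>t\<in>S. c s * cnj (c t) * ?G s t) =
      (\<integral>x. (\<Sum>s\<in>S. \<Sum>t\<in>S. c s * cnj (c t) * ((indicator D x * e s x) * cnj (indicator D x * e t x))) \<partial>\<mu>)"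
    using L2_integrable_mult[OF g g] by (simp add: Bochner_Integration.integral_sum)
  also have "\<dots> = (\<integral>x. of_real ((cmod (indicator D x * ?f x))\<^sup>2) \<partial>\<mu>)"
  proof (rule Bochner_Integration.integral_cong[OF refl])
    fix x
    have "(\<Sum>s\<in>S. \<Sum>t\<in>S. c s * cnj (c t) * ((indicator D x * e s x) * cnj (indicator D x * e t x))) =
       (\<Sum>s\<in>S. indicator D x * (c s * e s x)) * (\<Sum>t\<in>S. cnj (indicator D x * (c t * e t x)))"
      unfolding sum_product by (intro sum.cong refl) simp
    also have "\<dots> = (indicator D x * ?f x) * cnj (indicator D x * ?f x)"
      by (simp add: sum_distrib_left)
    finally show "(\<Sum>s\<in>S. \<Sum>t\<in>S. c s * cnj (c t) * ((indicator D x * e s x) * cnj (indicator D x * e t x))) =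
       of_real ((cmod (indicator D x * ?f x))\<^sup>2)" by (simp only: complex_norm_square)
  qed
  also have "\<dots> = of_real (\<integral>x. (cmod (indicator D x * ?f x))\<^sup>2 \<partial>\<mu>)" by (rule integral_complex_of_real)
  finally have G: "Re (\<Sum>s\<in>S. \<Sum>t\<in>S. c s * cnj (c t) * ?G s t) = (\<integral>x. (cmod (indicator D x * ?f x))\<^sup>2 \<partial>\<mu>)"
    by simp
  also have "\<dots> \<le> (\<integral>x. (cmod (?f x))\<^sup>2 \<partial>\<mu>)"
    by (rule integral_mono) (use D_L2[OF f] f in \<open>auto simp: L2_def indicator_def\<close>)
  also have "\<dots> = (\<Sum>s\<in>S. (cmod (c s))\<^sup>2 * (nrm (e s))\<^sup>2)"
    using ortho_norm_sum[OF e S, of c] by (simp only: L2_norm_sq)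
  also have "\<dots> \<le> (\<Sum>s\<in>S. (cmod (c s))\<^sup>2)"
    using orthoD(3)[OF e] by (intro sum_mono) (metis mult.right_neutral mult_zero_right order_refl power_one zero_le_power2 zero_power2)
  finally have le: "Re (\<Sum>s\<in>S. \<Sum>t\<in>S. c s * cnj (c t) * ?G s t) \<le> (\<Sum>s\<in>S. (cmod (c s))\<^sup>2)" .
  have "(\<Sum>s\<in>S. \<Sum>t\<in>S. c s * cnj (c t) * of_bool (s = t)) = (\<Sum>s\<in>S. c s * cnj (c s))"
    using S by (simp add: of_bool_def if_distrib cong: if_cong)
  then have "Re (\<Sum>s\<in>S. \<Sum>t\<in>S. c s * cnj (c t) * of_bool (s = t)) = (\<Sum>s\<in>S. (cmod (c s))\<^sup>2)"
    by (simp only: Re_sum Re_mult_cnj_self)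
  then show "0 \<le> Re (\<Sum>s\<in>S. \<Sum>t\<in>S. c s * cnj (c t) * (of_bool (s = t) - ?G s t))"
    using le by (simp only: right_diff_distrib sum_subtractf minus_complex.sel diff_ge_0_iff_ge)
qed

context
  fixes D assumes D: "D \<in> sets \<mu>" and fin_D: "integrable \<mu> (\<lambda>x. indicator D x * Re (K x x))"
begin

abbreviation "kc \<equiv> compressed_kernel D K"

text \<open>\<open>gap_tail\<close> for the members cut off to \<open>D\<close>, with the diagonal
  of \<open>K\<close> on \<open>D\<close> as majorant.\<close>

lemma ortho_tail:
  assumes e: "ortho e"
  defines "\<tau> \<equiv> \<lambda>n v w. \<Sum>s. (indicator D v * e (n + s) v) * cnj (indicator D w * e (n + s) w)"
  shows "psd (\<tau> n)" "case_prod (\<tau> n) \<in> borel_measurable (\<mu> \<Otimes>\<^sub>M \<mu>)" "Re (\<tau> n x x) \<le> indicator D x * Re (K x x)"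
    and "0 \<le> gap \<mu> (\<tau> n) i" "gap \<mu> (\<tau> n) i \<le> gap \<mu> (\<tau> (Suc n)) j"
proof -
  have m: "(\<lambda>x. indicator D x * e s x) \<in> borel_measurable \<mu>" for s
    using D in_L2[OF orthoD(1)[OF e], of s] unfolding L2_def by (intro borel_measurable_times) auto
  have sq: "(cmod (indicator D x * e s x))\<^sup>2 = indicator D x * (cmod (e s x))\<^sup>2" for s x
    by (simp add: indicator_def)
  have s1: "summable (\<lambda>s. (cmod (indicator D x * e s x))\<^sup>2)" for x
    unfolding sq by (intro summable_mult ortho_eval_bound(1)[OF e])
  have s2: "(\<Sum>s. (cmod (indicator D x * e s x))\<^sup>2) \<le> indicator D x * Re (K x x)" for x
    unfolding sq suminf_mult[OF ortho_eval_bound(1)[OF e]]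
    by (intro mult_left_mono ortho_eval_bound(2)[OF e]) simp
  show "psd (\<tau> n)" "case_prod (\<tau> n) \<in> borel_measurable (\<mu> \<Otimes>\<^sub>M \<mu>)" "Re (\<tau> n x x) \<le> indicator D x * Re (K x x)"
    "0 \<le> gap \<mu> (\<tau> n) i" "gap \<mu> (\<tau> n) i \<le> gap \<mu> (\<tau> (Suc n)) j"
    unfolding \<tau>_def by (rule gap_tail[OF sf fin_D m s1 s2 ortho_contraction[OF e D]])+
qed

text \<open>
  The members with index \<open>\<ge> n\<close> vanish at the \<open>x\<^sub>i\<close>, so their tail of the Mercer expansion is the
  Schur complement of the block \<open>K(x\<^sub>i, x\<^sub>j)\<close>.
\<close>

lemma janossy_factor:
  assumes e: "ortho e" and total: "\<And>f y. f \<in> H \<Longrightarrow> (\<And>i. ip f (e i) = 0) \<Longrightarrow> f y = 0"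
    and x: "\<And>i. i < n \<Longrightarrow> x i \<in> D"
    and span: "\<And>l. l < n \<Longrightarrow> \<exists>b. \<forall>w. e l w = (\<Sum>s<n. b s * K w (x s))"
    and vanish: "\<And>l j. n \<le> l \<Longrightarrow> j < n \<Longrightarrow> e l (x j) = 0"
  shows "janossy \<mu> kc n x = Re (det_on {..<n} (\<lambda>i j. kc (x i) (x j))) *
     gap \<mu> (\<lambda>v w. \<Sum>s. (indicator D v * e (n + s) v) * cnj (indicator D w * e (n + s) w)) n"
proof -
  let ?\<tau> = "\<lambda>v w. \<Sum>s. (indicator D v * e (n + s) v) * cnj (indicator D w * e (n + s) w)"
  have full: "(\<lambda>s. (indicator D v * e s v) * cnj (indicator D w * e s w)) sums kc v w" for v w
  proof -
    have "(\<lambda>s. indicator D v * (e s v * cnj (e s w)) * indicator D w) sums (indicator D v * K v w * indicator D w)"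
      by (intro sums_mult sums_mult2 mercer[OF e]) (rule total)
    moreover have "indicator D v * (e s v * cnj (e s w)) * indicator D w = (indicator D v * e s v) * cnj (indicator D w * e s w)" for s
      by (simp add: indicator_def)
    ultimately show ?thesis by (simp add: compressed_kernel_def)
  qed
  obtain b where b: "\<And>l w. l < n \<Longrightarrow> e l w = (\<Sum>s<n. b l s * K w (x s))"
    using span by metis
  \<comment> \<open>The removed members \<open>e l\<close> with \<open>l < n\<close> are
    combinations of the kernels at the \<open>x s\<close>, so the head of the Mercer series is a
    combination of the rows \<open>kc (x s)\<close>.\<close>
  have tau: "?\<tau> v w = kc v w - (\<Sum>s<n. (\<Sum>l<n. indicator D v * e l v * cnj (b l s)) * kc (x s) w)" for v w
  proof -
    have "?\<tau> v w = kc v w - (\<Sum>l<n. (indicator D v * e l v) * cnj (indicator D w * e l w))"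
      using sums_split_initial_segment[OF full[of v w], of n] by (simp add: sums_iff add.commute)
    also have "(\<Sum>l<n. (indicator D v * e l v) * cnj (indicator D w * e l w)) =
       (\<Sum>l<n. \<Sum>s<n. indicator D v * e l v * cnj (b l s) * kc (x s) w)"
    proof (rule sum.cong[OF refl])
      fix l assume "l \<in> {..<n}"
      then have "cnj (indicator D w * e l w) = (\<Sum>s<n. cnj (b l s) * kc (x s) w)"
        using x by (simp add: b sum_distrib_left ker_cnj compressed_kernel_def indicator_def)
      then show "(indicator D v * e l v) * cnj (indicator D w * e l w) = (\<Sum>s<n. indicator D v * e l v * cnj (b l s) * kc (x s) w)"
        by (simp only: sum_distrib_left mult.assoc)
    qed
    also have "\<dots> = (\<Sum>s<n. (\<Sum>l<n. indicator D v * e l v * cnj (b l s)) * kc (x s) w)"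
      unfolding sum_distrib_right by (rule sum.swap)
    finally show ?thesis .
  qed
  have tau0: "?\<tau> v (x j) = 0" if "j < n" for v j
    using vanish[OF le_add1 that] by simp
  have factor: "Re (det_on {..<n+m} (\<lambda>i j. kc (if i < n then x i else y i) (if j < n then x j else y j))) =
     Re (det_on {..<n} (\<lambda>i j. kc (x i) (x j))) * Re (det_on {n..<n+m} (\<lambda>i j. ?\<tau> (y i) (y j)))" for m y
  proof -
    let ?z = "\<lambda>i. if i < n then x i else y i"
    let ?a = "\<lambda>i j. kc (?z i) (?z j)"
    let ?C = "\<lambda>i s. \<Sum>l<n. indicator D (?z i) * e l (?z i) * cnj (b l s)"
    have a: "psd ?a" by (rule psd_pullback[OF compressed_psd])
    have res: "?a i j - (\<Sum>s<n. ?C i s * ?a s j) = ?\<tau> (?z i) (?z j)" for i j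
      unfolding tau by simp
    \<comment> \<open>The tail vanishes in the columns of the \<open>x j\<close>, which is the
      elimination relation that \<open>det_on_block\<close> asks of the coefficients
      \<open>?C\<close>.\<close>
    have "det_on ({..<n} \<union> {n..<n+m}) ?a = det_on {..<n} ?a * det_on {n..<n+m} (\<lambda>i j. ?a i j - (\<Sum>s<n. ?C i s * ?a s j))"
    proof (rule det_on_block[OF a])
      fix i j assume j: "j \<in> {..<n}"
      then have "?\<tau> (?z i) (?z j) = 0" using tau0[of j "?z i"] by simp
      then show "?a i j = (\<Sum>s<n. ?C i s * ?a s j)" using res[of i j] by (simp only: right_minus_eq)
    qed auto
    also have "{..<n} \<union> {n..<n+m} = {..<n+m}" by auto
    also have "det_on {..<n} ?a = det_on {..<n} (\<lambda>i j. kc (x i) (x j))" by (rule det_on_cong) simp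
    also have "det_on {n..<n+m} (\<lambda>i j. ?a i j - (\<Sum>s<n. ?C i s * ?a s j)) = det_on {n..<n+m} (\<lambda>i j. ?\<tau> (y i) (y j))"
      unfolding res by (rule det_on_cong) simp
    finally have "det_on {..<n+m} ?a = det_on {..<n} (\<lambda>i j. kc (x i) (x j)) * det_on {n..<n+m} (\<lambda>i j. ?\<tau> (y i) (y j))" .
    moreover have "Im (det_on {..<n} (\<lambda>i j. kc (x i) (x j))) = 0"
      using psd_det_on_hadamard[OF psd_pullback[OF compressed_psd], of "{..<n}"] by blast
    ultimately show ?thesis by simp
  qed
  have "janossy \<mu> kc n x = (\<Sum>m. Re (det_on {..<n} (\<lambda>i j. kc (x i) (x j))) * ((-1) ^ m / fact m *
      (\<integral>y. Re (det_on {n..<n+m} (\<lambda>i j. ?\<tau> (y i) (y j))) \<partial>PiM {n..<n+m} (\<lambda>_. \<mu>))))"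
    unfolding janossy_def factor by (rule suminf_cong) (simp only: integral_mult_right_zero mult.left_commute)
  also have "\<dots> = Re (det_on {..<n} (\<lambda>i j. kc (x i) (x j))) * gap \<mu> ?\<tau> n"
    unfolding gap_def
  proof (rule suminf_mult)
    let ?M = "\<lambda>m. (\<integral>x. indicator D x * Re (K x x) \<partial>\<mu>) ^ m / fact m"
    have "summable ?M"
      using summable_exp[of "\<integral>x. indicator D x * Re (K x x) \<partial>\<mu>"] by (simp add: field_simps)
    then show "summable (\<lambda>m. (-1) ^ m / fact m * (\<integral>y. Re (det_on {n..<n+m} (\<lambda>i j. ?\<tau> (y i) (y j))) \<partial>PiM {n..<n+m} (\<lambda>_. \<mu>)))"
    proof (rule summable_comparison_test'[where N=0])
      show "norm ((-1) ^ m / fact m * (\<integral>y. Re (det_on {n..<n+m} (\<lambda>i j. ?\<tau> (y i) (y j))) \<partial>PiM {n..<n+m} (\<lambda>_. \<mu>))) \<le> ?M m" for m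
      proof -
        have "norm ((-1) ^ m / fact m * I) = \<bar>I\<bar> / fact m" for I :: real
          by (simp add: abs_mult power_abs)
        then show ?thesis
          by (simp only: divide_right_mono[OF gap_term_bound[OF sf fin_D ortho_tail(1)[OF e, where n = n]
              ortho_tail(2)[OF e, where n = n] ortho_tail(3)[OF e, where n = n], of n m] fact_ge_zero])
      qed
    qed
  qed
  finally show ?thesis .
qed

lemma janossy_outside:
  assumes "i < n" "x i \<notin> D"
  shows "janossy \<mu> kc n x = 0" "det_on {..<n} (\<lambda>i j. kc (x i) (x j)) = 0"
proof -
  have k0: "kc (x i) w = 0" for w using assms(2) by (simp add: compressed_kernel_def)
  show "det_on {..<n} (\<lambda>i j. kc (x i) (x j)) = 0"
    by (rule det_on_zero_row[of _ i]) (use assms(1) k0 in auto)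
  have "det_on {..<n+m} (\<lambda>i j. kc (if i < n then x i else y i) (if j < n then x j else y j)) = 0" for m y
    by (rule det_on_zero_row[of _ i]) (use assms(1) k0 in auto)
  then show "janossy \<mu> kc n x = 0" unfolding janossy_def by simp
qed

text \<open>Gram-Schmidt on the \<open>N\<close> kernels at the points, followed by the total
  sequence. A member is orthogonal to the kernels that precede it, and orthogonality to the kernel
  at \<open>x j\<close> means vanishing at \<open>x j\<close>.\<close>

lemma adapted_ortho:
  fixes x :: "nat \<Rightarrow> 'a"
  obtains e where "ortho e" "\<And>f y. f \<in> H \<Longrightarrow> (\<And>i. ip f (e i) = 0) \<Longrightarrow> f y = 0"
    "\<And>l m. l < m \<Longrightarrow> m \<le> N \<Longrightarrow> \<exists>b. \<forall>w. e l w = (\<Sum>s<m. b s * K w (x s))"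
    "\<And>l j. j < l \<Longrightarrow> j < N \<Longrightarrow> e l (x j) = 0"
proof -
  define v where "v i = (if i < N then ker (x i) else h (i - N))" for i
  have v: "v i \<in> H" for i unfolding v_def using ker_H h_H by simp
  define e where "e = gram_schmidt v"
  have e: "ortho e" unfolding e_def by (rule gram_schmidt_ortho) (rule v)
  have expand: "\<exists>a. v m = (\<lambda>y. \<Sum>i\<in>{..m}. a i * e i y)" for m
    unfolding e_def fun_eq_iff by (rule gram_schmidt_expand) (rule v)
  have total: "f y = 0" if f: "f \<in> H" and 0: "\<And>i. ip f (e i) = 0" for f y
  proof (rule h_total[OF f])
    fix i
    obtain a where a: "v (i + N) = (\<lambda>y. \<Sum>j\<in>{..i + N}. a j * e j y)" using expand by blast
    have "ip (v (i + N)) f = (\<Sum>j\<in>{..i + N}. a j * ip (e j) f)"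
      unfolding a by (rule L2_inner_sum) (use orthoD(1)[OF e] f in auto)
    also have "\<dots> = 0"
      using 0 L2_inner_cnj[of \<mu> f] by (intro sum.neutral ballI) (metis complex_cnj_zero mult_zero_right)
    finally have "ip (h i) f = 0" by (simp add: v_def)
    then show "ip f (h i) = 0" using L2_inner_cnj[of \<mu> "h i" f] by simp
  qed
  have span: "\<exists>b. \<forall>w. e l w = (\<Sum>s<m. b s * K w (x s))" if lm: "l < m" "m \<le> N" for l m
  proof -
    obtain b where b: "\<And>w. e l w = (\<Sum>s\<in>{..l}. b s * v s w)"
      using gram_schmidt_span[of v l] unfolding e_def by blast
    have "e l w = (\<Sum>s<m. (if s \<le> l then b s else 0) * K w (x s))" for w
      unfolding b by (rule sum.mono_neutral_cong_left) (use lm in \<open>auto simp: v_def\<close>)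
    then show ?thesis by (intro exI allI)
  qed
  have vanish: "e l (x j) = 0" if "j < l" "j < N" for l j
  proof -
    obtain a where a: "v j = (\<lambda>y. \<Sum>i\<in>{..j}. a i * e i y)" using expand by blast
    have "ip (v j) (e l) = (\<Sum>i\<in>{..j}. a i * ip (e i) (e l))"
      unfolding a by (rule L2_inner_sum) (use orthoD(1)[OF e] in auto)
    also have "\<dots> = 0" using that orthoD(2)[OF e] by (intro sum.neutral) auto
    finally have "ip (ker (x j)) (e l) = 0" using that by (simp add: v_def)
    then show ?thesis using ortho_eval[OF e, of l "x j"] by simp
  qed
  show ?thesis using e total span vanish by (rule that)
qed

text \<open>One system adapted to \<open>N\<close> points serves all \<open>n \<le> N\<close>; this
  makes the factors for \<open>n\<close> and \<open>n + 1\<close> comparable. \<open>V n\<close> is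
  the gap of the tail from index \<open>n\<close> on.\<close>

lemma janossy_inside:
  assumes x: "\<And>i. i < N \<Longrightarrow> x i \<in> D"
  shows "\<exists>V. (\<forall>n. 0 \<le> V n \<and> V n \<le> V (Suc n)) \<and>
    (\<forall>n\<le>N. janossy \<mu> kc n x = Re (det_on {..<n} (\<lambda>i j. kc (x i) (x j))) * V n)"
proof -
  obtain e where e: "ortho e" and total: "\<And>f y. f \<in> H \<Longrightarrow> (\<And>i. ip f (e i) = 0) \<Longrightarrow> f y = 0"
    and span: "\<And>l m. l < m \<Longrightarrow> m \<le> N \<Longrightarrow> \<exists>b. \<forall>w. e l w = (\<Sum>s<m. b s * K w (x s))"
    and vanish: "\<And>l j. j < l \<Longrightarrow> j < N \<Longrightarrow> e l (x j) = 0"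
    using adapted_ortho[of N x] by blast
  note tail = ortho_tail[OF e]
  have "janossy \<mu> kc n x = Re (det_on {..<n} (\<lambda>i j. kc (x i) (x j))) *
      gap \<mu> (\<lambda>v w. \<Sum>s. (indicator D v * e (n + s) v) * cnj (indicator D w * e (n + s) w)) n" if "n \<le> N" for n
    proof (rule janossy_factor[OF e])
      show "f y = 0" if "f \<in> H" "\<And>i. ip f (e i) = 0" for f y using that by (rule total)
      show "x i \<in> D" if "i < n" for i using that x \<open>n \<le> N\<close> by simp
      show "\<exists>b. \<forall>w. e l w = (\<Sum>s<n. b s * K w (x s))" if "l < n" for l using span[OF that \<open>n \<le> N\<close>] .
      show "e l (x j) = 0" if "n \<le> l" "j < n" for l j using vanish[of j l] that \<open>n \<le> N\<close> by simp
    qed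
  then show ?thesis using tail(4,5)
    by (intro exI[of _ "\<lambda>n. gap \<mu> (\<lambda>v w. \<Sum>s. (indicator D v * e (n + s) v) * cnj (indicator D w * e (n + s) w)) n"]) blast
qed

lemma det_compressed_nonneg: "0 \<le> Re (det_on {..<n} (\<lambda>i j. kc (x i) (x j)))" for n :: nat
  using psd_det_on_hadamard[OF psd_pullback[OF compressed_psd], of "{..<n}"] by blast

text \<open>With the factors \<open>V\<close> of \<open>janossy_inside\<close>, the quotient turns
  the determinant for \<open>n\<close> into the one for \<open>n + 1\<close>, while \<open>V\<close>
  can only grow. If the determinant for \<open>n\<close> is 0, the quotient and hence the left side
  are 0.\<close>

lemma janossy_Suc:
  shows "Re (det_on {..<Suc n} (\<lambda>i j. kc (x i) (x j))) / Re (det_on {..<n} (\<lambda>i j. kc (x i) (x j))) * janossy \<mu> kc n x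
    \<le> janossy \<mu> kc (Suc n) x" (is "?d / ?c * _ \<le> _")
proof (cases "\<forall>i<Suc n. x i \<in> D")
  case True
  then have "\<And>i. i < Suc n \<Longrightarrow> x i \<in> D" by blast
  then obtain U where U: "\<forall>m. 0 \<le> U m \<and> U m \<le> U (Suc m)"
    "\<forall>m\<le>Suc n. janossy \<mu> kc m x = Re (det_on {..<m} (\<lambda>i j. kc (x i) (x j))) * U m"
    using janossy_inside[of "Suc n" x] by blast
  define V W where "V = U n" and "W = U (Suc n)"
  have VW: "0 \<le> V" "V \<le> W" "janossy \<mu> kc n x = ?c * V" "janossy \<mu> kc (Suc n) x = ?d * W"
    using U by (simp_all add: V_def W_def)
  have "?d / ?c * (?c * V) \<le> ?d * V"
    using det_compressed_nonneg[of "Suc n" x] VW(1) by (cases "?c = 0") auto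
  also have "\<dots> \<le> ?d * W" using VW(2) det_compressed_nonneg by (intro mult_left_mono)
  finally show ?thesis unfolding VW .
next
  case False
  then obtain i where i: "i < Suc n" "x i \<notin> D" by blast
  \<comment> \<open>A point outside \<open>D\<close> produces a zero row in \<open>?d\<close> and in
    the right side, so both sides are 0.\<close>
  show ?thesis using janossy_outside[of i "Suc n" x, OF i] by simp
qed

lemma janossy_nonneg: "0 \<le> janossy \<mu> kc n x"
proof (cases "\<forall>i<n. x i \<in> D")
  case True
  then have "\<And>i. i < n \<Longrightarrow> x i \<in> D" by blast
  then obtain U where "\<forall>m. 0 \<le> U m \<and> U m \<le> U (Suc m)"
    "\<forall>m\<le>n. janossy \<mu> kc m x = Re (det_on {..<m} (\<lambda>i j. kc (x i) (x j))) * U m"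
    using janossy_inside[of n x] by blast
  then show ?thesis using det_compressed_nonneg[of n x] by simp
next
  case False
  then obtain i where "i < n" "x i \<notin> D" by blast
  then show ?thesis using janossy_outside(1)[of i n x] by simp
qed

end

end

section \<open>Configurations and sums over tuples of points\<close>

lemma proper_compact_closure:
  fixes A :: "'a::metric_space set"
  assumes "proper_space TYPE('a)" "bounded A"
  shows "compact (closure A)"
proof -
  obtain x :: 'a and r where "A \<subseteq> cball x r"
    using assms(2) unfolding bounded_def by fastforce
  then have "closure A \<subseteq> cball x r" by (simp add: closure_minimal)
  then have "closure A = cball x r \<inter> closure A" by blast
  then show ?thesis using compact_Int_closed[of "cball x r" "closure A"] assms(1)
    by (metis proper_space_def closed_closure)
qed

lemma space_configurations: "space configurations = {S. locally_finite S}"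
  unfolding configurations_def by (rule space_measure_of) auto

lemma sets_configurations: "sets (configurations :: 'a::topological_space set measure) =
    sigma_sets {S. locally_finite S}
      {{S. locally_finite S \<and> card (S \<inter> A) = k} | A k. A \<in> sets borel \<and> compact (closure A)}"
  unfolding configurations_def by (rule sets_measure_of) auto

lemma measurable_configurationsI:
  fixes f :: "'w \<Rightarrow> 'a::topological_space set"
  assumes "\<And>w. w \<in> space M \<Longrightarrow> locally_finite (f w)"
    and "\<And>A k. A \<in> sets borel \<Longrightarrow> compact (closure A) \<Longrightarrow> {w \<in> space M. card (f w \<inter> A) = k} \<in> sets M"
  shows "f \<in> measurable M configurations"
  unfolding configurations_def
proof (rule measurable_measure_of)
  fix Y :: "'a set set" assume "Y \<in> {{S. locally_finite S \<and> card (S \<inter> A) = k} | A k. A \<in> sets borel \<and> compact (closure A)}"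
  then obtain A k where A: "A \<in> sets borel" "compact (closure A)" and Y: "Y = {S. locally_finite S \<and> card (S \<inter> A) = k}" by blast
  have "f -` Y \<inter> space M = {w \<in> space M. card (f w \<inter> A) = k}" using assms(1) by (auto simp: Y)
  then show "f -` Y \<inter> space M \<in> sets M" using assms(2)[OF A] by simp
qed (use assms(1) in auto)

lemma locally_finite_subset: "locally_finite S \<Longrightarrow> T \<subseteq> S \<Longrightarrow> locally_finite T"
  unfolding locally_finite_def by (meson Int_mono finite_subset order_refl)

lemma finite_locally_finite: "finite S \<Longrightarrow> locally_finite S"
  unfolding locally_finite_def by simp

context
  assumes proper: "proper_space TYPE('a::{metric_space, second_countable_topology})"
begin

lemma configuration_finite:
  fixes A :: "'a set"
  assumes "S \<in> space configurations" "bounded A"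
  shows "finite (S \<inter> A)"
proof -
  have "finite (S \<inter> closure A)"
    using assms(1) proper_compact_closure[OF proper assms(2)] by (auto simp: space_configurations locally_finite_def)
  then show ?thesis by (rule rev_finite_subset) (use closure_subset in blast)
qed

lemma measurable_card:
  fixes A :: "'a set"
  assumes "A \<in> sets borel" "bounded A"
  shows "(\<lambda>S. card (S \<inter> A)) \<in> measurable configurations (count_space UNIV)"
proof (subst measurable_count_space_eq2_countable, intro conjI ballI)
  show "(\<lambda>S. card (S \<inter> A)) -` {k} \<inter> space configurations \<in> sets configurations" for k
  proof -
    have "{S. locally_finite S \<and> card (S \<inter> A) = k} \<in> sets configurations"
      unfolding sets_configurations
      by (rule sigma_sets.Basic) (use assms proper_compact_closure[OF proper] in blast)
    moreover have "(\<lambda>S. card (S \<inter> A)) -` {k} \<inter> space configurations = {S. locally_finite S \<and> card (S \<inter> A) = k}"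
      by (auto simp: space_configurations)
    ultimately show ?thesis by simp
  qed
qed auto

lemma compact_closure_bounded: "compact (closure (A :: 'a set)) \<Longrightarrow> bounded A"
  using compact_imp_bounded bounded_subset closure_subset by blast

lemma measurable_configurations_Int:
  fixes A :: "'a set"
  assumes "A \<in> sets borel"
  shows "(\<lambda>S. S \<inter> A) \<in> measurable configurations configurations"
proof (rule measurable_configurationsI)
  fix C :: "'a set" and k assume C: "C \<in> sets borel" "compact (closure C)"
  then have "bounded C" by (simp add: compact_closure_bounded)
  then have "A \<inter> C \<in> sets borel" "bounded (A \<inter> C)" using C assms bounded_subset by auto
  from measurable_sets[OF measurable_card[OF this], of "{k}"]
  have "(\<lambda>S. card (S \<inter> (A \<inter> C))) -` {k} \<inter> space configurations \<in> sets configurations" by simp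
  moreover have "{S \<in> space configurations. card (S \<inter> A \<inter> C) = k} = (\<lambda>S. card (S \<inter> (A \<inter> C))) -` {k} \<inter> space configurations"
    by (auto simp: Int_assoc)
  ultimately show "{S \<in> space configurations. card (S \<inter> A \<inter> C) = k} \<in> sets configurations" by simp
qed (auto simp: space_configurations intro: locally_finite_subset)

lemma measurable_configurations_diff:
  fixes A :: "'a set"
  assumes "A \<in> sets borel"
  shows "(\<lambda>S. S - A) \<in> measurable configurations configurations"
  using measurable_configurations_Int[of "- A"] assms by (simp add: Diff_eq)

end

text \<open>An integral over a counting measure, so that convergence theorems apply and
  \<open>Z\<close> may be infinite.\<close>

definition tuple_sum :: "nat \<Rightarrow> 'a set \<Rightarrow> ((nat \<Rightarrow> 'a) \<Rightarrow> ennreal) \<Rightarrow> ennreal" where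
  "tuple_sum n Z g = (\<integral>\<^sup>+z. g z \<partial>count_space (distinct_tuples n Z))"

lemma distinct_tuples_finite: "finite Z \<Longrightarrow> finite (distinct_tuples n Z)"
  unfolding distinct_tuples_def by (rule card_inj_PiE(1)) auto

lemma card_distinct_tuples: "finite Z \<Longrightarrow> card (distinct_tuples n Z) = fact n * (card Z choose n)"
  unfolding distinct_tuples_def using card_inj_PiE(2)[of "{..<n}" Z] by simp

lemma tuple_sum_finite: "finite Z \<Longrightarrow> tuple_sum n Z g = (\<Sum>z\<in>distinct_tuples n Z. g z)"
  unfolding tuple_sum_def by (simp add: nn_integral_count_space_finite distinct_tuples_finite)

text \<open>With distinctness moved into the integrand the tuples run over a full product, over
  which indicators of boxes factor.\<close>

lemma tuple_sum_all: "tuple_sum n Z g =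
  (\<integral>\<^sup>+z. g z * indicator {z. inj_on z {..<n}} z \<partial>count_space ({..<n} \<rightarrow>\<^sub>E Z))"
proof -
  have "tuple_sum n Z g = (\<integral>\<^sup>+z. g z * indicator {z. inj_on z {..<n}} z \<partial>count_space (distinct_tuples n Z))"
    unfolding tuple_sum_def by (intro nn_integral_cong) (auto simp: distinct_tuples_def)
  also have "\<dots> = (\<integral>\<^sup>+z. g z * indicator {z. inj_on z {..<n}} z \<partial>count_space ({..<n} \<rightarrow>\<^sub>E Z))"
    by (rule nn_integral_count_space_eq) (auto simp: distinct_tuples_def)
  finally show ?thesis .
qed

lemma sets_inj_on:
  fixes M :: "'a::{second_countable_topology, t2_space} measure"
  assumes M: "sets M = sets borel" and n: "finite I"
  shows "{z \<in> space (PiM I (\<lambda>_. M)). inj_on z I} \<in> sets (PiM I (\<lambda>_. M))"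
proof -
  have "{z \<in> space (PiM I (\<lambda>_. M)). z i = z j} \<in> sets (PiM I (\<lambda>_. M))" if "i \<in> I" "j \<in> I" for i j
  proof (rule measurable_equality_set)
    have *: "(\<lambda>z. z i) \<in> measurable (PiM I (\<lambda>_. M)) M" if "i \<in> I" for i
      using that by (rule measurable_component_singleton)
    show "(\<lambda>z. z i) \<in> borel_measurable (PiM I (\<lambda>_. M))" "(\<lambda>z. z j) \<in> borel_measurable (PiM I (\<lambda>_. M))"
      using *[OF \<open>i \<in> I\<close>] *[OF \<open>j \<in> I\<close>] by (simp_all add: measurable_cong_sets[OF refl M])
  qed
  then have "{z \<in> space (PiM I (\<lambda>_. M)). \<forall>i\<in>I. \<forall>j\<in>I. z i = z j \<longrightarrow> i = j} \<in> sets (PiM I (\<lambda>_. M))"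
    using n by (intro sets.sets_Collect_finite_All sets.sets_Collect_imp) auto
  then show ?thesis by (simp add: inj_on_def)
qed

context
  fixes D :: "'a::{metric_space, second_countable_topology} set" and M :: "'a measure"
  assumes proper: "proper_space TYPE('a)" and D: "D \<in> sets borel" "bounded D" and M: "sets M = sets borel"
begin

lemma finite_Int_D: "S \<in> space configurations \<Longrightarrow> finite (S \<inter> D)"
  using configuration_finite[OF proper] D by blast

text \<open>For a box the sum is a product of point counts, which are measurable by the choice of
  the sigma-algebra on configurations. Dynkin's lemma passes from boxes to measurable sets, and
  induction to functions.\<close>

lemma all_tuples_measurable:
  fixes n :: nat
  assumes g: "g \<in> borel_measurable (PiM {..<n} (\<lambda>_. M))"
  shows "(\<lambda>S. \<integral>\<^sup>+z. g z \<partial>count_space ({..<n} \<rightarrow>\<^sub>E (S \<inter> D))) \<in> borel_measurable configurations"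
    (is "?T g \<in> _")
proof -
  let ?F = "\<lambda>S. {..<n} \<rightarrow>\<^sub>E (S \<inter> D)"
  let ?\<Omega> = "{..<n} \<rightarrow>\<^sub>E (UNIV :: 'a set)"
  have spM: "space M = UNIV" using sets_eq_imp_space_eq[OF M] by simp
  have finF: "finite (?F S)" if "S \<in> space configurations" for S
    using finite_Int_D[OF that] by (intro finite_PiE) auto
  have ind: "?T (indicator A) \<in> borel_measurable configurations" if A: "A \<in> sets (PiM {..<n} (\<lambda>_. M))" for A
  proof -
    have rect: "?T (indicator (PiE {..<n} X)) \<in> borel_measurable configurations" if X: "\<And>i. i < n \<Longrightarrow> X i \<in> sets borel" for X
    proof -
      have eq: "?T (indicator (PiE {..<n} X)) S = ennreal (\<Prod>i<n. real (card (S \<inter> (D \<inter> X i))))" if S: "S \<in> space configurations" for S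
      proof -
        have "?T (indicator (PiE {..<n} X)) S = emeasure (count_space (?F S)) (PiE {..<n} X \<inter> ?F S)"
          by (subst nn_integral_indicator[symmetric]) (auto intro!: nn_integral_cong simp del: nn_integral_indicator split: split_indicator)
        also have "\<dots> = of_nat (card (PiE {..<n} X \<inter> ?F S))"
          using finF[OF S] by (subst emeasure_count_space_finite) auto
        also have "PiE {..<n} X \<inter> ?F S = PiE {..<n} (\<lambda>i. S \<inter> (D \<inter> X i))"
          by (auto simp: PiE_Int Int_ac)
        also have "of_nat (card \<dots>) = ennreal (\<Prod>i<n. real (card (S \<inter> (D \<inter> X i))))"
          by (subst card_PiE) (simp_all add: ennreal_of_nat_eq_real_of_nat)
        finally show ?thesis .
      qed
      have [measurable]: "(\<lambda>S. card (S \<inter> (D \<inter> X i))) \<in> measurable configurations (count_space UNIV)" if "i < n" for i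
        by (rule measurable_card[OF proper]) (use D X[OF that] in \<open>auto intro: bounded_subset\<close>)
      have "(\<lambda>S. ennreal (\<Prod>i<n. real (card (S \<inter> (D \<inter> X i))))) \<in> borel_measurable configurations"
        by (intro measurable_compose[OF _ measurable_ennreal] borel_measurable_prod) (auto intro: measurable_compose[OF _ measurable_count_space])
      then show ?thesis using measurable_cong[of configurations "?T (indicator (PiE {..<n} X))", OF eq] by blast
    qed
    have full: "?T (indicator ?\<Omega>) \<in> borel_measurable configurations" by (rule rect) simp
    have A': "A \<in> sigma_sets ?\<Omega> {PiE {..<n} X | X. \<forall>i\<in>{..<n}. X i \<in> sets M}"
      using A by (simp add: sets_PiM prod_algebra_eq_finite spM Pi_iff)
    have I': "Int_stable {PiE {..<n} X | X. \<forall>i\<in>{..<n}. X i \<in> sets M}" by (rule Int_stable_PiE)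
    have P': "{PiE {..<n} X | X. \<forall>i\<in>{..<n}. X i \<in> sets M} \<subseteq> Pow ?\<Omega>" by auto
    show ?thesis
      using I' P' A'
    proof (induction rule: sigma_sets_induct_disjoint)
      case (basic A) then show ?case using rect M by auto
    next
      case empty then show ?case by simp
    next
      case (compl A)
      \<comment> \<open>Subtraction in the extended reals is legitimate because a configuration has
        finitely many points in \<open>D\<close>.\<close>
      have eq: "?T (indicator (?\<Omega> - A)) S = ?T (indicator ?\<Omega>) S - ?T (indicator A) S" if S: "S \<in> space configurations" for S
      proof -
        have "?T (indicator ?\<Omega>) S - ?T (indicator A) S = (\<integral>\<^sup>+z. indicator ?\<Omega> z - indicator A z \<partial>count_space (?F S))"
        proof (rule nn_integral_diff[symmetric])
          have "(\<integral>\<^sup>+z. indicator A z \<partial>count_space (?F S)) \<le> (\<integral>\<^sup>+z. 1 \<partial>count_space (?F S))"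
            by (intro nn_integral_mono) (simp split: split_indicator)
          also have "\<dots> < \<top>" using finF[OF S] by (simp add: nn_integral_count_space_finite of_nat_less_top)
          finally show "(\<integral>\<^sup>+z. indicator A z \<partial>count_space (?F S)) \<noteq> \<infinity>" by simp
          show "AE z in count_space (?F S). indicator A z \<le> (indicator ?\<Omega> z :: ennreal)"
            by (auto simp: AE_count_space split: split_indicator)
        qed auto
        also have "\<dots> = ?T (indicator (?\<Omega> - A)) S"
          by (intro nn_integral_cong) (auto split: split_indicator)
        finally show ?thesis by simp
      qed
      have "(\<lambda>S. ?T (indicator ?\<Omega>) S - ?T (indicator A) S) \<in> borel_measurable configurations"
        by (intro borel_measurable_minus_ennreal full compl(2))
      then show ?case using measurable_cong[of configurations "?T (indicator (?\<Omega> - A))", OF eq] by blast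
    next
      case (union A)
      have "?T (indicator (\<Union>i. A i)) = (\<lambda>S. \<Sum>i. ?T (indicator (A i)) S)"
        by (simp add: nn_integral_suminf[symmetric] suminf_indicator[OF union(1)])
      then show ?case using union by simp
    qed
  qed
  show ?thesis
    using g
  proof (induction rule: borel_measurable_induct)
    case (cong f g)
    have "?T f = ?T g"
      by (intro ext nn_integral_cong) (use cong(3) in \<open>auto simp: space_PiM spM\<close>)
    then show ?case using cong by simp
  next
    case (set A) then show ?case by (rule ind)
  next
    case (mult u c) then show ?case by (simp add: nn_integral_cmult)
  next
    case (add u v) then show ?case by (simp add: nn_integral_add)
  next
    case (seq U)
    have "?T (SUP i. U i) = (\<lambda>S. SUP i. ?T (U i) S)"
      unfolding SUP_apply using seq by (intro ext nn_integral_monotone_convergence_SUP) simp_all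
    moreover have "(\<lambda>S. SUP i. ?T (U i) S) \<in> borel_measurable configurations"
      using seq.IH by (intro borel_measurable_SUP) auto
    ultimately show ?case by (simp only:)
  qed
qed

lemma tuple_sum_measurable:
  assumes g: "g \<in> borel_measurable (PiM {..<n} (\<lambda>_. M))"
  shows "(\<lambda>S. tuple_sum n (S \<inter> D) g) \<in> borel_measurable configurations"
proof -
  have spM: "space M = UNIV" using sets_eq_imp_space_eq[OF M] by simp
  let ?I = "{z \<in> space (PiM {..<n} (\<lambda>_. M)). inj_on z {..<n}}"
  have I: "?I \<in> sets (PiM {..<n} (\<lambda>_. M))" by (rule sets_inj_on[OF M]) simp
  have "tuple_sum n (S \<inter> D) g = (\<integral>\<^sup>+z. g z * indicator ?I z \<partial>count_space ({..<n} \<rightarrow>\<^sub>E (S \<inter> D)))" for S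
    unfolding tuple_sum_all by (intro nn_integral_cong) (auto simp: space_PiM spM split: split_indicator)
  moreover have "(\<lambda>z. g z * indicator ?I z) \<in> borel_measurable (PiM {..<n} (\<lambda>_. M))"
    using g I by (intro borel_measurable_times_ennreal borel_measurable_indicator)
  ultimately show ?thesis by (simp only: all_tuples_measurable)
qed

end

section \<open>Determinantal processes in a window\<close>

lemma det_eq_det_on:
  "Determinant.det (Matrix.mat n n (\<lambda>(i, j). a i j)) = det_on {..<n} a"
proof -
  have "Determinant.det (Matrix.mat n n (\<lambda>(i, j). a i j)) =
    (\<Sum>p | p permutes {0..<n}. signof p * (\<Prod>i = 0..<n. Matrix.mat n n (\<lambda>(i, j). a i j) $$ (i, p i)))"
    by (rule det_def') simp
  also have "\<dots> = det_on {0..<n} a"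
    unfolding det_on_def
    by (intro sum.cong refl arg_cong2[where f="(*)"] prod.cong) (auto simp: permutes_in_image sign_def)
  finally show ?thesis by (simp add: atLeast0LessThan)
qed

section \<open>Inclusion-exclusion for tuples of points\<close>

lemma card_tuple_extensions:
  assumes Z: "finite Z"
  shows "card {z \<in> distinct_tuples (n + m) Z. restrict z {..<n} \<in> A} =
    card (distinct_tuples n Z \<inter> A) * (fact m * (card Z - n choose m))"
proof -
  let ?T = "{z \<in> distinct_tuples (n + m) Z. restrict z {..<n} \<in> A}"
  let ?r = "\<lambda>z. restrict z {..<n}"
  have fin: "finite ?T" "finite (distinct_tuples n Z \<inter> A)" using distinct_tuples_finite[OF Z] by auto
  \<comment> \<open>Tuples are grouped by their first \<open>n\<close> coordinates; the other
    \<open>m\<close> form an injection into the points not yet used.\<close>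
  have "card ?T = (\<Sum>w\<in>distinct_tuples n Z \<inter> A. \<Sum>z | z \<in> ?T \<and> ?r z = w. 1)"
  proof (subst sum.group)
    show "?r ` ?T \<subseteq> distinct_tuples n Z \<inter> A"
      by (auto simp: distinct_tuples_def PiE_def Pi_def inj_on_def)
  qed (use fin in auto)
  also have "\<dots> = (\<Sum>w\<in>distinct_tuples n Z \<inter> A. fact m * (card Z - n choose m))"
  proof (rule sum.cong[OF refl])
    fix w assume w: "w \<in> distinct_tuples n Z \<inter> A"
    then have wZ: "w ` {..<n} \<subseteq> Z" and wi: "inj_on w {..<n}" and we: "w \<in> {..<n} \<rightarrow>\<^sub>E Z" by (auto simp: distinct_tuples_def)
    let ?J = "{n..<n+m}"
    let ?F = "{f \<in> ?J \<rightarrow>\<^sub>E Z - w ` {..<n}. inj_on f ?J}"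
    have "bij_betw (\<lambda>z. restrict z ?J) {z. z \<in> ?T \<and> ?r z = w} ?F"
    proof (rule bij_betw_byWitness[where f' = "\<lambda>f i. if i < n then w i else f i"])
      show "\<forall>z\<in>{z. z \<in> ?T \<and> ?r z = w}. (\<lambda>i. if i < n then w i else restrict z ?J i) = z"
      proof
        fix z assume z: "z \<in> {z. z \<in> ?T \<and> ?r z = w}"
        then have "z i = w i" if "i < n" for i using that by (auto dest: fun_cong[of _ _ i])
        moreover have "z i = undefined" if "i \<ge> n + m" for i
          using z that by (auto simp: distinct_tuples_def PiE_def extensional_def)
        ultimately show "(\<lambda>i. if i < n then w i else restrict z ?J i) = z" by (auto simp: fun_eq_iff)
      qed
      show "\<forall>f\<in>?F. restrict (\<lambda>i. if i < n then w i else f i) ?J = f"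
        by (auto simp: fun_eq_iff PiE_def extensional_def)
      show "(\<lambda>z. restrict z ?J) ` {z. z \<in> ?T \<and> ?r z = w} \<subseteq> ?F"
      proof
        fix f assume "f \<in> (\<lambda>z. restrict z ?J) ` {z. z \<in> ?T \<and> ?r z = w}"
        then obtain z where z: "z \<in> ?T" "?r z = w" and f: "f = restrict z ?J" by blast
        have zi: "inj_on z {..<n+m}" and zZ: "\<And>i. i < n + m \<Longrightarrow> z i \<in> Z" using z by (auto simp: distinct_tuples_def)
        have zw: "w i = z i" if "i < n" for i using z(2) that by (auto dest: fun_cong[of _ _ i])
        have "z i \<notin> w ` {..<n}" if "i \<in> ?J" for i
        proof
          assume "z i \<in> w ` {..<n}"
          then obtain j where "j < n" "z i = z j" using zw by auto
          then have "i = j" using zi that by (auto dest: inj_onD)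
          then show False using that \<open>j < n\<close> by simp
        qed
        moreover have "inj_on z ?J" using zi by (rule inj_on_subset) auto
        ultimately show "f \<in> ?F" using zZ by (auto simp: f inj_on_def)
      qed
      show "(\<lambda>f i. if i < n then w i else f i) ` ?F \<subseteq> {z. z \<in> ?T \<and> ?r z = w}"
      proof
        fix z assume "z \<in> (\<lambda>f i. if i < n then w i else f i) ` ?F"
        then obtain f where f: "f \<in> ?F" and z: "z = (\<lambda>i. if i < n then w i else f i)" by blast
        have fJ: "f i \<in> Z" "f i \<notin> w ` {..<n}" if "n \<le> i" "i < n + m" for i
          using f that by (auto simp: PiE_def Pi_def)
        have "z \<in> {..<n+m} \<rightarrow>\<^sub>E Z"
          using we f fJ by (auto simp: z PiE_def extensional_def Pi_def)
        moreover have "inj_on z {..<n+m}"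
        proof (rule inj_onI)
          fix i j assume ij: "i \<in> {..<n+m}" "j \<in> {..<n+m}" "z i = z j"
          consider "i < n" "j < n" | "i < n" "n \<le> j" | "n \<le> i" "j < n" | "n \<le> i" "n \<le> j" by linarith
          then show "i = j"
          proof cases
            case 1 then show ?thesis using ij wi by (auto simp: z dest: inj_onD)
          next
            case 2
            then have "f j = w i" using ij by (simp add: z)
            then have "f j \<in> w ` {..<n}" using 2 by auto
            then show ?thesis using 2 ij fJ(2)[of j] by auto
          next
            case 3 then show ?thesis using ij fJ(2)[of i] by (auto simp: z)
          next
            case 4
            then have "f i = f j" using ij by (simp add: z)
            then show ?thesis using 4 ij f by (auto dest: inj_onD)
          qed
        qed
        moreover have "?r z = w" using we by (auto simp: z fun_eq_iff PiE_def extensional_def)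
        ultimately show "z \<in> {z. z \<in> ?T \<and> ?r z = w}" using w by (auto simp: distinct_tuples_def)
      qed
    qed
    then have "(\<Sum>z | z \<in> ?T \<and> ?r z = w. 1) = card ?F" by (simp add: bij_betw_same_card)
    also have "\<dots> = fact m * (card (Z - w ` {..<n}) choose m)"
      using card_inj_PiE(2)[of ?J "Z - w ` {..<n}"] Z by simp
    also have "card (Z - w ` {..<n}) = card Z - n"
      using wZ wi by (simp add: card_Diff_subset card_image finite_subset[OF wZ Z])
    finally show "(\<Sum>z | z \<in> ?T \<and> ?r z = w. 1) = fact m * (card Z - n choose m)" .
  qed
  finally show ?thesis by simp
qed

text \<open>Once the choice of the first \<open>n\<close> points is factored out, an alternating sum
  of binomial coefficients remains, which is 0 unless no further point is left. This isolates the
  event of exactly \<open>n\<close> points.\<close>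

lemma alternating_tuple_count:
  assumes Z: "finite Z"
  shows "(\<lambda>m. (-1) ^ m / fact m * real (card {z \<in> distinct_tuples (n + m) Z. restrict z {..<n} \<in> A}))
    sums (of_bool (card Z = n) * real (card (distinct_tuples n Z \<inter> A)))"
proof -
  let ?a = "real (card (distinct_tuples n Z \<inter> A))" and ?l = "card Z - n"
  have eq: "(-1) ^ m / fact m * real (card {z \<in> distinct_tuples (n + m) Z. restrict z {..<n} \<in> A}) =
     ?a * ((-1) ^ m * real (?l choose m))" for m
    unfolding card_tuple_extensions[OF Z] by simp
  have "(\<lambda>m. ?a * ((-1) ^ m * real (?l choose m))) sums (\<Sum>m\<le>?l. ?a * ((-1) ^ m * real (?l choose m)))"
    by (rule sums_finite) auto
  also have "(\<Sum>m\<le>?l. ?a * ((-1) ^ m * real (?l choose m))) = ?a * of_bool (?l = 0)"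
    using choose_alternating_sum[of ?l, where 'a=real] by (cases "?l = 0") (auto simp flip: sum_distrib_left)
  \<comment> \<open>Truncated subtraction gives \<open>?l = 0\<close> also for
    \<open>card Z < n\<close>; in that case there is no tuple of length \<open>n\<close>.\<close>
  also have "\<dots> = of_bool (card Z = n) * ?a"
  proof (cases "card Z < n")
    case True
    then have "card (distinct_tuples n Z) = 0" using card_distinct_tuples[OF Z, of n] by simp
    then have "distinct_tuples n Z = {}" using distinct_tuples_finite[OF Z] by simp
    then show ?thesis by simp
  qed auto
  finally show ?thesis unfolding eq .
qed

section \<open>Factorial moments of the process inside a window\<close>

locale dpp = rkhs_total \<mu> K H h
  for \<mu> :: "'a::{metric_space, second_countable_topology} measure" and K H h +
  fixes P :: "'w measure" and X :: "'w \<Rightarrow> 'a set"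
  assumes proper: "proper_space TYPE('a)" and sets_mu: "sets \<mu> = sets borel"
    and pp: "point_process P X"
    and intensity: "\<And>n. n \<ge> 1 \<Longrightarrow> \<exists>\<rho>. intensity_function P X \<mu> n \<rho> \<and>
      (AE x in (\<Pi>\<^sub>M i\<in>{..<n}. \<mu>).
         complex_of_real (\<rho> x) = Determinant.det (Matrix.mat n n (\<lambda>(i, j). K (x i) (x j))))"
begin

lemma P_prob: "prob_space P" and X_measurable [measurable]: "X \<in> measurable P configurations"
  using pp by (auto simp: point_process_def)

lemma space_mu: "space \<mu> = UNIV"
  using sets_eq_imp_space_eq[OF sets_mu] by simp

lemma X_config: "\<omega> \<in> space P \<Longrightarrow> X \<omega> \<in> space configurations"
  using measurable_space[OF X_measurable] .

end

locale dpp_window = dpp \<mu> K H h P X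
  for \<mu> :: "'a::{metric_space, second_countable_topology} measure" and K H h P X +
  fixes D :: "'a set"
  assumes D_borel: "D \<in> sets borel" and D_bounded: "bounded D"
    and D_int: "integrable \<mu> (\<lambda>x. indicator D x * Re (K x x))"
begin

sublocale product_sigma_finite "\<lambda>_::nat. \<mu>"
  by (simp add: product_sigma_finite_def sf)

abbreviation "kD \<equiv> compressed_kernel D K"
abbreviation "dens n z \<equiv> Re (det_on {..<n} (\<lambda>i j. kD (z i) (z j)))"
abbreviation "\<mu>n I \<equiv> PiM I (\<lambda>_::nat. \<mu>)"

lemma D_sets: "D \<in> sets \<mu>"
  using D_borel sets_mu by simp

lemma finite_XD: "\<omega> \<in> space P \<Longrightarrow> finite (X \<omega> \<inter> D)"
  using configuration_finite[OF proper X_config D_bounded] .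

lemma dens_nonneg: "0 \<le> dens n z" for n :: nat
  using psd_det_on_hadamard[OF psd_pullback[OF compressed_psd], of "{..<n}"] by blast

lemma dens_measurable: "dens n \<in> borel_measurable (\<mu>n {..<n})"
  by (intro borel_measurable_Re[THEN measurable_compose[rotated]] det_on_measurable kernel_coord_measurable
      compressed_measurable D_sets)

lemma tuple_sum_X_measurable [measurable (raw)]:
  assumes "g \<in> borel_measurable (\<mu>n {..<n})"
  shows "(\<lambda>\<omega>. tuple_sum n (X \<omega> \<inter> D) g) \<in> borel_measurable P"
  by (rule measurable_compose[OF X_measurable tuple_sum_measurable[OF proper D_borel D_bounded sets_mu assms]])

text \<open>The weight \<open>u\<close> is 1 for factorial moments and the indicator of exactly
  \<open>n\<close> points for Janossy densities.\<close>

lemma tuple_expectation_extend: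
  assumes u [measurable]: "u \<in> borel_measurable P" and w [measurable]: "w \<in> borel_measurable (\<mu>n {..<n})"
    and ind: "\<And>A. A \<in> sets (\<mu>n {..<n}) \<Longrightarrow>
      (\<integral>\<^sup>+\<omega>. u \<omega> * tuple_sum n (X \<omega> \<inter> D) (indicator A) \<partial>P) = (\<integral>\<^sup>+z. indicator A z * w z \<partial>\<mu>n {..<n})"
    and g: "g \<in> borel_measurable (\<mu>n {..<n})"
  shows "(\<integral>\<^sup>+\<omega>. u \<omega> * tuple_sum n (X \<omega> \<inter> D) g \<partial>P) = (\<integral>\<^sup>+z. g z * w z \<partial>\<mu>n {..<n})"
  using g
proof (induction rule: borel_measurable_induct)
  case (cong f g)
  have "tuple_sum n Z f = tuple_sum n Z g" for Z
    unfolding tuple_sum_def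
    by (intro nn_integral_cong cong(3)) (auto simp: distinct_tuples_def space_PiM space_mu)
  moreover have "(\<integral>\<^sup>+z. f z * w z \<partial>\<mu>n {..<n}) = (\<integral>\<^sup>+z. g z * w z \<partial>\<mu>n {..<n})"
    by (intro nn_integral_cong) (simp add: cong)
  ultimately show ?case using cong by simp
next
  case (set A) then show ?case by (rule ind)
next
  case (mult f c)
  have "tuple_sum n Z (\<lambda>x. c * f x) = c * tuple_sum n Z f" for Z
    unfolding tuple_sum_def by (simp add: nn_integral_cmult)
  then have "(\<integral>\<^sup>+\<omega>. u \<omega> * tuple_sum n (X \<omega> \<inter> D) (\<lambda>x. c * f x) \<partial>P) = (\<integral>\<^sup>+\<omega>. c * (u \<omega> * tuple_sum n (X \<omega> \<inter> D) f) \<partial>P)"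
    by (simp add: ac_simps)
  also have "\<dots> = c * (\<integral>\<^sup>+z. f z * w z \<partial>\<mu>n {..<n})"
    using mult by (subst nn_integral_cmult) auto
  also have "\<dots> = (\<integral>\<^sup>+z. c * f z * w z \<partial>\<mu>n {..<n})"
    using mult by (subst nn_integral_cmult[symmetric]) (auto simp: mult.assoc)
  finally show ?case .
next
  case (add f f')
  have "tuple_sum n Z (\<lambda>x. f' x + f x) = tuple_sum n Z f' + tuple_sum n Z f" for Z
    unfolding tuple_sum_def by (simp add: nn_integral_add)
  then have "(\<integral>\<^sup>+\<omega>. u \<omega> * tuple_sum n (X \<omega> \<inter> D) (\<lambda>x. f' x + f x) \<partial>P) =
     (\<integral>\<^sup>+\<omega>. u \<omega> * tuple_sum n (X \<omega> \<inter> D) f' + u \<omega> * tuple_sum n (X \<omega> \<inter> D) f \<partial>P)"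
    by (simp add: distrib_left)
  also have "\<dots> = (\<integral>\<^sup>+z. f' z * w z \<partial>\<mu>n {..<n}) + (\<integral>\<^sup>+z. f z * w z \<partial>\<mu>n {..<n})"
    using add by (subst nn_integral_add) auto
  also have "\<dots> = (\<integral>\<^sup>+z. (f' z + f z) * w z \<partial>\<mu>n {..<n})"
    using add by (subst nn_integral_add[symmetric]) (auto simp: distrib_right)
  finally show ?case .
next
  case (seq U)
  have inc: "incseq U" using seq by simp
  then have incz: "incseq (\<lambda>i. U i z)" for z by (auto simp: incseq_def le_fun_def)
  have ts: "tuple_sum n Z (SUP i. U i) = (SUP i. tuple_sum n Z (U i))" for Z
    unfolding tuple_sum_def SUP_apply using inc by (intro nn_integral_monotone_convergence_SUP) simp_all
  have inct: "incseq (\<lambda>i. tuple_sum n Z (U i))" for Z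
    using inc unfolding tuple_sum_def by (auto simp: incseq_def le_fun_def intro!: nn_integral_mono)
  have "(\<integral>\<^sup>+\<omega>. u \<omega> * tuple_sum n (X \<omega> \<inter> D) (SUP i. U i) \<partial>P) = (\<integral>\<^sup>+\<omega>. (SUP i. u \<omega> * tuple_sum n (X \<omega> \<inter> D) (U i)) \<partial>P)"
    unfolding ts by (simp add: SUP_mult_left_ennreal)
  also have "\<dots> = (SUP i. \<integral>\<^sup>+\<omega>. u \<omega> * tuple_sum n (X \<omega> \<inter> D) (U i) \<partial>P)"
    using seq.hyps inct by (intro nn_integral_monotone_convergence_SUP) (auto simp: incseq_def le_fun_def intro!: mult_left_mono)
  also have "\<dots> = (SUP i. \<integral>\<^sup>+z. U i z * w z \<partial>\<mu>n {..<n})" using seq.IH by simp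
  also have "\<dots> = (\<integral>\<^sup>+z. (SUP i. U i z * w z) \<partial>\<mu>n {..<n})"
    using seq.hyps incz by (intro nn_integral_monotone_convergence_SUP[symmetric]) (auto simp: incseq_def le_fun_def intro!: mult_right_mono)
  also have "\<dots> = (\<integral>\<^sup>+z. (SUP i. U i) z * w z \<partial>\<mu>n {..<n})"
    by (simp add: SUP_mult_right_ennreal image_comp)
  finally show ?case .
qed

lemma tuple_sum_indicator:
  "tuple_sum n Z (indicator A) = emeasure (count_space UNIV) (distinct_tuples n Z \<inter> A)"
proof -
  have "tuple_sum n Z (indicator A) = (\<integral>\<^sup>+z. indicator (distinct_tuples n Z \<inter> A) z \<partial>count_space (distinct_tuples n Z))"
    unfolding tuple_sum_def by (intro nn_integral_cong) (auto split: split_indicator)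
  also have "\<dots> = (\<integral>\<^sup>+z. indicator (distinct_tuples n Z \<inter> A) z \<partial>count_space UNIV)"
    by (rule nn_integral_count_space_eq) auto
  finally show ?thesis by simp
qed

lemma tuple_sum_indicator_card:
  "finite Z \<Longrightarrow> tuple_sum n Z (indicator A) = ennreal (real (card (distinct_tuples n Z \<inter> A)))"
  unfolding tuple_sum_indicator using distinct_tuples_finite[of Z n]
  by (simp add: ennreal_of_nat_eq_real_of_nat)

text \<open>The restriction to the window is carried by the kernel: inside \<open>D\<close> the
  kernels \<open>kD\<close> and \<open>K\<close> agree, and a coordinate outside \<open>D\<close>
  makes a zero row.\<close>

lemma tuple_expectation:
  assumes g: "g \<in> borel_measurable (\<mu>n {..<n})"
  shows "(\<integral>\<^sup>+\<omega>. tuple_sum n (X \<omega> \<inter> D) g \<partial>P) = (\<integral>\<^sup>+z. g z * ennreal (dens n z) \<partial>\<mu>n {..<n})"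
proof -
  have "(\<integral>\<^sup>+\<omega>. 1 * tuple_sum n (X \<omega> \<inter> D) g \<partial>P) = (\<integral>\<^sup>+z. g z * ennreal (dens n z) \<partial>\<mu>n {..<n})"
  proof (rule tuple_expectation_extend[OF borel_measurable_const measurable_compose[OF dens_measurable measurable_ennreal] _ g])
    fix A assume A: "A \<in> sets (\<mu>n {..<n})"
    show "(\<integral>\<^sup>+\<omega>. 1 * tuple_sum n (X \<omega> \<inter> D) (indicator A) \<partial>P) = (\<integral>\<^sup>+z. indicator A z * ennreal (dens n z) \<partial>\<mu>n {..<n})"
    proof (cases "n = 0")
      \<comment> \<open>Intensities are given for \<open>n \<ge> 1\<close> only; for
        \<open>n = 0\<close> the single empty tuple and total mass 1 give the identity.\<close>
      case True
      interpret prob_space P by (rule P_prob)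
      have "distinct_tuples 0 Z = {\<lambda>_. undefined}" for Z :: "'a set" by (auto simp: distinct_tuples_def)
      then have ts: "tuple_sum 0 Z (indicator A) = indicator A (\<lambda>_. undefined)" for Z :: "'a set"
        unfolding tuple_sum_def by (simp add: nn_integral_count_space_finite)
      show ?thesis unfolding True ts lessThan_0 det_on_empty
        by (subst nn_integral_empty) (simp_all add: emeasure_space_1)
    next
      case False
      then have n1: "1 \<le> n" by simp
      obtain \<rho> where \<rho>: "intensity_function P X \<mu> n \<rho>"
        and \<rho>_det: "AE x in \<mu>n {..<n}. complex_of_real (\<rho> x) = Determinant.det (Matrix.mat n n (\<lambda>(i, j). K (x i) (x j)))"
        using intensity[OF n1] by (elim exE conjE)
      let ?DD = "PiE {..<n} (\<lambda>_. D)"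
      have DD: "?DD \<in> sets (\<mu>n {..<n})" using D_sets by (intro sets_PiM_I_finite) auto
      have AD: "A \<inter> ?DD \<in> sets (\<mu>n {..<n})" using A DD by (rule sets.Int)
      have "distinct_tuples n (X \<omega> \<inter> D) \<inter> A = distinct_tuples n (X \<omega>) \<inter> (A \<inter> ?DD)" for \<omega>
        by (auto simp: distinct_tuples_def PiE_def Pi_def)
      then have "(\<integral>\<^sup>+\<omega>. 1 * tuple_sum n (X \<omega> \<inter> D) (indicator A) \<partial>P) =
        (\<integral>\<^sup>+\<omega>. emeasure (count_space UNIV) (distinct_tuples n (X \<omega>) \<inter> (A \<inter> ?DD)) \<partial>P)"
        by (simp only: tuple_sum_indicator mult_1)
      also have "\<dots> = (\<integral>\<^sup>+x. ennreal (\<rho> x) * indicator (A \<inter> ?DD) x \<partial>\<mu>n {..<n})"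
        by (rule \<rho>[unfolded intensity_function_def, THEN conjunct2, THEN conjunct2, rule_format, OF AD])
      also have "\<dots> = (\<integral>\<^sup>+z. indicator A z * ennreal (dens n z) \<partial>\<mu>n {..<n})"
      proof (rule nn_integral_cong_AE)
        show "AE x in \<mu>n {..<n}. ennreal (\<rho> x) * indicator (A \<inter> ?DD) x = indicator A x * ennreal (dens n x)"
          using \<rho>_det AE_space
        proof eventually_elim
          fix x assume elim: "complex_of_real (\<rho> x) = Determinant.det (Matrix.mat n n (\<lambda>(i, j). K (x i) (x j)))"
            "x \<in> space (\<mu>n {..<n})"
          show "ennreal (\<rho> x) * indicator (A \<inter> ?DD) x = indicator A x * ennreal (dens n x)"
          proof (cases "x \<in> ?DD")
            case True
            then have xD: "x i \<in> D" if "i < n" for i using PiE_mem[OF True, of i] that by simp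
            have "det_on {..<n} (\<lambda>i j. kD (x i) (x j)) = det_on {..<n} (\<lambda>i j. K (x i) (x j))"
              by (rule det_on_cong) (simp add: compressed_kernel_def xD)
            then have eq: "complex_of_real (\<rho> x) = det_on {..<n} (\<lambda>i j. kD (x i) (x j))"
              using elim(1) by (simp only: det_eq_det_on)
            have "dens n x = \<rho> x" unfolding eq[symmetric] by (rule Re_complex_of_real)
            moreover have "indicator (A \<inter> ?DD) x = (indicator A x :: ennreal)" using True by (auto split: split_indicator)
            ultimately show ?thesis by (simp only: mult.commute)
          next
            case False
            have "x \<in> extensional {..<n}" using elim(2) by (auto simp: space_PiM PiE_def)
            then obtain i where i: "i < n" "x i \<notin> D" using False by (auto simp: PiE_def Pi_def)
            then have 0: "det_on {..<n} (\<lambda>i j. kD (x i) (x j)) = 0"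
              by (intro det_on_zero_row[of _ i]) (auto simp: compressed_kernel_def)
            have "indicator (A \<inter> ?DD) x = (0 :: ennreal)" using False by (auto split: split_indicator)
            then show ?thesis unfolding 0 by (simp only: complex.sel zero_complex.sel ennreal_0 mult_zero_right)
          qed
        qed
      qed
      finally show ?thesis .
    qed
  qed
  then show ?thesis by (simp only: mult_1)
qed

section \<open>Janossy densities describe the law of the process in the window\<close>

abbreviation "\<kappa> x \<equiv> indicator D x * Re (K x x)"

lemma kD_diag: "Re (kD x x) \<le> \<kappa> x"
  by (simp add: compressed_kernel_def indicator_def)

lemmas kD_bound = det_on_psd_integral_bound[OF sf D_int compressed_psd compressed_measurable[OF D_sets] kD_diag]

text \<open>The integral in the \<open>m\<close>-th term of the Janossy series: the density for
  \<open>n + m\<close> points with the last \<open>m\<close> of them integrated out.\<close>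

definition part :: "nat \<Rightarrow> nat \<Rightarrow> (nat \<Rightarrow> 'a) \<Rightarrow> real" where
  "part n m x = (\<integral>y. Re (det_on {..<n+m} (\<lambda>i j. kD (if i < n then x i else y i) (if j < n then x j else y j))) \<partial>\<mu>n {n..<n+m})"

lemma janossy_part: "janossy \<mu> kD n x = (\<Sum>m. (-1) ^ m / fact m * part n m x)"
  unfolding janossy_def part_def ..

lemma part_measurable: "part n m \<in> borel_measurable (\<mu>n {..<n})"
proof -
  interpret J: sigma_finite_measure "\<mu>n {n..<n+m}" by (rule sigma_finite) simp
  have coord: "(\<lambda>p. if i < n then fst p i else snd p i) \<in> measurable (\<mu>n {..<n} \<Otimes>\<^sub>M \<mu>n {n..<n+m}) \<mu>" if "i < n + m" for i
  proof (cases "i < n")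
    case True
    then have "(\<lambda>p. fst p i) \<in> measurable (\<mu>n {..<n} \<Otimes>\<^sub>M \<mu>n {n..<n+m}) \<mu>"
      by (intro measurable_compose[OF measurable_fst] measurable_component_singleton) simp
    then show ?thesis using True by simp
  next
    case False
    then have "(\<lambda>p. snd p i) \<in> measurable (\<mu>n {..<n} \<Otimes>\<^sub>M \<mu>n {n..<n+m}) \<mu>"
      using that by (intro measurable_compose[OF measurable_snd] measurable_component_singleton) simp
    then show ?thesis using False by simp
  qed
  have "(\<lambda>p. kD (if i < n then fst p i else snd p i) (if j < n then fst p j else snd p j)) \<in> borel_measurable (\<mu>n {..<n} \<Otimes>\<^sub>M \<mu>n {n..<n+m})"
    if "i < n + m" "j < n + m" for i j
    using measurable_compose[OF measurable_Pair[OF coord[OF that(1)] coord[OF that(2)]] compressed_measurable[OF D_sets]]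
    by (simp only: prod.case)
  then have "(\<lambda>p. det_on {..<n+m} (\<lambda>i j. kD (if i < n then fst p i else snd p i) (if j < n then fst p j else snd p j)))
     \<in> borel_measurable (\<mu>n {..<n} \<Otimes>\<^sub>M \<mu>n {n..<n+m})"
    by (intro det_on_measurable) (simp only: lessThan_iff)
  then have "(\<lambda>(x, y). Re (det_on {..<n+m} (\<lambda>i j. kD (if i < n then x i else y i) (if j < n then x j else y j))))
     \<in> borel_measurable (\<mu>n {..<n} \<Otimes>\<^sub>M \<mu>n {n..<n+m})"
    unfolding case_prod_beta by (rule borel_measurable_Re[THEN measurable_compose[rotated]])
  then show ?thesis unfolding part_def[abs_def] by (rule J.borel_measurable_lebesgue_integral)
qed

lemma janossy_measurable: "janossy \<mu> kD n \<in> borel_measurable (\<mu>n {..<n})"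
  unfolding janossy_part[abs_def]
  by (intro borel_measurable_suminf borel_measurable_times borel_measurable_const part_measurable)

lemma part_bounds: "0 \<le> part n m x" "part n m x \<le> (\<Prod>i<n. \<kappa> (x i)) * integral\<^sup>L \<mu> \<kappa> ^ m"
proof -
  let ?z = "\<lambda>y i. if i < n then x i else y i"
  let ?f = "\<lambda>y. Re (det_on {..<n+m} (\<lambda>i j. kD (?z y i) (?z y j)))"
  have nonneg: "0 \<le> ?f y" for y
    using psd_det_on_hadamard[OF psd_pullback[OF compressed_psd], of "{..<n+m}" D "?z y"] by blast
  then show "0 \<le> part n m x" unfolding part_def by (intro integral_nonneg_AE AE_I2)
  have union: "{..<n+m} = {..<n} \<union> {n..<n+m}" by auto
  have le: "?f y \<le> (\<Prod>i<n. \<kappa> (x i)) * (\<Prod>i\<in>{n..<n+m}. \<kappa> (y i))" for y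
  proof -
    have "?f y \<le> (\<Prod>i<n+m. \<kappa> (?z y i))"
      using kD_bound(3)[of "{..<n+m}" "?z y"] by simp
    also have "\<dots> = (\<Prod>i<n. \<kappa> (?z y i)) * (\<Prod>i\<in>{n..<n+m}. \<kappa> (?z y i))"
      unfolding union by (rule prod.union_disjoint) auto
    also have "\<dots> = (\<Prod>i<n. \<kappa> (x i)) * (\<Prod>i\<in>{n..<n+m}. \<kappa> (y i))"
      by (intro arg_cong2[where f="(*)"] prod.cong) auto
    finally show ?thesis .
  qed
  have int: "integrable (\<mu>n {n..<n+m}) (\<lambda>y. (\<Prod>i<n. \<kappa> (x i)) * (\<Prod>i\<in>{n..<n+m}. \<kappa> (y i)))"
    by (intro integrable_mult_right kD_bound(2)) simp
  have "part n m x \<le> (\<integral>y. (\<Prod>i<n. \<kappa> (x i)) * (\<Prod>i\<in>{n..<n+m}. \<kappa> (y i)) \<partial>\<mu>n {n..<n+m})"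
    unfolding part_def
  proof (rule integral_mono_AE')
    show "AE y in \<mu>n {n..<n+m}. ?f y \<le> (\<Prod>i<n. \<kappa> (x i)) * (\<Prod>i\<in>{n..<n+m}. \<kappa> (y i))" by (intro AE_I2 le)
    show "AE y in \<mu>n {n..<n+m}. 0 \<le> (\<Prod>i<n. \<kappa> (x i)) * (\<Prod>i\<in>{n..<n+m}. \<kappa> (y i))"
      by (intro AE_I2 order_trans[OF nonneg le])
  qed (rule int)
  also have "\<dots> = (\<Prod>i<n. \<kappa> (x i)) * integral\<^sup>L \<mu> \<kappa> ^ m"
    using kD_bound(4)[of "{n..<n+m}"] by simp
  finally show "part n m x \<le> (\<Prod>i<n. \<kappa> (x i)) * integral\<^sup>L \<mu> \<kappa> ^ m" .
qed

lemma dens_integrable: "integrable (\<mu>n {..<n}) (dens n)"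
  by (rule kD_bound(1)) simp

lemma dens_integral_le: "(\<integral>z. dens n z \<partial>\<mu>n {..<n}) \<le> integral\<^sup>L \<mu> \<kappa> ^ n"
proof -
  have "(\<integral>z. dens n z \<partial>\<mu>n {..<n}) \<le> (\<integral>z. (\<Prod>i<n. \<kappa> (z i)) \<partial>\<mu>n {..<n})"
    by (intro integral_mono dens_integrable kD_bound(2) order_trans[OF abs_ge_self kD_bound(3)]) simp_all
  then show ?thesis using kD_bound(4)[of "{..<n}"] by simp
qed

lemma part_integral:
  assumes A: "A \<in> sets (\<mu>n {..<n})"
  shows "integrable (\<mu>n {..<n+m}) (\<lambda>z. indicator A (restrict z {..<n}) * dens (n + m) z)"
    and "(\<integral>z. indicator A (restrict z {..<n}) * dens (n + m) z \<partial>\<mu>n {..<n+m}) = (\<integral>x. indicator A x * part n m x \<partial>\<mu>n {..<n})"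
proof -
  have union: "{..<n+m} = {..<n} \<union> {n..<n+m}" by auto
  have r: "(\<lambda>z. restrict z {..<n}) \<in> measurable (\<mu>n {..<n+m}) (\<mu>n {..<n})"
    by (rule measurable_restrict_subset) auto
  have ind: "(\<lambda>z. indicator A (restrict z {..<n}) :: real) \<in> borel_measurable (\<mu>n {..<n+m})"
    by (rule measurable_compose[OF r]) (use A in simp)
  show int: "integrable (\<mu>n {..<n+m}) (\<lambda>z. indicator A (restrict z {..<n}) * dens (n + m) z)"
  proof (rule Bochner_Integration.integrable_bound[OF dens_integrable[of "n + m"]])
    show "(\<lambda>z. indicator A (restrict z {..<n}) * dens (n + m) z) \<in> borel_measurable (\<mu>n {..<n+m})"
      by (intro borel_measurable_times ind dens_measurable)
  qed (auto simp: indicator_def)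
  have "(\<integral>z. indicator A (restrict z {..<n}) * dens (n + m) z \<partial>\<mu>n {..<n+m}) =
    (\<integral>x. (\<integral>y. indicator A (restrict (merge {..<n} {n..<n+m} (x, y)) {..<n}) * dens (n + m) (merge {..<n} {n..<n+m} (x, y)) \<partial>\<mu>n {n..<n+m}) \<partial>\<mu>n {..<n})"
    unfolding union by (rule product_integral_fold) (use int in \<open>auto simp flip: union\<close>)
  also have "\<dots> = (\<integral>x. indicator A x * part n m x \<partial>\<mu>n {..<n})"
  proof (rule Bochner_Integration.integral_cong[OF refl])
    fix x assume "x \<in> space (\<mu>n {..<n})"
    then have x: "x \<in> extensional {..<n}" by (auto simp: space_PiM PiE_def)
    have "restrict (merge {..<n} {n..<n+m} (x, y)) {..<n} = x" for y
      using x by (auto simp: merge_def fun_eq_iff extensional_def)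
    moreover have "dens (n + m) (merge {..<n} {n..<n+m} (x, y)) =
       Re (det_on {..<n+m} (\<lambda>i j. kD (if i < n then x i else y i) (if j < n then x j else y j)))" for y
      by (intro arg_cong[where f=Re] det_on_cong) (auto simp: merge_def)
    ultimately show "(\<integral>y. indicator A (restrict (merge {..<n} {n..<n+m} (x, y)) {..<n}) * dens (n + m) (merge {..<n} {n..<n+m} (x, y)) \<partial>\<mu>n {n..<n+m}) =
       indicator A x * part n m x"
      unfolding part_def by simp
  qed
  finally show "(\<integral>z. indicator A (restrict z {..<n}) * dens (n + m) z \<partial>\<mu>n {..<n+m}) = (\<integral>x. indicator A x * part n m x \<partial>\<mu>n {..<n})" .
qed

lemma summable_exp_shift: "summable (\<lambda>m. c ^ (n + m) / fact m :: real)"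
proof -
  have "summable (\<lambda>m. c ^ n * (inverse (fact m) * c ^ m))" by (intro summable_mult summable_exp)
  then show ?thesis by (simp add: power_add field_simps)
qed

text \<open>\<open>C m\<close> counts the extensions of admissible \<open>n\<close>-tuples by
  \<open>m\<close> further points, so its expectation is a factorial moment of order
  \<open>n + m\<close> in which the last \<open>m\<close> variables are unrestricted.\<close>

lemma extension_expectation:
  assumes A: "A \<in> sets (\<mu>n {..<n})"
  defines "C \<equiv> \<lambda>m \<omega>. real (card {z \<in> distinct_tuples (n + m) (X \<omega> \<inter> D). restrict z {..<n} \<in> A})"
  shows "integrable P (C m)" "(\<integral>\<omega>. C m \<omega> \<partial>P) = (\<integral>x. indicator A x * part n m x \<partial>\<mu>n {..<n})"
    "(\<integral>\<omega>. C m \<omega> \<partial>P) \<le> integral\<^sup>L \<mu> \<kappa> ^ (n + m)"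
proof -
  define B where "B = (\<lambda>z. restrict z {..<n}) -` A \<inter> space (\<mu>n {..<n+m})"
  have B: "B \<in> sets (\<mu>n {..<n+m})"
    unfolding B_def by (rule measurable_sets[OF measurable_restrict_subset A]) auto
  have Bc: "distinct_tuples (n + m) Z \<inter> B = {z \<in> distinct_tuples (n + m) Z. restrict z {..<n} \<in> A}" for Z
    by (auto simp: B_def distinct_tuples_def space_PiM space_mu)
  have C_eq: "ennreal (C m \<omega>) = tuple_sum (n + m) (X \<omega> \<inter> D) (indicator B)" if "\<omega> \<in> space P" for \<omega>
    unfolding tuple_sum_indicator_card[OF finite_XD[OF that]] C_def Bc ..
  have em: "(\<lambda>\<omega>. enn2real (tuple_sum (n + m) (X \<omega> \<inter> D) (indicator B))) \<in> borel_measurable P"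
    by (intro borel_measurable_enn2real tuple_sum_X_measurable borel_measurable_indicator B)
  have Ce: "C m \<omega> = enn2real (tuple_sum (n + m) (X \<omega> \<inter> D) (indicator B))" if "\<omega> \<in> space P" for \<omega>
    unfolding C_eq[OF that, symmetric] by (simp add: C_def)
  have "C m \<in> borel_measurable P \<longleftrightarrow> (\<lambda>\<omega>. enn2real (tuple_sum (n + m) (X \<omega> \<inter> D) (indicator B))) \<in> borel_measurable P"
    by (rule measurable_cong) (rule Ce)
  then have meas: "C m \<in> borel_measurable P" using em by (rule iffD2)
  have "(\<integral>\<^sup>+\<omega>. ennreal (C m \<omega>) \<partial>P) = (\<integral>\<^sup>+\<omega>. tuple_sum (n + m) (X \<omega> \<inter> D) (indicator B) \<partial>P)"
    by (rule nn_integral_cong) (rule C_eq)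
  also have "\<dots> = (\<integral>\<^sup>+z. indicator B z * ennreal (dens (n + m) z) \<partial>\<mu>n {..<n+m})"
    by (rule tuple_expectation[OF borel_measurable_indicator[OF B]])
  also have "\<dots> = (\<integral>\<^sup>+z. ennreal (indicator A (restrict z {..<n}) * dens (n + m) z) \<partial>\<mu>n {..<n+m})"
    by (intro nn_integral_cong) (auto simp: B_def split: split_indicator)
  also have "\<dots> = ennreal (\<integral>z. indicator A (restrict z {..<n}) * dens (n + m) z \<partial>\<mu>n {..<n+m})"
    by (intro nn_integral_eq_integral part_integral A AE_I2 mult_nonneg_nonneg dens_nonneg) simp
  finally have nn: "(\<integral>\<^sup>+\<omega>. ennreal (C m \<omega>) \<partial>P) = ennreal (\<integral>z. indicator A (restrict z {..<n}) * dens (n + m) z \<partial>\<mu>n {..<n+m})" .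
  have ge: "0 \<le> (\<integral>z. indicator A (restrict z {..<n}) * dens (n + m) z \<partial>\<mu>n {..<n+m})"
    by (intro integral_nonneg_AE AE_I2 mult_nonneg_nonneg dens_nonneg) simp
  have both: "integrable P (C m) \<and> integral\<^sup>L P (C m) = (\<integral>z. indicator A (restrict z {..<n}) * dens (n + m) z \<partial>\<mu>n {..<n+m})"
    by (rule nn_integral_eq_integrable[OF meas _ ge, THEN iffD1, OF _ nn]) (simp add: C_def)
  then show "integrable P (C m)" "(\<integral>\<omega>. C m \<omega> \<partial>P) = (\<integral>x. indicator A x * part n m x \<partial>\<mu>n {..<n})"
    using part_integral(2)[OF A] by auto
  have "integral\<^sup>L P (C m) \<le> (\<integral>z. dens (n + m) z \<partial>\<mu>n {..<n+m})"
    unfolding conjunct2[OF both]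
  proof (rule integral_mono[OF part_integral(1)[OF A] dens_integrable])
    show "indicator A (restrict z {..<n}) * dens (n + m) z \<le> dens (n + m) z" for z
      using dens_nonneg[of "n + m" z] by (auto split: split_indicator)
  qed
  then show "(\<integral>\<omega>. C m \<omega> \<partial>P) \<le> integral\<^sup>L \<mu> \<kappa> ^ (n + m)"
    using dens_integral_le[of "n + m"] by (rule order_trans)
qed

lemma janossy_nonneg': "0 \<le> janossy \<mu> kD n z"
  by (rule janossy_nonneg[OF D_sets D_int])

text \<open>The expectation of the alternating count is, term by term, the integrated Janossy
  series. Sum and integral may be exchanged on both sides because the \<open>m\<close>-th absolute
  term integrates to at most \<open>c ^ (n + m) / fact m\<close>.\<close>

lemma janossy_density_indicator:
  assumes A: "A \<in> sets (\<mu>n {..<n})"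
  shows "(\<integral>\<^sup>+\<omega>. of_bool (card (X \<omega> \<inter> D) = n) * tuple_sum n (X \<omega> \<inter> D) (indicator A) \<partial>P) =
    (\<integral>\<^sup>+z. indicator A z * ennreal (janossy \<mu> kD n z) \<partial>\<mu>n {..<n})"
proof -
  define C where "C m \<omega> = real (card {z \<in> distinct_tuples (n + m) (X \<omega> \<inter> D). restrict z {..<n} \<in> A})" for m \<omega>
  note C = extension_expectation[OF A, folded C_def]
  define c where "c = integral\<^sup>L \<mu> \<kappa>"
  define a where "a \<omega> = of_bool (card (X \<omega> \<inter> D) = n) * real (card (distinct_tuples n (X \<omega> \<inter> D) \<inter> A))" for \<omega>
  have C_nonneg: "0 \<le> C m \<omega>" for m \<omega> by (simp add: C_def)
  have norm_coeff: "norm ((-1) ^ m / fact m * r) = r / fact m" if "0 \<le> r" for m and r :: real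
    using that by (simp add: abs_mult power_abs)
  have a_sums: "(\<lambda>m. (-1) ^ m / fact m * C m \<omega>) sums a \<omega>" if "\<omega> \<in> space P" for \<omega>
    unfolding C_def a_def by (rule alternating_tuple_count[OF finite_XD[OF that]])
  \<comment> \<open>For each outcome the series has finitely many nonzero terms, as \<open>D\<close>
    contains finitely many points.\<close>
  have C_zero: "C m \<omega> = 0" if "\<omega> \<in> space P" "m > card (X \<omega> \<inter> D)" for m \<omega>
  proof -
    have "card (X \<omega> \<inter> D) - n < m" using that(2) by linarith
    then show ?thesis unfolding C_def card_tuple_extensions[OF finite_XD[OF that(1)]] by (simp add: binomial_eq_0)
  qed
  have int1: "integrable P (\<lambda>\<omega>. (-1) ^ m / fact m * C m \<omega>)" for m by (intro integrable_mult_right C)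
  have ae1: "AE \<omega> in P. summable (\<lambda>m. norm ((-1) ^ m / fact m * C m \<omega>))"
  proof (rule AE_I2)
    fix \<omega> assume "\<omega> \<in> space P"
    then show "summable (\<lambda>m. norm ((-1) ^ m / fact m * C m \<omega>))"
      by (intro summable_finite[of "{..card (X \<omega> \<inter> D)}"]) (auto simp: C_zero)
  qed
  have sum1: "summable (\<lambda>m. \<integral>\<omega>. norm ((-1) ^ m / fact m * C m \<omega>) \<partial>P)"
  proof (rule summable_comparison_test'[where N=0, OF summable_exp_shift[of c n]])
    fix m
    have "(\<integral>\<omega>. norm ((-1) ^ m / fact m * C m \<omega>) \<partial>P) = (\<integral>\<omega>. C m \<omega> \<partial>P) / fact m"
      by (simp only: norm_coeff[OF C_nonneg] integral_divide_zero)
    moreover have "0 \<le> (\<integral>\<omega>. C m \<omega> \<partial>P)" by (intro integral_nonneg_AE AE_I2 C_nonneg)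
    ultimately show "norm (\<integral>\<omega>. norm ((-1) ^ m / fact m * C m \<omega>) \<partial>P) \<le> c ^ (n + m) / fact m"
      using C(3)[of m] by (simp add: divide_right_mono c_def)
  qed
  have a_eq: "a \<omega> = (\<Sum>m. (-1) ^ m / fact m * C m \<omega>)" if "\<omega> \<in> space P" for \<omega>
    using sums_unique[OF a_sums[OF that]] .
  have a_int: "integrable P a"
    using integrable_suminf[OF int1 ae1 sum1] by (subst Bochner_Integration.integrable_cong[OF refl a_eq])
  have p0: "0 \<le> indicator A x * part n m x" for x m by (simp add: part_bounds)
  have pc: "indicator A x * part n m x \<le> (\<Prod>i<n. \<kappa> (x i)) * c ^ m" for x m
    using part_bounds(2)[of n m x, folded c_def] order_trans[OF part_bounds(1)[of n m x] part_bounds(2)[of n m x], folded c_def]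
    by (cases "x \<in> A") simp_all
  have pint: "integrable (\<mu>n {..<n}) (\<lambda>x. indicator A x * part n m x)" for m
  proof (rule Bochner_Integration.integrable_bound)
    show "integrable (\<mu>n {..<n}) (\<lambda>x. (\<Prod>i<n. \<kappa> (x i)) * c ^ m)"
      by (intro integrable_mult_left kD_bound(2)) simp
    show "(\<lambda>x. indicator A x * part n m x) \<in> borel_measurable (\<mu>n {..<n})"
      by (intro borel_measurable_times borel_measurable_indicator A part_measurable)
    show "AE x in \<mu>n {..<n}. norm (indicator A x * part n m x) \<le> norm ((\<Prod>i<n. \<kappa> (x i)) * c ^ m)"
      by (intro AE_I2) (simp only: real_norm_def abs_of_nonneg[OF p0] order_trans[OF pc abs_ge_self])
  qed
  have int2: "integrable (\<mu>n {..<n}) (\<lambda>x. (-1) ^ m / fact m * (indicator A x * part n m x))" for m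
    by (intro integrable_mult_right pint)
  have ae2: "AE x in \<mu>n {..<n}. summable (\<lambda>m. norm ((-1) ^ m / fact m * (indicator A x * part n m x)))"
  proof (rule AE_I2)
    fix x
    have "summable (\<lambda>m. (\<Prod>i<n. \<kappa> (x i)) * (c ^ (0 + m) / fact m))" by (intro summable_mult summable_exp_shift)
    then show "summable (\<lambda>m. norm ((-1) ^ m / fact m * (indicator A x * part n m x)))"
      unfolding norm_coeff[OF p0]
    proof (rule summable_comparison_test'[where N=0])
      fix m
      have "norm (indicator A x * part n m x / fact m) = indicator A x * part n m x / fact m"
        using p0[of x m] by simp
      also have "\<dots> \<le> (\<Prod>i<n. \<kappa> (x i)) * c ^ m / fact m" by (intro divide_right_mono pc) simp
      finally show "norm (indicator A x * part n m x / fact m) \<le> (\<Prod>i<n. \<kappa> (x i)) * (c ^ (0 + m) / fact m)" by simp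
    qed
  qed
  \<comment> \<open>These integrals coincide with those in \<open>sum1\<close>, by the formula for
    the expectation of \<open>C m\<close>.\<close>
  have sum2: "summable (\<lambda>m. \<integral>x. norm ((-1) ^ m / fact m * (indicator A x * part n m x)) \<partial>\<mu>n {..<n})"
    using sum1 unfolding norm_coeff[OF p0] norm_coeff[OF C_nonneg] integral_divide_zero C(2) .
  have J_eq: "(\<Sum>m. (-1) ^ m / fact m * (indicator A x * part n m x)) = indicator A x * janossy \<mu> kD n x" for x
    by (cases "x \<in> A") (simp_all add: janossy_part)
  have "integral\<^sup>L P a = (\<integral>\<omega>. (\<Sum>m. (-1) ^ m / fact m * C m \<omega>) \<partial>P)"
    by (rule Bochner_Integration.integral_cong[OF refl a_eq])
  also have "\<dots> = (\<Sum>m. \<integral>\<omega>. (-1) ^ m / fact m * C m \<omega> \<partial>P)"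
    by (rule integral_suminf[OF int1 ae1 sum1])
  also have "\<dots> = (\<Sum>m. \<integral>x. (-1) ^ m / fact m * (indicator A x * part n m x) \<partial>\<mu>n {..<n})"
    by (simp only: integral_mult_right_zero C(2))
  also have "\<dots> = (\<integral>x. (\<Sum>m. (-1) ^ m / fact m * (indicator A x * part n m x)) \<partial>\<mu>n {..<n})"
    by (rule integral_suminf[OF int2 ae2 sum2, symmetric])
  also have "\<dots> = (\<integral>x. indicator A x * janossy \<mu> kD n x \<partial>\<mu>n {..<n})"
    by (simp only: J_eq)
  finally have int_eq: "integral\<^sup>L P a = (\<integral>x. indicator A x * janossy \<mu> kD n x \<partial>\<mu>n {..<n})" .
  have "(\<integral>\<^sup>+\<omega>. of_bool (card (X \<omega> \<inter> D) = n) * tuple_sum n (X \<omega> \<inter> D) (indicator A) \<partial>P) = (\<integral>\<^sup>+\<omega>. ennreal (a \<omega>) \<partial>P)"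
    by (intro nn_integral_cong) (auto simp: a_def tuple_sum_indicator_card[OF finite_XD])
  also have "\<dots> = ennreal (integral\<^sup>L P a)"
    by (intro nn_integral_eq_integral a_int AE_I2) (simp add: a_def)
  also have "\<dots> = ennreal (\<integral>x. indicator A x * janossy \<mu> kD n x \<partial>\<mu>n {..<n})" by (simp only: int_eq)
  also have "\<dots> = (\<integral>\<^sup>+x. ennreal (indicator A x * janossy \<mu> kD n x) \<partial>\<mu>n {..<n})"
  proof (rule nn_integral_eq_integral[symmetric])
    show "integrable (\<mu>n {..<n}) (\<lambda>x. indicator A x * janossy \<mu> kD n x)"
      using integrable_suminf[OF int2 ae2 sum2] by (simp only: J_eq)
    show "AE x in \<mu>n {..<n}. 0 \<le> indicator A x * janossy \<mu> kD n x"
      by (intro AE_I2 mult_nonneg_nonneg janossy_nonneg') simp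
  qed
  also have "\<dots> = (\<integral>\<^sup>+z. indicator A z * ennreal (janossy \<mu> kD n z) \<partial>\<mu>n {..<n})"
    by (intro nn_integral_cong) (auto split: split_indicator)
  finally show ?thesis .
qed

lemma janossy_density:
  assumes g: "g \<in> borel_measurable (\<mu>n {..<n})"
  shows "(\<integral>\<^sup>+\<omega>. of_bool (card (X \<omega> \<inter> D) = n) * tuple_sum n (X \<omega> \<inter> D) g \<partial>P) =
    (\<integral>\<^sup>+z. g z * ennreal (janossy \<mu> kD n z) \<partial>\<mu>n {..<n})"
proof (rule tuple_expectation_extend[OF _ _ janossy_density_indicator g])
  have "(\<lambda>S. card (S \<inter> D)) \<in> measurable configurations (count_space UNIV)"
    by (rule measurable_card[OF proper D_borel D_bounded])
  from measurable_compose[OF measurable_compose[OF X_measurable this], of "\<lambda>i. of_bool (i = n)" borel]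
  show "(\<lambda>\<omega>. of_bool (card (X \<omega> \<inter> D) = n) :: ennreal) \<in> borel_measurable P" by simp
  show "(\<lambda>z. ennreal (janossy \<mu> kD n z)) \<in> borel_measurable (\<mu>n {..<n})"
    by (rule measurable_compose[OF janossy_measurable measurable_ennreal])
qed

end

section \<open>Insertion tolerance\<close>

lemma image_tuple_eq:
  assumes "finite Z" "card Z = n" "z \<in> distinct_tuples n Z"
  shows "z ` {..<n} = Z"
proof (rule card_subset_eq[OF assms(1)])
  show "z ` {..<n} \<subseteq> Z" using assms(3) by (auto simp: distinct_tuples_def)
  show "card (z ` {..<n}) = card Z" using assms by (simp add: distinct_tuples_def card_image)
qed

lemma image_tuple_butlast:
  assumes "finite Z" "card Z = Suc n" "z \<in> distinct_tuples (Suc n) Z"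
  shows "z ` {..<n} = Z - {z n}"
proof -
  have i: "inj_on z (insert n {..<n})" using assms(3) by (simp add: distinct_tuples_def lessThan_Suc)
  have "Z = insert (z n) (z ` {..<n})" using image_tuple_eq[OF assms] by (simp add: lessThan_Suc)
  moreover have "z n \<notin> z ` {..<n}" using i by (auto dest: inj_onD)
  ultimately show ?thesis by simp
qed

text \<open>For a fixed last point the other \<open>n\<close> points can be ordered in
  \<open>fact n\<close> ways.\<close>

lemma tuple_sum_last:
  fixes F :: "'a \<Rightarrow> ennreal"
  assumes Z: "finite Z" "card Z = Suc n"
  shows "tuple_sum (Suc n) Z (\<lambda>z. F (z n)) = fact n * (\<Sum>x\<in>Z. F x)"
proof -
  let ?T = "distinct_tuples (Suc n) Z"
  have fin: "finite ?T" by (rule distinct_tuples_finite[OF Z(1)])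
  have "tuple_sum (Suc n) Z (\<lambda>z. F (z n)) = (\<Sum>z\<in>?T. F (z n))" by (rule tuple_sum_finite[OF Z(1)])
  also have "\<dots> = (\<Sum>x\<in>Z. \<Sum>z | z \<in> ?T \<and> z n = x. F (z n))"
    by (rule sum.group[symmetric]) (use fin Z in \<open>auto simp: distinct_tuples_def\<close>)
  also have "\<dots> = (\<Sum>x\<in>Z. fact n * F x)"
  proof (rule sum.cong[OF refl])
    fix x assume x: "x \<in> Z"
    have "bij_betw (\<lambda>z. restrict z {..<n}) {z. z \<in> ?T \<and> z n = x} (distinct_tuples n (Z - {x}))"
    proof (rule bij_betw_byWitness[where f' = "\<lambda>w. w(n := x)"])
      show "\<forall>z\<in>{z. z \<in> ?T \<and> z n = x}. (restrict z {..<n})(n := x) = z"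
        by (auto simp: fun_eq_iff distinct_tuples_def PiE_def extensional_def)
      show "\<forall>w\<in>distinct_tuples n (Z - {x}). restrict (w(n := x)) {..<n} = w"
        by (auto simp: fun_eq_iff distinct_tuples_def PiE_def extensional_def)
      show "(\<lambda>z. restrict z {..<n}) ` {z. z \<in> ?T \<and> z n = x} \<subseteq> distinct_tuples n (Z - {x})"
      proof
        fix w assume "w \<in> (\<lambda>z. restrict z {..<n}) ` {z. z \<in> ?T \<and> z n = x}"
        then obtain z where z: "z \<in> ?T" "z n = x" and w: "w = restrict z {..<n}" by blast
        have im: "z ` {..<n} = Z - {x}" using image_tuple_butlast[OF Z z(1)] z(2) by simp
        have "inj_on z {..<n}" using z(1) by (auto simp: distinct_tuples_def inj_on_def)
        then show "w \<in> distinct_tuples n (Z - {x})"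
          using im by (auto simp: w distinct_tuples_def inj_on_def)
      qed
      show "(\<lambda>w. w(n := x)) ` distinct_tuples n (Z - {x}) \<subseteq> {z. z \<in> ?T \<and> z n = x}"
      proof
        fix z assume "z \<in> (\<lambda>w. w(n := x)) ` distinct_tuples n (Z - {x})"
        then obtain w where w: "w \<in> {..<n} \<rightarrow>\<^sub>E (Z - {x})" "inj_on w {..<n}" and z: "z = w(n := x)"
          by (auto simp: distinct_tuples_def)
        have wZ: "w i \<in> Z" "w i \<noteq> x" if "i < n" for i using PiE_mem[OF w(1), of i] that by auto
        have "z \<in> {..<Suc n} \<rightarrow>\<^sub>E Z"
        proof (rule PiE_I)
          show "z i \<in> Z" if "i \<in> {..<Suc n}" for i using that wZ(1)[of i] x by (cases "i = n") (auto simp: z)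
          show "z i = undefined" if "i \<notin> {..<Suc n}" for i using that PiE_arb[OF w(1), of i] by (auto simp: z)
        qed
        moreover have "inj_on z {..<Suc n}"
        proof (rule inj_onI)
          fix i j assume ij: "i \<in> {..<Suc n}" "j \<in> {..<Suc n}" "z i = z j"
          show "i = j"
          proof (cases "i = n")
            case True then show ?thesis using ij wZ(2)[of j] by (cases "j = n") (auto simp: z)
          next
            case False
            then have "j \<noteq> n" using ij wZ(2)[of i] by (auto simp: z)
            then show ?thesis using False ij w(2) by (auto simp: z dest: inj_onD)
          qed
        qed
        ultimately show "z \<in> {z. z \<in> ?T \<and> z n = x}" by (simp add: distinct_tuples_def z)
      qed
    qed
    then have "card {z. z \<in> ?T \<and> z n = x} = card (distinct_tuples n (Z - {x}))" by (rule bij_betw_same_card)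
    also have "\<dots> = fact n" using Z x by (simp add: card_distinct_tuples)
    finally have card: "card {z. z \<in> ?T \<and> z n = x} = fact n" .
    have "(\<Sum>z | z \<in> ?T \<and> z n = x. F (z n)) = (\<Sum>z | z \<in> ?T \<and> z n = x. F x)" by (rule sum.cong) auto
    then show "(\<Sum>z | z \<in> ?T \<and> z n = x. F (z n)) = fact n * F x" by (simp only: sum_constant card of_nat_fact)
  qed
  finally show ?thesis by (simp add: sum_distrib_left)
qed

lemma suminf_of_bool_ennreal: "(\<Sum>n. of_bool (c = n) * f n) = (f c :: ennreal)"
proof -
  have "(\<Sum>n. of_bool (c = n) * f n) = (\<Sum>n\<in>{c}. of_bool (c = n) * f n)"
    by (rule suminf_finite) auto
  then show ?thesis by simp
qed

text \<open>Coordinates may coincide, so each point of the image is counted at the first index where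
  it occurs.\<close>

lemma image_tuple_measurable:
  fixes M :: "'a::{metric_space, second_countable_topology} measure"
  assumes M: "sets M = sets borel"
  shows "(\<lambda>z. z ` {..<n}) \<in> measurable (PiM {..<n} (\<lambda>_::nat. M)) configurations"
proof (rule measurable_configurationsI)
  fix z show "locally_finite (z ` {..<n})" by (rule finite_locally_finite) simp
next
  fix A :: "'a set" and k assume A: "A \<in> sets borel"
  let ?N = "PiM {..<n} (\<lambda>_::nat. M)"
  let ?S = "\<lambda>z. {i. i < n \<and> z i \<in> A \<and> (\<forall>j<i. z j \<noteq> z i)}"
  have card: "card (z ` {..<n} \<inter> A) = (\<Sum>i<n. of_bool (z i \<in> A \<and> (\<forall>j<i. z j \<noteq> z i)))" for z :: "nat \<Rightarrow> 'a"
  proof -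
    have "bij_betw z (?S z) (z ` {..<n} \<inter> A)"
    proof (rule bij_betw_imageI)
      show "inj_on z (?S z)"
      proof (rule inj_onI)
        fix i j assume "i \<in> ?S z" "j \<in> ?S z" "z i = z j"
        then show "i = j" by (cases i j rule: linorder_cases) auto
      qed
      show "z ` ?S z = z ` {..<n} \<inter> A"
      proof (intro equalityI subsetI)
        fix a assume "a \<in> z ` {..<n} \<inter> A"
        then obtain i where i: "i < n" "z i = a" and a: "a \<in> A" by auto
        define l where "l = (LEAST i. z i = a)"
        have l: "z l = a" "l \<le> i" using i(2) unfolding l_def by (auto intro: LeastI Least_le)
        have "z j \<noteq> a" if "j < l" for j using that not_less_Least unfolding l_def by blast
        then have "l \<in> ?S z" using l i a by auto
        then show "a \<in> z ` ?S z" using l(1) by (intro image_eqI[of _ _ l]) auto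
      qed auto
    qed
    then have "card (z ` {..<n} \<inter> A) = card (?S z)" by (simp add: bij_betw_same_card)
    also have "\<dots> = (\<Sum>i<n. of_bool (z i \<in> A \<and> (\<forall>j<i. z j \<noteq> z i)))"
      by (simp add: of_bool_def sum.If_cases) (rule arg_cong[where f=card], auto)
    finally show ?thesis .
  qed
  have comp: "(\<lambda>z. z i) \<in> borel_measurable ?N" if "i < n" for i
    using measurable_component_singleton[of i "{..<n}" "\<lambda>_. M"] that by (simp add: measurable_cong_sets[OF refl M])
  have pr: "{z \<in> space ?N. z i \<in> A \<and> (\<forall>j<i. z j \<noteq> z i)} \<in> sets ?N" if "i < n" for i
  proof -
    have "{z \<in> space ?N. z i \<in> A} \<in> sets ?N"
      using measurable_sets[OF comp[OF that] A] by (simp add: vimage_def Int_def conj_commute)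
    moreover have "{z \<in> space ?N. z j \<noteq> z i} \<in> sets ?N" if "j < i" for j
    proof -
      have "{z \<in> space ?N. z j = z i} \<in> sets ?N"
        using that \<open>i < n\<close> by (intro measurable_equality_set comp) auto
      then show ?thesis by (rule sets.sets_Collect_neg)
    qed
    then have "{z \<in> space ?N. \<forall>j\<in>{..<i}. z j \<noteq> z i} \<in> sets ?N"
      by (intro sets.sets_Collect_finite_All finite_lessThan) (simp only: lessThan_iff)
    ultimately have "{z \<in> space ?N. z i \<in> A} \<inter> {z \<in> space ?N. \<forall>j\<in>{..<i}. z j \<noteq> z i} \<in> sets ?N"
      by (rule sets.Int)
    moreover have "{z \<in> space ?N. z i \<in> A} \<inter> {z \<in> space ?N. \<forall>j\<in>{..<i}. z j \<noteq> z i} =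
        {z \<in> space ?N. z i \<in> A \<and> (\<forall>j<i. z j \<noteq> z i)}" by auto
    ultimately show ?thesis by (simp only:)
  qed
  have "(\<lambda>z. \<Sum>i<n. of_bool (z i \<in> A \<and> (\<forall>j<i. z j \<noteq> z i)) :: real) \<in> borel_measurable ?N"
  proof (intro borel_measurable_sum)
    fix i assume "i \<in> {..<n}"
    then have i: "i < n" by simp
    have "(\<lambda>z. indicator {z \<in> space ?N. z i \<in> A \<and> (\<forall>j<i. z j \<noteq> z i)} z :: real) \<in> borel_measurable ?N"
      by (intro borel_measurable_indicator pr i)
    then show "(\<lambda>z. of_bool (z i \<in> A \<and> (\<forall>j<i. z j \<noteq> z i)) :: real) \<in> borel_measurable ?N"
      by (rule measurable_cong[THEN iffD1, rotated]) (auto simp: indicator_def)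
  qed
  then have "(\<lambda>z. \<Sum>i<n. of_bool (z i \<in> A \<and> (\<forall>j<i. z j \<noteq> z i)) :: real) -` {real k} \<inter> space ?N \<in> sets ?N"
    by (rule measurable_sets) simp
  moreover have "(\<Sum>i<n. of_bool (z i \<in> A \<and> (\<forall>j<i. z j \<noteq> z i)) :: real) = real (card (z ` {..<n} \<inter> A))" for z :: "nat \<Rightarrow> 'a"
    unfolding card by simp
  moreover have "{z \<in> space ?N. card (z ` {..<n} \<inter> A) = k} = (\<lambda>z. real (card (z ` {..<n} \<inter> A))) -` {real k} \<inter> space ?N"
    by auto
  ultimately show "{z \<in> space ?N. card (z ` {..<n} \<inter> A) = k} \<in> sets ?N" by simp
qed

text \<open>
  The squared distance of \<open>K\<^sub>t\<close> from the span of the \<open>K\<^sub>z\<^sub>i\<close> (see \<open>gain_residual\<close>) when the denominator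
  is nonzero, and \<open>0\<close> otherwise since \<open>x / 0 = 0\<close>.
\<close>

definition gain :: "('a \<Rightarrow> 'a \<Rightarrow> complex) \<Rightarrow> nat \<Rightarrow> (nat \<Rightarrow> 'a) \<Rightarrow> 'a \<Rightarrow> real" where
  "gain k n z t = Re (det_on {..<Suc n} (\<lambda>i j. k ((z(n := t)) i) ((z(n := t)) j))) / Re (det_on {..<n} (\<lambda>i j. k (z i) (z j)))"

context dpp_window
begin

text \<open>The total squared distance over all points \<open>t\<close> of \<open>B\<close> that
  might be inserted; the overview shows that it must vanish under rigidity.\<close>

definition deficit :: "'a set \<Rightarrow> nat \<Rightarrow> (nat \<Rightarrow> 'a) \<Rightarrow> ennreal" where
  "deficit B n z = (\<integral>\<^sup>+t. ennreal (gain kD n z t) * indicator B t \<partial>\<mu>)"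

text \<open>Averaging over the orderings gives a function of the finite set; almost surely all
  orderings have the same deficit, as \<open>total_deficit_eq\<close> and
  \<open>AE_dens_nonzero\<close> show.\<close>

definition total_deficit :: "'a set \<Rightarrow> 'a set \<Rightarrow> ennreal" where
  "total_deficit B Z = tuple_sum (card Z) Z (\<lambda>z. ennreal (1 / fact (card Z)) * deficit B (card Z) z)"

lemma deficit_measurable:
  assumes B: "B \<in> sets borel"
  shows "deficit B n \<in> borel_measurable (\<mu>n {..<n})"
proof -
  interpret sigma_finite_measure \<mu> by (rule sf)
  have ins: "insert n {..<n} = {..<Suc n}" by (simp add: lessThan_Suc)
  have "(\<lambda>p. (fst p)(n := snd p)) \<in> measurable (\<mu>n {..<n} \<Otimes>\<^sub>M \<mu>) (\<mu>n {..<Suc n})"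
    using measurable_add_dim[of n "{..<n}" "\<lambda>_. \<mu>"] by (simp add: case_prod_beta' ins)
  from measurable_compose[OF this dens_measurable]
  have 1: "(\<lambda>p. dens (Suc n) ((fst p)(n := snd p))) \<in> borel_measurable (\<mu>n {..<n} \<Otimes>\<^sub>M \<mu>)" .
  have 2: "(\<lambda>p. dens n (fst p)) \<in> borel_measurable (\<mu>n {..<n} \<Otimes>\<^sub>M \<mu>)"
    by (rule measurable_compose[OF measurable_fst dens_measurable])
  have 3: "(\<lambda>p. indicator B (snd p) :: ennreal) \<in> borel_measurable (\<mu>n {..<n} \<Otimes>\<^sub>M \<mu>)"
    by (rule measurable_compose[OF measurable_snd]) (use B sets_mu in simp)
  have "(\<lambda>p. ennreal (gain kD n (fst p) (snd p)) * indicator B (snd p)) \<in> borel_measurable (\<mu>n {..<n} \<Otimes>\<^sub>M \<mu>)"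
    unfolding gain_def by (intro borel_measurable_times_ennreal 3 measurable_compose[OF _ measurable_ennreal] borel_measurable_divide 1 2)
  then show ?thesis unfolding deficit_def[abs_def] by (intro borel_measurable_nn_integral) (simp add: case_prod_beta')
qed

lemma upd_measurable:
  assumes "z \<in> space (\<mu>n {..<n})"
  shows "(\<lambda>t. z(n := t)) \<in> measurable \<mu> (\<mu>n {..<Suc n})"
  using measurable_component_update[OF assms, of n] by (simp add: lessThan_Suc)

text \<open>\<open>janossy_Suc\<close> integrated over the inserted point.\<close>

lemma deficit_janossy_le:
  assumes z: "z \<in> space (\<mu>n {..<n})" and B: "B \<in> sets borel"
  shows "deficit B n z * ennreal (janossy \<mu> kD n z) \<le> (\<integral>\<^sup>+t. ennreal (janossy \<mu> kD (Suc n) (z(n := t))) * indicator B t \<partial>\<mu>)"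
proof -
  have "(\<lambda>t. dens (Suc n) (z(n := t))) \<in> borel_measurable \<mu>"
    by (rule measurable_compose[OF upd_measurable[OF z] dens_measurable])
  then have meas: "(\<lambda>t. ennreal (gain kD n z t) * indicator B t) \<in> borel_measurable \<mu>"
    unfolding gain_def
    by (intro borel_measurable_times_ennreal measurable_compose[OF _ measurable_ennreal] borel_measurable_divide
        borel_measurable_const borel_measurable_indicator) (use B sets_mu in auto)
  have "deficit B n z * ennreal (janossy \<mu> kD n z) = (\<integral>\<^sup>+t. ennreal (gain kD n z t) * indicator B t * ennreal (janossy \<mu> kD n z) \<partial>\<mu>)"
    unfolding deficit_def by (rule nn_integral_multc[OF meas, symmetric])
  also have "\<dots> \<le> (\<integral>\<^sup>+t. ennreal (janossy \<mu> kD (Suc n) (z(n := t))) * indicator B t \<partial>\<mu>)"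
  proof (rule nn_integral_mono)
    fix t
    \<comment> \<open>Neither the determinant nor the Janossy density for \<open>n\<close> points
      reads the coordinate \<open>n\<close>.\<close>
    have d: "dens n (z(n := t)) = dens n z"
      by (intro arg_cong[where f=Re] det_on_cong) auto
    have j: "janossy \<mu> kD n (z(n := t)) = janossy \<mu> kD n z"
    proof -
      have "(if i < n then (z(n := t)) i else y i) = (if i < n then z i else y i)" for i and y :: "nat \<Rightarrow> 'a" by auto
      then show ?thesis unfolding janossy_def by (simp only:)
    qed
    have "gain kD n z t * janossy \<mu> kD n z \<le> janossy \<mu> kD (Suc n) (z(n := t))"
      using janossy_Suc[OF D_sets D_int, of n "z(n := t)"] unfolding gain_def j d .
    then have "ennreal (gain kD n z t) * ennreal (janossy \<mu> kD n z) \<le> ennreal (janossy \<mu> kD (Suc n) (z(n := t)))"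
      by (simp only: ennreal_mult''[OF janossy_nonneg', symmetric] ennreal_leI)
    then show "ennreal (gain kD n z t) * indicator B t * ennreal (janossy \<mu> kD n z) \<le> ennreal (janossy \<mu> kD (Suc n) (z(n := t))) * indicator B t"
      by (cases "t \<in> B") simp_all
  qed
  finally show ?thesis .
qed

lemma card_XD_measurable: "(\<lambda>\<omega>. of_bool (card (X \<omega> \<inter> D) = n) :: ennreal) \<in> borel_measurable P"
proof -
  have "(\<lambda>S. card (S \<inter> D)) \<in> measurable configurations (count_space UNIV)"
    by (rule measurable_card[OF proper D_borel D_bounded])
  from measurable_compose[OF measurable_compose[OF X_measurable this], of "\<lambda>i. of_bool (i = n)" borel]
  show ?thesis by simp
qed

lemma image_indicator_measurable:
  assumes "A \<in> sets configurations"
  shows "(\<lambda>z. indicator A (z ` {..<n}) :: ennreal) \<in> borel_measurable (\<mu>n {..<n})"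
  by (rule measurable_compose[OF image_tuple_measurable[OF sets_mu]]) (use assms in simp)

lemma total_deficit_expand:
  assumes Z: "finite Z"
  shows "indicator A Z * total_deficit B Z =
    (\<Sum>n. of_bool (card Z = n) * tuple_sum n Z (\<lambda>z. ennreal (1 / fact n) * indicator A (z ` {..<n}) * deficit B n z))"
proof -
  let ?n = "card Z"
  have "indicator A Z * total_deficit B Z = (\<Sum>z\<in>distinct_tuples ?n Z. indicator A Z * (ennreal (1 / fact ?n) * deficit B ?n z))"
    unfolding total_deficit_def tuple_sum_finite[OF Z] by (rule sum_distrib_left)
  also have "\<dots> = (\<Sum>z\<in>distinct_tuples ?n Z. ennreal (1 / fact ?n) * indicator A (z ` {..<?n}) * deficit B ?n z)"
    by (rule sum.cong[OF refl]) (simp only: image_tuple_eq[OF Z refl] ac_simps)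
  finally show ?thesis unfolding suminf_of_bool_ennreal tuple_sum_finite[OF Z] .
qed

text \<open>A tuple of length \<open>n + 1\<close> is read as an ordering of the remaining points
  followed by the deleted point; the \<open>fact n\<close> orderings cancel the weight
  \<open>1 / fact n\<close>.\<close>

lemma deletion_expand:
  assumes Z: "finite Z"
  shows "(\<Sum>x\<in>Z \<inter> B. indicator A (Z - {x})) =
    (\<Sum>n. of_bool (card Z = Suc n) * tuple_sum (Suc n) Z (\<lambda>z. ennreal (1 / fact n) * indicator B (z n) * indicator A (z ` {..<n})))"
proof (cases "card Z")
  case 0
  then show ?thesis using Z by simp
next
  case (Suc m)
  have "(\<Sum>n. of_bool (card Z = Suc n) * tuple_sum (Suc n) Z (\<lambda>z. ennreal (1 / fact n) * indicator B (z n) * indicator A (z ` {..<n}))) =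
     tuple_sum (Suc m) Z (\<lambda>z. ennreal (1 / fact m) * indicator B (z m) * indicator A (z ` {..<m}))"
    unfolding Suc nat.inject by (rule suminf_of_bool_ennreal)
  also have "\<dots> = tuple_sum (Suc m) Z (\<lambda>z. ennreal (1 / fact m) * (indicator B (z m) * indicator A (Z - {z m})))"
    unfolding tuple_sum_finite[OF Z]
    by (rule sum.cong[OF refl]) (simp only: image_tuple_butlast[OF Z Suc] mult.assoc)
  also have "\<dots> = fact m * (\<Sum>x\<in>Z. ennreal (1 / fact m) * (indicator B x * indicator A (Z - {x})))"
    by (rule tuple_sum_last[OF Z Suc])
  also have "\<dots> = (fact m * ennreal (1 / fact m)) * (\<Sum>x\<in>Z. indicator B x * indicator A (Z - {x}))"
    by (simp only: sum_distrib_left mult.assoc)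
  also have "fact m * ennreal (1 / fact m) = 1"
  proof -
    have "(fact m :: ennreal) = ennreal (fact m)"
      by (metis ennreal_of_nat_eq_real_of_nat of_nat_fact)
    then show ?thesis by (simp flip: ennreal_mult)
  qed
  also have "1 * (\<Sum>x\<in>Z. indicator B x * indicator A (Z - {x})) = (\<Sum>x\<in>Z \<inter> B. indicator A (Z - {x}) :: ennreal)"
    by (simp only: mult_1_left sum.inter_restrict[OF Z]) (rule sum.cong, auto simp: indicator_def)
  finally show ?thesis by simp
qed

text \<open>Both sides are split by the number of points in the window. The left one becomes an
  integral against the Janossy density for \<open>n\<close>; the right one, with the deleted point
  as last coordinate, an integral against that for \<open>n + 1\<close>;
  \<open>deficit_janossy_le\<close> compares them.\<close>

lemma insertion_tolerance:
  assumes A: "A \<in> sets configurations" and B: "B \<in> sets borel" "B \<subseteq> D"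
  shows "(\<integral>\<^sup>+\<omega>. indicator A (X \<omega> \<inter> D) * total_deficit B (X \<omega> \<inter> D) \<partial>P) \<le>
    (\<integral>\<^sup>+\<omega>. (\<Sum>x\<in>X \<omega> \<inter> B. indicator A (X \<omega> \<inter> D - {x})) \<partial>P)"
proof -
  let ?g = "\<lambda>n z. ennreal (1 / fact n) * indicator A (z ` {..<n}) * deficit B n z"
  let ?h = "\<lambda>n z. ennreal (1 / fact n) * indicator B (z n) * indicator A (z ` {..<n})"
  have g: "?g n \<in> borel_measurable (\<mu>n {..<n})" for n
    by (intro borel_measurable_times_ennreal borel_measurable_const image_indicator_measurable A deficit_measurable B)
  have Bm: "(indicator B :: 'a \<Rightarrow> ennreal) \<in> borel_measurable \<mu>" using B sets_mu by simp
  have h: "?h n \<in> borel_measurable (\<mu>n {..<Suc n})" for n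
  proof (intro borel_measurable_times_ennreal borel_measurable_const)
    show "(\<lambda>z. indicator B (z n) :: ennreal) \<in> borel_measurable (\<mu>n {..<Suc n})"
      by (rule measurable_compose[OF measurable_component_singleton[of n "{..<Suc n}" "\<lambda>_. \<mu>"] Bm]) simp
    have "(\<lambda>z. restrict z {..<n}) \<in> measurable (\<mu>n {..<Suc n}) (\<mu>n {..<n})"
      by (rule measurable_restrict_subset) auto
    from measurable_compose[OF this image_indicator_measurable[OF A]]
    show "(\<lambda>z. indicator A (z ` {..<n}) :: ennreal) \<in> borel_measurable (\<mu>n {..<Suc n})" by simp
  qed
  have "(\<integral>\<^sup>+\<omega>. indicator A (X \<omega> \<inter> D) * total_deficit B (X \<omega> \<inter> D) \<partial>P) =
     (\<integral>\<^sup>+\<omega>. (\<Sum>n. of_bool (card (X \<omega> \<inter> D) = n) * tuple_sum n (X \<omega> \<inter> D) (?g n)) \<partial>P)"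
    by (rule nn_integral_cong) (rule total_deficit_expand[OF finite_XD])
  also have "\<dots> = (\<Sum>n. \<integral>\<^sup>+\<omega>. of_bool (card (X \<omega> \<inter> D) = n) * tuple_sum n (X \<omega> \<inter> D) (?g n) \<partial>P)"
    by (intro nn_integral_suminf borel_measurable_times_ennreal card_XD_measurable tuple_sum_X_measurable g)
  also have "\<dots> = (\<Sum>n. \<integral>\<^sup>+z. ?g n z * ennreal (janossy \<mu> kD n z) \<partial>\<mu>n {..<n})"
    by (simp only: janossy_density[OF g])
  also have "\<dots> \<le> (\<Sum>n. \<integral>\<^sup>+z. ?h n z * ennreal (janossy \<mu> kD (Suc n) z) \<partial>\<mu>n {..<Suc n})"
  proof (intro suminf_le summableI)
    fix n
    have "(\<integral>\<^sup>+z. ?g n z * ennreal (janossy \<mu> kD n z) \<partial>\<mu>n {..<n}) \<le>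
      (\<integral>\<^sup>+z. (\<integral>\<^sup>+t. ?h n (z(n := t)) * ennreal (janossy \<mu> kD (Suc n) (z(n := t))) \<partial>\<mu>) \<partial>\<mu>n {..<n})"
    proof (rule nn_integral_mono)
      fix z assume z: "z \<in> space (\<mu>n {..<n})"
      have "?g n z * ennreal (janossy \<mu> kD n z) = (ennreal (1 / fact n) * indicator A (z ` {..<n})) * (deficit B n z * ennreal (janossy \<mu> kD n z))"
        by (simp only: mult.assoc)
      also have "\<dots> \<le> (ennreal (1 / fact n) * indicator A (z ` {..<n})) * (\<integral>\<^sup>+t. ennreal (janossy \<mu> kD (Suc n) (z(n := t))) * indicator B t \<partial>\<mu>)"
        by (intro mult_left_mono deficit_janossy_le z B) simp
      also have "\<dots> = (\<integral>\<^sup>+t. (ennreal (1 / fact n) * indicator A (z ` {..<n})) * (ennreal (janossy \<mu> kD (Suc n) (z(n := t))) * indicator B t) \<partial>\<mu>)"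
      proof (rule nn_integral_cmult[symmetric])
        from measurable_compose[OF measurable_compose[OF upd_measurable[OF z] janossy_measurable] measurable_ennreal]
        show "(\<lambda>t. ennreal (janossy \<mu> kD (Suc n) (z(n := t))) * indicator B t) \<in> borel_measurable \<mu>"
          by (intro borel_measurable_times_ennreal Bm)
      qed
      also have "\<dots> = (\<integral>\<^sup>+t. ?h n (z(n := t)) * ennreal (janossy \<mu> kD (Suc n) (z(n := t))) \<partial>\<mu>)"
      proof (rule nn_integral_cong)
        fix t
        have "(z(n := t)) ` {..<n} = z ` {..<n}" by auto
        then show "(ennreal (1 / fact n) * indicator A (z ` {..<n})) * (ennreal (janossy \<mu> kD (Suc n) (z(n := t))) * indicator B t) =
           ?h n (z(n := t)) * ennreal (janossy \<mu> kD (Suc n) (z(n := t)))"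
          by (simp only: fun_upd_same ac_simps)
      qed
      finally show "?g n z * ennreal (janossy \<mu> kD n z) \<le> (\<integral>\<^sup>+t. ?h n (z(n := t)) * ennreal (janossy \<mu> kD (Suc n) (z(n := t))) \<partial>\<mu>)" .
    qed
    \<comment> \<open>Fubini joins the configuration \<open>z\<close> and the inserted point
      \<open>t\<close> to one tuple of length \<open>n + 1\<close>.\<close>
    also have "\<dots> = (\<integral>\<^sup>+z. ?h n z * ennreal (janossy \<mu> kD (Suc n) z) \<partial>\<mu>n {..<Suc n})"
    proof -
      have "(\<lambda>z. ?h n z * ennreal (janossy \<mu> kD (Suc n) z)) \<in> borel_measurable (\<mu>n {..<Suc n})"
        by (rule borel_measurable_times_ennreal[OF h measurable_compose[OF janossy_measurable measurable_ennreal]])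
      from product_nn_integral_insert[OF _ _ this[unfolded lessThan_Suc]] show ?thesis
        unfolding lessThan_Suc by simp
    qed
    finally show "(\<integral>\<^sup>+z. ?g n z * ennreal (janossy \<mu> kD n z) \<partial>\<mu>n {..<n}) \<le> (\<integral>\<^sup>+z. ?h n z * ennreal (janossy \<mu> kD (Suc n) z) \<partial>\<mu>n {..<Suc n})" .
  qed
  also have "\<dots> = (\<Sum>n. \<integral>\<^sup>+\<omega>. of_bool (card (X \<omega> \<inter> D) = Suc n) * tuple_sum (Suc n) (X \<omega> \<inter> D) (?h n) \<partial>P)"
    by (simp only: janossy_density[OF h])
  also have "\<dots> = (\<integral>\<^sup>+\<omega>. (\<Sum>n. of_bool (card (X \<omega> \<inter> D) = Suc n) * tuple_sum (Suc n) (X \<omega> \<inter> D) (?h n)) \<partial>P)"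
    by (intro nn_integral_suminf[symmetric] borel_measurable_times_ennreal card_XD_measurable tuple_sum_X_measurable h)
  also have "\<dots> = (\<integral>\<^sup>+\<omega>. (\<Sum>x\<in>X \<omega> \<inter> D \<inter> B. indicator A (X \<omega> \<inter> D - {x})) \<partial>P)"
    by (rule nn_integral_cong) (rule deletion_expand[OF finite_XD, symmetric])
  also have "\<dots> = (\<integral>\<^sup>+\<omega>. (\<Sum>x\<in>X \<omega> \<inter> B. indicator A (X \<omega> \<inter> D - {x})) \<partial>P)"
  proof -
    have "X \<omega> \<inter> D \<inter> B = X \<omega> \<inter> B" for \<omega> using B(2) by blast
    then show ?thesis by (simp only:)
  qed
  finally show ?thesis .
qed

end

section \<open>The gain as a squared distance\<close>

context rkhs_total
begin

text \<open>The difference of two residuals is a combination of the kernels at \<open>Z\<close> and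
  vanishes on \<open>Z\<close>, so it is orthogonal to itself. The coefficients may differ when the
  kernels are dependent.\<close>

lemma residual_unique:
  assumes Z: "finite Z" and f: "\<And>y. f y = K y t - (\<Sum>x\<in>Z. c x * K y x)" "\<And>x. x \<in> Z \<Longrightarrow> f x = 0"
    and g: "\<And>y. g y = K y t - (\<Sum>x\<in>Z. d x * K y x)" "\<And>x. x \<in> Z \<Longrightarrow> g x = 0"
  shows "f = g"
proof -
  define r where "r y = (\<Sum>x\<in>Z. (d x - c x) * K y x)" for y
  have r: "r y = f y - g y" for y
    unfolding r_def f(1) g(1) by (simp add: left_diff_distrib sum_subtractf)
  have rH: "r \<in> H" unfolding r_def[abs_def] by (rule H_sum[OF Z ker_H])
  have "of_real ((nrm r)\<^sup>2) = ip r r" by (simp only: L2_inner_self)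
  also have "\<dots> = cnj (ip r r)" by (simp only: L2_inner_cnj)
  also have "ip r r = (\<Sum>x\<in>Z. (d x - c x) * ip (ker x) r)"
    unfolding r_def[abs_def] by (rule L2_inner_sum[OF Z]) (use ker_H rH in \<open>auto simp: r_def[abs_def]\<close>)
  also have "\<dots> = 0"
  proof (rule sum.neutral, rule ballI)
    fix x assume x: "x \<in> Z"
    have "ip (ker x) r = cnj (ip r (ker x))" by (simp only: L2_inner_cnj)
    also have "ip r (ker x) = r x" by (rule reproducing[OF rH, symmetric])
    also have "r x = 0" using x f(2) g(2) by (simp add: r)
    finally show "(d x - c x) * ip (ker x) r = 0" by simp
  qed
  finally have "nrm r = 0" by simp
  then have "r y = 0" for y by (rule eq_0_if_norm_0[OF rH])
  then show ?thesis using r by (auto simp: fun_eq_iff)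
qed

text \<open>Elimination of row \<open>t\<close> in the kernel matrix and projection of the kernel at
  \<open>t\<close> use conjugate coefficients, because vanishing at \<open>z j\<close> means
  orthogonality to the kernel there. The pivot is then the squared norm of the residual.\<close>

lemma gain_residual:
  assumes z: "inj_on z {..<n}" and nz: "Re (det_on {..<n} (\<lambda>i j. K (z i) (z j))) \<noteq> 0"
  shows "\<exists>f c. (\<forall>y. f y = K y t - (\<Sum>x\<in>z ` {..<n}. c x * K y x)) \<and> (\<forall>x\<in>z ` {..<n}. f x = 0) \<and>
    gain K n z t = (nrm f)\<^sup>2"
proof -
  define w where "w = z(n := t)"
  have w: "psd (\<lambda>i j. K (w i) (w j))" by (rule psd_pullback[OF ker_psd])
  obtain C where C: "\<And>i j. j \<in> {..<n} \<Longrightarrow> K (w i) (w j) = (\<Sum>s\<in>{..<n}. C i s * K (w s) (w j))"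
    using psd_residual[OF w finite_lessThan] by blast
  have wn: "w n = t" and wi: "\<And>i. i < n \<Longrightarrow> w i = z i" by (auto simp: w_def)
  \<comment> \<open>Coefficients are carried from indices to points, so that the residual refers
    only to the set. The conjugate appears because elimination acts on the first argument of
    \<open>K\<close> and the residual on the second.\<close>
  define c where "c x = cnj (C n (the_inv_into {..<n} z x))" for x
  have cz: "c (z i) = cnj (C n i)" if "i < n" for i
    using the_inv_into_f_f[OF z, of i] that by (simp add: c_def)
  define f where "f y = K y t - (\<Sum>x\<in>z ` {..<n}. c x * K y x)" for y
  have f: "f y = K y t - (\<Sum>s<n. cnj (C n s) * K y (z s))" for y
    unfolding f_def by (subst sum.reindex[OF z]) (simp add: cz)
  have fz: "f (z j) = 0" if "j < n" for j
  proof -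
    have "K t (z j) = (\<Sum>s<n. C n s * K (z s) (z j))"
      using C[of j n] that by (simp add: wn wi)
    then have "cnj (K t (z j)) = cnj (\<Sum>s<n. C n s * K (z s) (z j))" by (rule arg_cong)
    then show ?thesis unfolding f by (simp add: ker_cnj)
  qed
  have fH: "f \<in> H" unfolding f_def[abs_def] by (intro H_diff H_sum ker_H) auto
  have "of_real ((nrm f)\<^sup>2) = ip f f" by (simp only: L2_inner_self)
  also have "\<dots> = ip (ker t) f - ip (\<lambda>y. \<Sum>s<n. cnj (C n s) * K y (z s)) f"
  proof -
    have "ip f f = ip (\<lambda>y. K y t - (\<Sum>s<n. cnj (C n s) * K y (z s))) f"
      by (rule arg_cong[where f="\<lambda>g. ip g f"]) (rule ext, rule f)
    also have "\<dots> = ip (ker t) f - ip (\<lambda>y. \<Sum>s<n. cnj (C n s) * K y (z s)) f"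
      by (intro L2_inner_diff in_L2 ker_H H_sum fH) auto
    finally show ?thesis .
  qed
  also have "ip (\<lambda>y. \<Sum>s<n. cnj (C n s) * K y (z s)) f = (\<Sum>s<n. cnj (C n s) * ip (ker (z s)) f)"
    by (intro L2_inner_sum in_L2 ker_H fH) auto
  also have "\<dots> = 0"
  proof (rule sum.neutral, rule ballI)
    fix s assume "s \<in> {..<n}"
    then have "ip f (ker (z s)) = 0" using fz[of s] reproducing[OF fH, of "z s"] by simp
    then show "cnj (C n s) * ip (ker (z s)) f = 0" using L2_inner_cnj[of \<mu> f "ker (z s)"] by simp
  qed
  also have "ip (ker t) f = cnj (f t)"
    using reproducing[OF fH, of t] L2_inner_cnj[of \<mu> f "ker t"] by simp
  also have "cnj (f t) = K t t - (\<Sum>s<n. C n s * K (z s) t)"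
    unfolding f by (simp add: ker_cnj)
  finally have norm: "of_real ((nrm f)\<^sup>2) = K t t - (\<Sum>s<n. C n s * K (z s) t)" by simp
  have "det_on (insert n {..<n}) (\<lambda>i j. K (w i) (w j)) =
     (K (w n) (w n) - (\<Sum>s\<in>{..<n}. C n s * K (w s) (w n))) * det_on {..<n} (\<lambda>i j. K (w i) (w j))"
    by (rule det_on_insert) (use C in auto)
  also have "K (w n) (w n) - (\<Sum>s\<in>{..<n}. C n s * K (w s) (w n)) = of_real ((nrm f)\<^sup>2)"
    unfolding norm by (simp add: wn wi)
  also have "det_on {..<n} (\<lambda>i j. K (w i) (w j)) = det_on {..<n} (\<lambda>i j. K (z i) (z j))"
    by (rule det_on_cong) (simp add: wi)
  finally have "Re (det_on {..<Suc n} (\<lambda>i j. K (w i) (w j))) = (nrm f)\<^sup>2 * Re (det_on {..<n} (\<lambda>i j. K (z i) (z j)))"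
    by (simp only: lessThan_Suc Re_of_real_mult)
  then have "gain K n z t = (nrm f)\<^sup>2" using nz by (simp add: gain_def w_def)
  then show ?thesis using f_def fz by blast
qed

end

context dpp_window
begin

lemma gain_compressed:
  assumes "z ` {..<n} \<subseteq> D" "t \<in> D"
  shows "gain kD n z t = gain K n z t"
proof -
  have "z i \<in> D" if "i < n" for i using assms that by auto
  then have 1: "det_on {..<n} (\<lambda>i j. kD (z i) (z j)) = det_on {..<n} (\<lambda>i j. K (z i) (z j))"
    and 2: "det_on {..<Suc n} (\<lambda>i j. kD ((z(n := t)) i) ((z(n := t)) j)) = det_on {..<Suc n} (\<lambda>i j. K ((z(n := t)) i) ((z(n := t)) j))"
    using assms(2) by (intro det_on_cong; simp add: compressed_kernel_def)+
  show ?thesis unfolding gain_def 1 2 ..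
qed

text \<open>The residual is determined by the set \<open>Z\<close>, so all
  \<open>fact (card Z)\<close> orderings have the same gain at each \<open>t\<close>.\<close>

lemma total_deficit_eq:
  assumes Z: "finite Z" "Z \<subseteq> D" and B: "B \<subseteq> D" and z: "z \<in> distinct_tuples (card Z) Z"
    and nd: "\<And>z. z \<in> distinct_tuples (card Z) Z \<Longrightarrow> dens (card Z) z \<noteq> 0"
  shows "total_deficit B Z = deficit B (card Z) z"
proof -
  let ?n = "card Z"
  have eq: "deficit B ?n z' = deficit B ?n z" if z': "z' \<in> distinct_tuples ?n Z" for z'
    unfolding deficit_def
  proof (rule nn_integral_cong)
    fix t
    show "ennreal (gain kD ?n z' t) * indicator B t = ennreal (gain kD ?n z t) * indicator B t"
    proof (cases "t \<in> B")
      case True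
      then have t: "t \<in> D" using B by auto
      have res: "\<exists>f c. (\<forall>y. f y = K y t - (\<Sum>x\<in>Z. c x * K y x)) \<and> (\<forall>x\<in>Z. f x = 0) \<and> gain kD ?n z t = (nrm f)\<^sup>2"
        if z: "z \<in> distinct_tuples ?n Z" for z
      proof -
        have im: "z ` {..<?n} = Z" by (rule image_tuple_eq[OF Z(1) refl z])
        then have zD: "z ` {..<?n} \<subseteq> D" using Z by simp
        have "z i \<in> D" if "i < ?n" for i using zD that by auto
        then have "det_on {..<?n} (\<lambda>i j. kD (z i) (z j)) = det_on {..<?n} (\<lambda>i j. K (z i) (z j))"
          by (intro det_on_cong) (simp add: compressed_kernel_def)
        then have "Re (det_on {..<?n} (\<lambda>i j. K (z i) (z j))) \<noteq> 0" using nd[OF z] by simp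
        from gain_residual[OF _ this, of t] show ?thesis
          using z unfolding im gain_compressed[OF zD t] by (simp add: distinct_tuples_def)
      qed
      obtain f c where f: "\<And>y. f y = K y t - (\<Sum>x\<in>Z. c x * K y x)" "\<And>x. x \<in> Z \<Longrightarrow> f x = 0" "gain kD ?n z t = (nrm f)\<^sup>2"
        using res[OF z] by blast
      obtain g d where g: "\<And>y. g y = K y t - (\<Sum>x\<in>Z. d x * K y x)" "\<And>x. x \<in> Z \<Longrightarrow> g x = 0" "gain kD ?n z' t = (nrm g)\<^sup>2"
        using res[OF z'] by blast
      have "f = g" by (rule residual_unique[OF Z(1) f(1,2) g(1,2)])
      then show ?thesis using f(3) g(3) by simp
    qed simp
  qed
  have "total_deficit B Z = (\<Sum>z'\<in>distinct_tuples ?n Z. ennreal (1 / fact ?n) * deficit B ?n z)"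
    unfolding total_deficit_def tuple_sum_finite[OF Z(1)] by (rule sum.cong[OF refl]) (simp only: eq)
  also have "\<dots> = (of_nat (fact ?n) * ennreal (1 / fact ?n)) * deficit B ?n z"
    by (simp add: card_distinct_tuples[OF Z(1)] mult.assoc)
  also have "of_nat (fact ?n) * ennreal (1 / fact ?n) = 1"
  proof -
    have "(of_nat (fact ?n) :: ennreal) = ennreal (fact ?n)"
      by (metis ennreal_of_nat_eq_real_of_nat of_nat_fact)
    then show ?thesis by (simp only: ennreal_mult[symmetric] fact_ge_zero) (simp flip: ennreal_mult)
  qed
  finally show ?thesis by simp
qed

lemma total_deficit_measurable:
  assumes B: "B \<in> sets borel"
  shows "(\<lambda>\<omega>. total_deficit B (X \<omega> \<inter> D)) \<in> borel_measurable P"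
proof -
  let ?g = "\<lambda>n z. ennreal (1 / fact n) * indicator UNIV (z ` {..<n}) * deficit B n z"
  have "(\<lambda>\<omega>. \<Sum>n. of_bool (card (X \<omega> \<inter> D) = n) * tuple_sum n (X \<omega> \<inter> D) (?g n)) \<in> borel_measurable P"
    by (intro borel_measurable_suminf_order borel_measurable_times_ennreal card_XD_measurable tuple_sum_X_measurable
       borel_measurable_const deficit_measurable B) simp
  moreover have "total_deficit B (X \<omega> \<inter> D) = (\<Sum>n. of_bool (card (X \<omega> \<inter> D) = n) * tuple_sum n (X \<omega> \<inter> D) (?g n))" if "\<omega> \<in> space P" for \<omega>
    using total_deficit_expand[OF finite_XD[OF that], of UNIV B] by simp
  ultimately show ?thesis using measurable_cong[of P "\<lambda>\<omega>. total_deficit B (X \<omega> \<inter> D)"] by simp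
qed

lemma deletion_measurable:
  assumes A: "A \<in> sets configurations" and B: "B \<in> sets borel" "B \<subseteq> D"
  shows "(\<lambda>\<omega>. \<Sum>x\<in>X \<omega> \<inter> B. indicator A (X \<omega> \<inter> D - {x}) :: ennreal) \<in> borel_measurable P"
proof -
  let ?h = "\<lambda>n z. ennreal (1 / fact n) * indicator B (z n) * indicator A (z ` {..<n})"
  have Bm: "(indicator B :: 'a \<Rightarrow> ennreal) \<in> borel_measurable \<mu>" using B sets_mu by simp
  have h: "?h n \<in> borel_measurable (\<mu>n {..<Suc n})" for n
  proof (intro borel_measurable_times_ennreal borel_measurable_const)
    show "(\<lambda>z. indicator B (z n) :: ennreal) \<in> borel_measurable (\<mu>n {..<Suc n})"
      by (rule measurable_compose[OF measurable_component_singleton[of n "{..<Suc n}" "\<lambda>_. \<mu>"] Bm]) simp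
    have "(\<lambda>z. restrict z {..<n}) \<in> measurable (\<mu>n {..<Suc n}) (\<mu>n {..<n})"
      by (rule measurable_restrict_subset) auto
    from measurable_compose[OF this image_indicator_measurable[OF A]]
    show "(\<lambda>z. indicator A (z ` {..<n}) :: ennreal) \<in> borel_measurable (\<mu>n {..<Suc n})" by simp
  qed
  have m: "(\<lambda>\<omega>. \<Sum>n. of_bool (card (X \<omega> \<inter> D) = Suc n) * tuple_sum (Suc n) (X \<omega> \<inter> D) (?h n)) \<in> borel_measurable P"
    by (intro borel_measurable_suminf_order borel_measurable_times_ennreal card_XD_measurable tuple_sum_X_measurable h)
  have XB: "X \<omega> \<inter> D \<inter> B = X \<omega> \<inter> B" for \<omega> using B(2) by blast
  have "(\<lambda>\<omega>. \<Sum>x\<in>X \<omega> \<inter> B. indicator A (X \<omega> \<inter> D - {x}) :: ennreal) \<in> borel_measurable P \<longleftrightarrow>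
    (\<lambda>\<omega>. \<Sum>n. of_bool (card (X \<omega> \<inter> D) = Suc n) * tuple_sum (Suc n) (X \<omega> \<inter> D) (?h n)) \<in> borel_measurable P"
  proof (rule measurable_cong)
    fix \<omega> assume "\<omega> \<in> space P"
    from deletion_expand[OF finite_XD[OF this], of A B]
    show "(\<Sum>x\<in>X \<omega> \<inter> B. indicator A (X \<omega> \<inter> D - {x}) :: ennreal) =
      (\<Sum>n. of_bool (card (X \<omega> \<inter> D) = Suc n) * tuple_sum (Suc n) (X \<omega> \<inter> D) (?h n))"
      by (simp only: XB)
  qed
  then show ?thesis using m by (rule iffD2)
qed

text \<open>The expected number of tuples on which the density vanishes is the integral of the
  density over its own zero set. Nonzero determinants are what allows gains to be read as squared
  distances.\<close>

lemma AE_dens_nonzero: "AE \<omega> in P. \<forall>n. \<forall>z\<in>distinct_tuples n (X \<omega> \<inter> D). dens n z \<noteq> 0"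
proof -
  have "AE \<omega> in P. \<forall>z\<in>distinct_tuples n (X \<omega> \<inter> D). dens n z \<noteq> 0" for n
  proof -
    let ?A = "dens n -` {0} \<inter> space (\<mu>n {..<n})"
    have A: "?A \<in> sets (\<mu>n {..<n})" by (rule measurable_sets[OF dens_measurable]) simp
    have "(\<integral>\<^sup>+\<omega>. tuple_sum n (X \<omega> \<inter> D) (indicator ?A) \<partial>P) = (\<integral>\<^sup>+z. indicator ?A z * ennreal (dens n z) \<partial>\<mu>n {..<n})"
      by (rule tuple_expectation[OF borel_measurable_indicator[OF A]])
    also have "\<dots> = (\<integral>\<^sup>+z. 0 \<partial>\<mu>n {..<n})"
      by (rule nn_integral_cong) (auto split: split_indicator)
    finally have 0: "(\<integral>\<^sup>+\<omega>. tuple_sum n (X \<omega> \<inter> D) (indicator ?A) \<partial>P) = 0" by simp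
    have "AE \<omega> in P. tuple_sum n (X \<omega> \<inter> D) (indicator ?A) = 0"
      using 0 nn_integral_0_iff_AE[OF tuple_sum_X_measurable[OF borel_measurable_indicator[OF A]]] by (rule iffD1[rotated])
    then show ?thesis using AE_space
    proof eventually_elim
      case (elim \<omega>)
      have fin: "finite (distinct_tuples n (X \<omega> \<inter> D))" by (rule distinct_tuples_finite[OF finite_XD[OF elim(2)]])
      show ?case
      proof
        fix z assume z: "z \<in> distinct_tuples n (X \<omega> \<inter> D)"
        have "(indicator ?A z :: ennreal) = 0"
          using elim(1) z fin unfolding tuple_sum_finite[OF finite_XD[OF elim(2)]] by simp
        moreover have "z \<in> space (\<mu>n {..<n})" using z by (auto simp: distinct_tuples_def space_PiM space_mu)
        ultimately show "dens n z \<noteq> 0" by (auto simp: indicator_eq_0_iff)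
      qed
    qed
  qed
  then show ?thesis by (simp add: AE_all_countable)
qed

lemma expected_card: "(\<integral>\<^sup>+\<omega>. of_nat (card (X \<omega> \<inter> D)) \<partial>P) < \<infinity>"
proof -
  have "(\<integral>\<^sup>+\<omega>. of_nat (card (X \<omega> \<inter> D)) \<partial>P) = (\<integral>\<^sup>+\<omega>. tuple_sum 1 (X \<omega> \<inter> D) (\<lambda>_. 1) \<partial>P)"
  proof (rule nn_integral_cong)
    fix \<omega> assume \<omega>: "\<omega> \<in> space P"
    show "of_nat (card (X \<omega> \<inter> D)) = tuple_sum 1 (X \<omega> \<inter> D) (\<lambda>_. 1)"
      unfolding tuple_sum_finite[OF finite_XD[OF \<omega>]] by (simp add: card_distinct_tuples[OF finite_XD[OF \<omega>]])
  qed
  also have "\<dots> = (\<integral>\<^sup>+z. 1 * ennreal (dens 1 z) \<partial>\<mu>n {..<1})"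
    by (rule tuple_expectation) simp
  also have "\<dots> = ennreal (\<integral>z. dens 1 z \<partial>\<mu>n {..<1})"
    unfolding mult_1 by (intro nn_integral_eq_integral dens_integrable AE_I2 dens_nonneg)
  finally show ?thesis by simp
qed

end

section \<open>Consequences of rigidity\<close>

locale dpp_locally_finite = dpp \<mu> K H h P X
  for \<mu> :: "'a::{metric_space, second_countable_topology} measure" and K H h
    and P :: "'w measure" and X +
  fixes x0 :: 'a
  assumes compact_finite: "\<And>C. compact C \<Longrightarrow> emeasure \<mu> C < \<infinity>"
begin

text \<open>
  Bounding the diagonal of \<open>K\<close> makes it integrable on the window.
\<close>

definition window :: "nat \<Rightarrow> 'a set" where
  "window q = cball x0 (real q) \<inter> {x. Re (K x x) \<le> real q}"

lemma K_diag_measurable: "(\<lambda>x. Re (K x x)) \<in> borel_measurable \<mu>"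
proof -
  have "(\<lambda>x. (x, x)) \<in> measurable \<mu> (\<mu> \<Otimes>\<^sub>M \<mu>)" by simp
  from measurable_compose[OF measurable_compose[OF this K_measurable] borel_measurable_Re]
  show ?thesis by simp
qed

lemma window_borel: "window q \<in> sets borel"
proof -
  have "(\<lambda>x. Re (K x x)) \<in> borel_measurable borel"
    using K_diag_measurable by (simp add: measurable_cong_sets[OF sets_mu refl])
  then have "(\<lambda>x. Re (K x x)) -` {..real q} \<inter> space borel \<in> sets borel" by (rule measurable_sets) simp
  moreover have "window q = cball x0 (real q) \<inter> ((\<lambda>x. Re (K x x)) -` {..real q} \<inter> space borel)"
    by (auto simp: window_def)
  ultimately show ?thesis by simp
qed

lemma window_bounded: "bounded (window q)"
  unfolding window_def by (intro bounded_subset[OF bounded_cball]) auto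

lemma window_mono: "q \<le> l \<Longrightarrow> window q \<subseteq> window l"
  unfolding window_def by auto

lemma window_cover: "\<exists>q. x \<in> window q"
proof -
  obtain q :: nat where "max (dist x0 x) (Re (K x x)) \<le> real q" using real_arch_simple by blast
  then show ?thesis by (auto simp: window_def)
qed

lemma finite_in_window:
  assumes "finite F" shows "\<exists>q. F \<subseteq> window q"
  using assms
proof (induction F)
  case (insert x F)
  then obtain q l where "F \<subseteq> window q" "x \<in> window l" using window_cover by blast
  then have "insert x F \<subseteq> window (max q l)"
    using window_mono[of q "max q l"] window_mono[of l "max q l"] by auto
  then show ?case by blast
qed simp

lemma dpp_window: "dpp_window \<mu> K H h P X (window q)"
proof unfold_locales
  show "window q \<in> sets borel" "bounded (window q)" by (rule window_borel window_bounded)+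
  have W: "window q \<in> sets \<mu>" using window_borel sets_mu by simp
  show "integrable \<mu> (\<lambda>x. indicator (window q) x * Re (K x x))"
  proof (rule integrableI_bounded_set[where A="window q" and B="real q"])
    have "emeasure \<mu> (window q) \<le> emeasure \<mu> (cball x0 (real q))"
      by (rule emeasure_mono) (auto simp: window_def sets_mu)
    also have "\<dots> < \<infinity>" using proper by (intro compact_finite) (simp add: proper_space_def)
    finally show "emeasure \<mu> (window q) < \<infinity>" .
    show "(\<lambda>x. indicator (window q) x * Re (K x x)) \<in> borel_measurable \<mu>"
      by (intro borel_measurable_times borel_measurable_indicator W K_diag_measurable)
    show "AE x in \<mu>. x \<in> window q \<longrightarrow> norm (indicator (window q) x * Re (K x x)) \<le> real q"
      using psd_diag(2)[OF ker_psd] by (intro AE_I2) (simp add: window_def)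
  qed (use W in auto)
qed

text \<open>The algebra of events decided by a single window: it generates the sigma-algebra, and
  its members are the events to which \<open>insertion_tolerance\<close> applies.\<close>

definition local_events :: "'a set set set" where
  "local_events = {{Y \<in> space configurations. Y \<inter> window q \<in> A} | q A. A \<in> sets configurations}"

lemma restrict_window_measurable: "(\<lambda>Y. Y \<inter> window q) \<in> measurable configurations configurations"
  by (rule measurable_configurations_Int[OF proper window_borel])

lemma local_eventsE:
  assumes "L \<in> local_events"
  obtains q A where "A \<in> sets configurations" "L = {Y \<in> space configurations. Y \<inter> window q \<in> A}"
  using assms unfolding local_events_def by blast

lemma local_eventsI: "A \<in> sets configurations \<Longrightarrow> {Y \<in> space configurations. Y \<inter> window q \<in> A} \<in> local_events"
  unfolding local_events_def by blast

lemma restrict_config: "Y \<in> space configurations \<Longrightarrow> Y \<inter> B \<in> space configurations"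
  by (auto simp: space_configurations intro: locally_finite_subset)

text \<open>Restriction to the larger window followed by restriction to the smaller one loses
  nothing; any two local events can thus be placed in a common window.\<close>

lemma local_events_raise:
  assumes "A \<in> sets configurations" "q \<le> l"
  shows "\<exists>A'\<in>sets configurations. {Y \<in> space configurations. Y \<inter> window q \<in> A} = {Y \<in> space configurations. Y \<inter> window l \<in> A'}"
proof (rule bexI)
  let ?A = "(\<lambda>Y. Y \<inter> window q) -` A \<inter> space configurations"
  show "?A \<in> sets configurations" by (rule measurable_sets[OF restrict_window_measurable assms(1)])
  have "window l \<inter> window q = window q" using window_mono[OF assms(2)] by auto
  then have "Y \<inter> window l \<inter> window q = Y \<inter> window q" for Y by auto
  then show "{Y \<in> space configurations. Y \<inter> window q \<in> A} = {Y \<in> space configurations. Y \<inter> window l \<in> ?A}"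
    by (auto simp: restrict_config)
qed

lemma local_events_common:
  assumes "L \<in> local_events" "L' \<in> local_events"
  obtains q A A' where "A \<in> sets configurations" "A' \<in> sets configurations"
    "L = {Y \<in> space configurations. Y \<inter> window q \<in> A}" "L' = {Y \<in> space configurations. Y \<inter> window q \<in> A'}"
proof -
  obtain q A where A: "A \<in> sets configurations" "L = {Y \<in> space configurations. Y \<inter> window q \<in> A}"
    by (rule local_eventsE[OF assms(1)])
  obtain l B where B: "B \<in> sets configurations" "L' = {Y \<in> space configurations. Y \<inter> window l \<in> B}"
    by (rule local_eventsE[OF assms(2)])
  obtain A' where A': "A' \<in> sets configurations" "L = {Y \<in> space configurations. Y \<inter> window (max q l) \<in> A'}"
    using local_events_raise[OF A(1) max.cobounded1[of q l]] A(2) by blast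
  obtain B' where B': "B' \<in> sets configurations" "L' = {Y \<in> space configurations. Y \<inter> window (max q l) \<in> B'}"
    using local_events_raise[OF B(1) max.cobounded2[of l q]] B(2) by blast
  show ?thesis by (rule that[OF A'(1) B'(1) A'(2) B'(2)])
qed

lemma local_events_Int: "L \<in> local_events \<Longrightarrow> L' \<in> local_events \<Longrightarrow> L \<inter> L' \<in> local_events"
proof (erule (1) local_events_common)
  fix q A A' assume "A \<in> sets configurations" "A' \<in> sets configurations"
    and L: "L = {Y \<in> space configurations. Y \<inter> window q \<in> A}" "L' = {Y \<in> space configurations. Y \<inter> window q \<in> A'}"
  then have "{Y \<in> space configurations. Y \<inter> window q \<in> A \<inter> A'} \<in> local_events" by (intro local_eventsI) auto
  then show "L \<inter> L' \<in> local_events" unfolding L by (simp add: Int_def Collect_conj_eq[symmetric] conj_ac)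
qed

lemma local_events_compl: "L \<in> local_events \<Longrightarrow> space configurations - L \<in> local_events"
proof (erule local_eventsE)
  fix q A assume A: "A \<in> sets configurations" and L: "L = {Y \<in> space configurations. Y \<inter> window q \<in> A}"
  have "{Y \<in> space configurations. Y \<inter> window q \<in> space configurations - A} \<in> local_events" using A by (intro local_eventsI) auto
  moreover have "{Y \<in> space configurations. Y \<inter> window q \<in> space configurations - A} = space configurations - L"
    unfolding L using restrict_config by auto
  ultimately show "space configurations - L \<in> local_events" by simp
qed

lemma local_events_empty: "{} \<in> local_events"
  using local_eventsI[of "{}" 0] by simp

lemma local_events_Un: "L \<in> local_events \<Longrightarrow> L' \<in> local_events \<Longrightarrow> L \<union> L' \<in> local_events"
proof (erule (1) local_events_common)
  fix q A A' assume "A \<in> sets configurations" "A' \<in> sets configurations"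
    and L: "L = {Y \<in> space configurations. Y \<inter> window q \<in> A}" "L' = {Y \<in> space configurations. Y \<inter> window q \<in> A'}"
  then have "{Y \<in> space configurations. Y \<inter> window q \<in> A \<union> A'} \<in> local_events" by (intro local_eventsI) auto
  moreover have "{Y \<in> space configurations. Y \<inter> window q \<in> A \<union> A'} = L \<union> L'" unfolding L by auto
  ultimately show "L \<union> L' \<in> local_events" by simp
qed

lemma local_events_UN: "(\<And>i::nat. L i \<in> local_events) \<Longrightarrow> (\<Union>i<n. L i) \<in> local_events"
  by (induction n) (auto simp: lessThan_Suc intro: local_events_Un local_events_empty)

lemma local_events_sets: "L \<in> local_events \<Longrightarrow> L \<in> sets configurations"
proof (erule local_eventsE)
  fix q A assume A: "A \<in> sets configurations" and L: "L = {Y \<in> space configurations. Y \<inter> window q \<in> A}"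
  have "(\<lambda>Y. Y \<inter> window q) -` A \<inter> space configurations = L" unfolding L by auto
  then show "L \<in> sets configurations" using measurable_sets[OF restrict_window_measurable A, of q] by simp
qed

text \<open>The generators count points in bounded sets. A configuration has finitely many points
  there, so the count inside window \<open>q\<close> is constant for large \<open>q\<close>, and the
  full count is a limit of local ones.\<close>

lemma sigma_local_events: "sets configurations = sigma_sets (space configurations) local_events"
proof (rule antisym)
  show "sigma_sets (space configurations) local_events \<subseteq> sets configurations"
    using sets.sigma_sets_subset[of local_events configurations] local_events_sets by blast
  define N where "N = sigma (space (configurations :: 'a set measure)) local_events"
  have sub: "local_events \<subseteq> Pow (space configurations)" using local_events_sets sets.sets_into_space by blast
  have N: "space N = space configurations" "sets N = sigma_sets (space configurations) local_events"
    unfolding N_def using sub by simp_all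
  have "(\<lambda>Y. Y) \<in> measurable N configurations"
  proof (rule measurable_configurationsI)
    fix C :: "'a set" and j assume C: "C \<in> sets borel" "compact (closure C)"
    have bC: "bounded C" by (rule compact_closure_bounded[OF proper C(2)])
    have "(\<lambda>Y. real (card (Y \<inter> C))) \<in> borel_measurable N"
    proof (rule borel_measurable_LIMSEQ_real)
      fix Y assume "Y \<in> space N"
      then have "finite (Y \<inter> C)" using configuration_finite[OF proper _ bC] N by simp
      then obtain k0 where k0: "Y \<inter> C \<subseteq> window k0" using finite_in_window by blast
      have "Y \<inter> window q \<inter> C = Y \<inter> C" if "q \<ge> k0" for q using k0 window_mono[OF that] by auto
      then have "\<forall>\<^sub>F q in sequentially. real (card (Y \<inter> window q \<inter> C)) = real (card (Y \<inter> C))"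
        by (intro eventually_sequentiallyI[of k0]) simp
      then show "(\<lambda>q. real (card (Y \<inter> window q \<inter> C))) \<longlonglongrightarrow> real (card (Y \<inter> C))" by (rule tendsto_eventually)
    next
      fix q
      have "(\<lambda>Y. Y \<inter> window q) \<in> measurable N configurations"
      proof (rule measurableI)
        show "Y \<inter> window q \<in> space configurations" if "Y \<in> space N" for Y using that by (simp add: N restrict_config)
        fix A :: "'a set set" assume "A \<in> sets configurations"
        then have "{Y \<in> space configurations. Y \<inter> window q \<in> A} \<in> local_events" by (rule local_eventsI)
        then show "(\<lambda>Y. Y \<inter> window q) -` A \<inter> space N \<in> sets N"
          unfolding N by (intro sigma_sets.Basic) (simp add: vimage_def Int_def conj_commute)
      qed
      from measurable_compose[OF measurable_compose[OF this measurable_card[OF proper C(1) bC]], of real borel]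
      show "(\<lambda>Y. real (card (Y \<inter> window q \<inter> C))) \<in> borel_measurable N" by simp
    qed
    from measurable_sets[OF this, of "{real j}"]
    have "(\<lambda>Y. real (card (Y \<inter> C))) -` {real j} \<inter> space N \<in> sets N" by simp
    moreover have "{Y \<in> space N. card (Y \<inter> C) = j} = (\<lambda>Y. real (card (Y \<inter> C))) -` {real j} \<inter> space N" by auto
    ultimately show "{Y \<in> space N. card (Y \<inter> C) = j} \<in> sets N" by simp
  qed (simp add: N space_configurations)
  then show "sets configurations \<subseteq> sigma_sets (space configurations) local_events"
    using N measurable_sets[of "\<lambda>Y. Y" N configurations] sets.sets_into_space[of _ configurations]
    by (auto simp: subset_eq Int_absorb2)
qed

text \<open>The sets approximable in measure by local events are closed under complements, and under
  countable unions because finite unions exhaust these up to \<open>\<epsilon> / 2\<close>.\<close>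

lemma approximation_by_local:
  assumes M: "sets M = sets configurations" "emeasure M (space M) < \<infinity>" and A: "A \<in> sets configurations" and \<epsilon>: "0 < \<epsilon>"
  shows "\<exists>L\<in>local_events. measure M ((A - L) \<union> (L - A)) < \<epsilon>"
proof -
  interpret finite_measure M by (rule finite_measureI) (use M in auto)
  have spM: "space M = space configurations" using sets_eq_imp_space_eq[OF M(1)] .
  have local_M: "L \<in> sets M" if "L \<in> local_events" for L using local_events_sets[OF that] M by simp
  show ?thesis
    using A[unfolded sigma_local_events] \<epsilon>
  proof (induction arbitrary: \<epsilon> rule: sigma_sets.induct)
    case (Basic A)
    then show ?case by (intro bexI[of _ A]) simp_all
  next
    case Empty
    then show ?case using local_events_empty by (intro bexI[of _ "{}"]) simp_all
  next
    case (Compl A)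
    then obtain L where L: "L \<in> local_events" "measure M ((A - L) \<union> (L - A)) < \<epsilon>" by blast
    have "A \<subseteq> space configurations" "L \<subseteq> space configurations"
      using Compl(1) L(1) local_events_sets sigma_local_events sets.sets_into_space by blast+
    then have "(space configurations - A - (space configurations - L)) \<union> (space configurations - L - (space configurations - A)) = (A - L) \<union> (L - A)"
      by auto
    then show ?case using L local_events_compl[OF L(1)] by (intro bexI[of _ "space configurations - L"]) simp_all
  next
    case (Union A)
    have AM: "A i \<in> sets M" for i using Union(1) M sigma_local_events by simp
    have "(\<lambda>n. measure M (\<Union>i<n. A i)) \<longlonglongrightarrow> measure M (\<Union>n. \<Union>i<n. A i)"
      by (rule finite_Lim_measure_incseq) (use AM in \<open>auto simp: incseq_def intro: less_le_trans\<close>)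
    moreover have "(\<Union>n. \<Union>i<n. A i) = (\<Union>i. A i)" by (auto intro: exI[of _ "Suc _"])
    ultimately have "(\<lambda>n. measure M (\<Union>i<n. A i)) \<longlonglongrightarrow> measure M (\<Union>i. A i)" by simp
    then have "\<forall>\<^sub>F n in sequentially. measure M (\<Union>i. A i) - \<epsilon> / 2 < measure M (\<Union>i<n. A i)"
      using Union(3) by (intro order_tendstoD(1)) auto
    then obtain n where n: "measure M (\<Union>i. A i) - \<epsilon> / 2 < measure M (\<Union>i<n. A i)"
      using eventually_happens by fastforce
    \<comment> \<open>The first \<open>n\<close> errors add up to at most
      \<open>\<epsilon> / 2\<close>; dividing by \<open>n + 1\<close> covers
      \<open>n = 0\<close>.\<close>
    have "\<forall>i. \<exists>L\<in>local_events. measure M ((A i - L) \<union> (L - A i)) < \<epsilon> / (2 * (real n + 1))"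
      using Union(2,3) by simp
    then obtain L where L: "\<And>i. L i \<in> local_events" "\<And>i. measure M ((A i - L i) \<union> (L i - A i)) < \<epsilon> / (2 * (real n + 1))"
      by metis
    let ?U = "\<Union>i. A i" and ?Un = "\<Union>i<n. A i" and ?L = "\<Union>i<n. L i"
    have LM: "L i \<in> sets M" for i by (rule local_M[OF L(1)])
    have "measure M ((?U - ?L) \<union> (?L - ?U)) \<le> measure M ((?U - ?Un) \<union> (\<Union>i<n. (A i - L i) \<union> (L i - A i)))"
      by (rule finite_measure_mono) (use AM LM in auto)
    also have "\<dots> \<le> measure M (?U - ?Un) + measure M (\<Union>i<n. (A i - L i) \<union> (L i - A i))"
      by (rule measure_Un_le) (use AM LM in auto)
    also have "measure M (?U - ?Un) = measure M ?U - measure M ?Un"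
      by (rule finite_measure_Diff) (use AM in auto)
    also have "measure M (\<Union>i<n. (A i - L i) \<union> (L i - A i)) \<le> (\<Sum>i<n. measure M ((A i - L i) \<union> (L i - A i)))"
      by (rule finite_measure_subadditive_finite) (use AM LM in auto)
    also have "\<dots> \<le> (\<Sum>i<n. \<epsilon> / (2 * (real n + 1)))"
      by (intro sum_mono less_imp_le L(2))
    also have "\<dots> \<le> \<epsilon> / 2" using Union(3) by (simp add: field_simps)
    finally have "measure M ((?U - ?L) \<union> (?L - ?U)) < \<epsilon>" using n by linarith
    then show ?case using local_events_UN[of L n] L(1) by blast
  qed
qed

abbreviation "window_deficit q \<equiv> dpp_window.total_deficit \<mu> K (window q)"

lemma X_diff_config: "\<omega> \<in> space P \<Longrightarrow> X \<omega> - B \<in> space configurations"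
  using X_config[of \<omega>] by (auto simp: space_configurations intro: locally_finite_subset)

section \<open>Deletions of one point and the passage to all events\<close>

context
  fixes B :: "'a set" and j :: nat
  assumes B: "B \<in> sets borel" and Bj: "B \<subseteq> window j"
begin

text \<open>An integral over a counting measure, so that countable additivity in \<open>A\<close>
  holds for every outcome; \<open>min_deficit_null\<close> builds a measure from it.\<close>

definition deletions :: "'a set set \<Rightarrow> 'w \<Rightarrow> ennreal" where
  "deletions A \<omega> = (\<integral>\<^sup>+x. indicator A (X \<omega> - {x}) \<partial>count_space (X \<omega> \<inter> B))"

lemma finite_XB: "\<omega> \<in> space P \<Longrightarrow> finite (X \<omega> \<inter> B)"
  using configuration_finite[OF proper X_config] bounded_subset[OF window_bounded Bj] by blast

lemma deletions_sum: "\<omega> \<in> space P \<Longrightarrow> deletions A \<omega> = (\<Sum>x\<in>X \<omega> \<inter> B. indicator A (X \<omega> - {x}))"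
  unfolding deletions_def by (rule nn_integral_count_space_finite[OF finite_XB])

lemma local_event_window:
  assumes "L \<in> local_events"
  obtains q A where "j \<le> q" "A \<in> sets configurations" "L = {Y \<in> space configurations. Y \<inter> window q \<in> A}"
proof -
  obtain q A where A: "A \<in> sets configurations" "L = {Y \<in> space configurations. Y \<inter> window q \<in> A}"
    by (rule local_eventsE[OF assms])
  then obtain A' where "A' \<in> sets configurations" "L = {Y \<in> space configurations. Y \<inter> window (max j q) \<in> A'}"
    using local_events_raise[OF A(1) max.cobounded2[of q j]] by blast
  then show ?thesis using that[of "max j q" A'] by simp
qed

lemma deletions_local:
  assumes \<omega>: "\<omega> \<in> space P"
  shows "deletions {Y \<in> space configurations. Y \<inter> window q \<in> A} \<omega> = (\<Sum>x\<in>X \<omega> \<inter> B. indicator A (X \<omega> \<inter> window q - {x}))"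
  unfolding deletions_sum[OF \<omega>]
proof (rule sum.cong[OF refl])
  fix x
  have "(X \<omega> - {x}) \<inter> window q = X \<omega> \<inter> window q - {x}" by auto
  then show "indicator {Y \<in> space configurations. Y \<inter> window q \<in> A} (X \<omega> - {x}) = (indicator A (X \<omega> \<inter> window q - {x}) :: ennreal)"
    using X_diff_config[OF \<omega>, of "{x}"] by (simp add: indicator_def)
qed

lemma deletions_le_card:
  assumes "\<omega> \<in> space P" shows "deletions A \<omega> \<le> of_nat (card (X \<omega> \<inter> window j))"
proof -
  have "deletions A \<omega> \<le> (\<Sum>x\<in>X \<omega> \<inter> B. 1)"
    unfolding deletions_sum[OF assms] by (intro sum_mono) (simp add: indicator_def)
  also have "\<dots> = of_nat (card (X \<omega> \<inter> B))" by simp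
  also have "\<dots> \<le> of_nat (card (X \<omega> \<inter> window j))"
    unfolding of_nat_le_iff using Bj
    by (intro card_mono dpp_window.finite_XD[OF dpp_window assms]) auto
  finally show ?thesis .
qed

text \<open>For a local event the count is a tuple sum in one window containing \<open>B\<close>; a
  Dynkin argument extends measurability to all events.\<close>

lemma deletions_measurable:
  assumes A: "A \<in> sets configurations"
  shows "deletions A \<in> borel_measurable P"
proof -
  have I: "Int_stable local_events" by (auto simp: Int_stable_def local_events_Int)
  have sub: "local_events \<subseteq> Pow (space configurations)" using local_events_sets sets.sets_into_space by blast
  have base: "deletions L \<in> borel_measurable P" if L: "L \<in> local_events" for L
  proof -
    obtain q A where q: "j \<le> q" "A \<in> sets configurations" "L = {Y \<in> space configurations. Y \<inter> window q \<in> A}"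
      by (rule local_event_window[OF L])
    have "B \<subseteq> window q" using Bj window_mono[OF q(1)] by auto
    from dpp_window.deletion_measurable[OF dpp_window q(2) B this]
    have m: "(\<lambda>\<omega>. \<Sum>x\<in>X \<omega> \<inter> B. indicator A (X \<omega> \<inter> window q - {x}) :: ennreal) \<in> borel_measurable P" .
    have "deletions L \<in> borel_measurable P \<longleftrightarrow> (\<lambda>\<omega>. \<Sum>x\<in>X \<omega> \<inter> B. indicator A (X \<omega> \<inter> window q - {x}) :: ennreal) \<in> borel_measurable P"
      unfolding q(3) by (rule measurable_cong) (rule deletions_local)
    then show ?thesis using m by (rule iffD2)
  qed
  show ?thesis
    using I sub A[unfolded sigma_local_events]
  proof (induction rule: sigma_sets_induct_disjoint)
    case (basic A) then show ?case by (rule base)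
  next
    case empty then show ?case by (intro base local_events_empty)
  next
    case (compl A)
    \<comment> \<open>Counts are finite, being at most the number of points in window
      \<open>j\<close>, so they may be subtracted.\<close>
    have eq: "deletions (space configurations - A) \<omega> = deletions (space configurations) \<omega> - deletions A \<omega>" if \<omega>: "\<omega> \<in> space P" for \<omega>
    proof -
      have "deletions A \<omega> + deletions (space configurations - A) \<omega> = deletions (space configurations) \<omega>"
        unfolding deletions_sum[OF \<omega>] sum.distrib[symmetric]
        using X_diff_config[OF \<omega>] by (intro sum.cong refl) (simp add: indicator_def)
      moreover have "deletions A \<omega> \<noteq> \<top>"
        using le_less_trans[OF deletions_le_card[OF \<omega>, of A] of_nat_less_top] by (rule less_imp_neq)
      ultimately show ?thesis by (metis ennreal_add_diff_cancel_left)
    qed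
    have "space configurations \<in> local_events" using local_events_compl[OF local_events_empty] by simp
    then have "(\<lambda>\<omega>. deletions (space configurations) \<omega> - deletions A \<omega>) \<in> borel_measurable P"
      by (intro borel_measurable_minus_ennreal base compl(2))
    moreover have "deletions (space configurations - A) \<in> borel_measurable P \<longleftrightarrow>
        (\<lambda>\<omega>. deletions (space configurations) \<omega> - deletions A \<omega>) \<in> borel_measurable P"
      by (rule measurable_cong) (rule eq)
    ultimately show ?case by simp
  next
    case (union A)
    have "deletions (\<Union>i. A i) = (\<lambda>\<omega>. \<Sum>i. deletions (A i) \<omega>)"
      unfolding deletions_def[abs_def]
      by (simp add: nn_integral_suminf[symmetric] suminf_indicator[OF union(1)])
    then show ?case using union(3) by (simp only: borel_measurable_suminf_order)
  qed
qed

text \<open>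
  Insertion tolerance applies only to events depending on a single window, so \<open>A\<close> is approximated by
  such events in the finite measure \<open>m C = E(deletions C) + P(X \<in> C)\<close>.
\<close>

lemma min_deficit_null:
  assumes A: "A \<in> sets configurations" and AE_A: "AE \<omega> in P. X \<omega> \<in> A"
    and null: "AE \<omega> in P. deletions A \<omega> = 0"
  shows "AE \<omega> in P. (INF q\<in>{j..}. window_deficit q B (X \<omega> \<inter> window q)) = 0"
proof -
  interpret P: prob_space P by (rule P_prob)
  \<comment> \<open>Truncation at 1 lets the error set be paid for by its probability. The infimum
    is taken because the window of the approximating event is not known in advance; it starts at
    \<open>j\<close> so that every window used contains \<open>B\<close>.\<close>
  define \<Delta> where "\<Delta> \<omega> = min 1 (INF q\<in>{j..}. window_deficit q B (X \<omega> \<inter> window q))" for \<omega>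
  have \<Delta>_meas: "\<Delta> \<in> borel_measurable P"
    unfolding \<Delta>_def[abs_def]
    by (intro borel_measurable_min borel_measurable_const borel_measurable_INF dpp_window.total_deficit_measurable[OF dpp_window B]) simp
  have Xind: "(\<lambda>\<omega>. indicator C (X \<omega>) :: ennreal) \<in> borel_measurable P" if "C \<in> sets configurations" for C
    by (rule measurable_compose[OF X_measurable]) (use that in simp)
  define m where "m C = (\<integral>\<^sup>+\<omega>. deletions C \<omega> + indicator C (X \<omega>) \<partial>P)" for C
  define M where "M = measure_of (space configurations) (sets configurations) m"
  have sM: "sets M = sets configurations" unfolding M_def by (simp add: sets.sets_into_space subsetI sets.sigma_sets_eq sets.space_closed)
  have eM: "emeasure M C = m C" if "C \<in> sets configurations" for C
  proof (rule emeasure_measure_of[OF M_def])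
    show "sets configurations \<subseteq> Pow (space configurations)" by (rule sets.space_closed)
    show "C \<in> sets M" using that sM by simp
    show "positive (sets M) m" by (simp add: positive_def m_def deletions_def)
    show "countably_additive (sets M) m"
      unfolding countably_additive_def sM
    proof (intro allI impI)
      fix C :: "nat \<Rightarrow> 'a set set"
      assume C: "range C \<subseteq> sets configurations" "disjoint_family C" "\<Union> (range C) \<in> sets configurations"
      have Ci: "C i \<in> sets configurations" for i using C(1) by auto
      have "(\<Sum>i. m (C i)) = (\<integral>\<^sup>+\<omega>. (\<Sum>i. deletions (C i) \<omega> + indicator (C i) (X \<omega>)) \<partial>P)"
        unfolding m_def by (intro nn_integral_suminf[symmetric] borel_measurable_add deletions_measurable Xind Ci)
      also have "\<dots> = m (\<Union> (range C))"
        unfolding m_def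
      proof (rule nn_integral_cong)
        fix \<omega>
        have "deletions (\<Union> (range C)) \<omega> = (\<Sum>i. deletions (C i) \<omega>)"
          unfolding deletions_def by (simp add: nn_integral_suminf[symmetric] suminf_indicator[OF C(2)])
        then show "(\<Sum>i. deletions (C i) \<omega> + indicator (C i) (X \<omega>)) = deletions (\<Union> (range C)) \<omega> + indicator (\<Union> (range C)) (X \<omega>)"
          by (simp add: suminf_add[symmetric] suminf_indicator[OF C(2)])
      qed
      finally show "(\<Sum>i. m (C i)) = m (\<Union> (range C))" .
    qed
  qed
  have spM: "space M = space configurations" using sets_eq_imp_space_eq[OF sM] .
  \<comment> \<open>Finiteness rests on the finite expected number of points in window
    \<open>j\<close>.\<close>
  have "emeasure M (space M) \<le> (\<integral>\<^sup>+\<omega>. of_nat (card (X \<omega> \<inter> window j)) + 1 \<partial>P)"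
    unfolding spM eM[OF sets.top] m_def
    by (intro nn_integral_mono add_mono deletions_le_card) (simp_all add: indicator_def)
  also have "\<dots> = (\<integral>\<^sup>+\<omega>. of_nat (card (X \<omega> \<inter> window j)) \<partial>P) + 1"
  proof (subst nn_integral_add)
    have "(\<lambda>\<omega>. of_nat (card (X \<omega> \<inter> window j)) :: ennreal) \<in> borel_measurable P"
      by (rule measurable_compose[OF measurable_compose[OF X_measurable measurable_card[OF proper window_borel window_bounded]]]) simp
    then show "(\<lambda>\<omega>. of_nat (card (X \<omega> \<inter> window j)) :: ennreal) \<in> borel_measurable P" .
  qed (simp_all add: P.emeasure_space_1)
  also have "\<dots> < \<infinity>" using dpp_window.expected_card[OF dpp_window, of j] by simp
  finally have fM: "emeasure M (space M) < \<infinity>" .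
  interpret M: finite_measure M by (rule finite_measureI) (use fM in auto)
  \<comment> \<open>Insertion tolerance in a window that decides \<open>L\<close>; the deficit of
    that window is one of those in the infimum.\<close>
  have local_le: "(\<integral>\<^sup>+\<omega>. indicator L (X \<omega>) * \<Delta> \<omega> \<partial>P) \<le> (\<integral>\<^sup>+\<omega>. deletions L \<omega> \<partial>P)" if L: "L \<in> local_events" for L
  proof -
    obtain q C where q: "j \<le> q" "C \<in> sets configurations" "L = {Y \<in> space configurations. Y \<inter> window q \<in> C}"
      by (rule local_event_window[OF L])
    have Bq: "B \<subseteq> window q" using Bj window_mono[OF q(1)] by auto
    have "(\<integral>\<^sup>+\<omega>. indicator L (X \<omega>) * \<Delta> \<omega> \<partial>P) \<le> (\<integral>\<^sup>+\<omega>. indicator C (X \<omega> \<inter> window q) * window_deficit q B (X \<omega> \<inter> window q) \<partial>P)"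
    proof (rule nn_integral_mono)
      fix \<omega> assume \<omega>: "\<omega> \<in> space P"
      have "\<Delta> \<omega> \<le> window_deficit q B (X \<omega> \<inter> window q)"
        unfolding \<Delta>_def using q(1) by (intro min.coboundedI2 INF_lower) simp
      moreover have "indicator L (X \<omega>) = (indicator C (X \<omega> \<inter> window q) :: ennreal)"
        using X_config[OF \<omega>] by (simp add: q(3) indicator_def)
      ultimately show "indicator L (X \<omega>) * \<Delta> \<omega> \<le> indicator C (X \<omega> \<inter> window q) * window_deficit q B (X \<omega> \<inter> window q)"
        by (simp add: mult_left_mono)
    qed
    also have "\<dots> \<le> (\<integral>\<^sup>+\<omega>. (\<Sum>x\<in>X \<omega> \<inter> B. indicator C (X \<omega> \<inter> window q - {x})) \<partial>P)"
      by (rule dpp_window.insertion_tolerance[OF dpp_window q(2) B Bq])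
    also have "\<dots> = (\<integral>\<^sup>+\<omega>. deletions L \<omega> \<partial>P)"
      by (rule nn_integral_cong) (simp only: q(3) deletions_local)
    finally show ?thesis .
  qed
  have small: "(\<integral>\<^sup>+\<omega>. \<Delta> \<omega> \<partial>P) \<le> ennreal \<epsilon>" if \<epsilon>: "0 < \<epsilon>" for \<epsilon>
  proof -
    obtain L where L: "L \<in> local_events" "measure M ((A - L) \<union> (L - A)) < \<epsilon>"
      using approximation_by_local[OF sM fM A \<epsilon>] by blast
    have Ls: "L \<in> sets configurations" by (rule local_events_sets[OF L(1)])
    let ?S = "(A - L) \<union> (L - A)"
    have S: "?S \<in> sets configurations" using A Ls by auto
    \<comment> \<open>The configuration is almost surely in \<open>A\<close>, so when outside
      \<open>L\<close> it is in \<open>?S\<close>, where \<open>\<Delta> \<omega> \<le> 1\<close>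
      suffices.\<close>
    have "(\<integral>\<^sup>+\<omega>. \<Delta> \<omega> \<partial>P) \<le> (\<integral>\<^sup>+\<omega>. indicator L (X \<omega>) * \<Delta> \<omega> + indicator ?S (X \<omega>) \<partial>P)"
    proof (rule nn_integral_mono_AE)
      show "AE \<omega> in P. \<Delta> \<omega> \<le> indicator L (X \<omega>) * \<Delta> \<omega> + indicator ?S (X \<omega>)"
        using AE_A by eventually_elim (auto simp: indicator_def \<Delta>_def)
    qed
    also have "\<dots> = (\<integral>\<^sup>+\<omega>. indicator L (X \<omega>) * \<Delta> \<omega> \<partial>P) + (\<integral>\<^sup>+\<omega>. indicator ?S (X \<omega>) \<partial>P)"
      by (intro nn_integral_add borel_measurable_times_ennreal Xind Ls S \<Delta>_meas)
    also have "\<dots> \<le> (\<integral>\<^sup>+\<omega>. deletions L \<omega> \<partial>P) + (\<integral>\<^sup>+\<omega>. indicator ?S (X \<omega>) \<partial>P)"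
      by (intro add_right_mono local_le L(1))
    also have "(\<integral>\<^sup>+\<omega>. deletions L \<omega> \<partial>P) \<le> (\<integral>\<^sup>+\<omega>. deletions ?S \<omega> \<partial>P)"
    proof (rule nn_integral_mono_AE)
      show "AE \<omega> in P. deletions L \<omega> \<le> deletions ?S \<omega>"
        using null AE_space
      proof eventually_elim
        case (elim \<omega>)
        \<comment> \<open>\<open>L\<close> is contained in the union of \<open>A\<close> and
          \<open>?S\<close>, and deletions into \<open>A\<close> vanish almost surely.\<close>
        have "deletions L \<omega> \<le> deletions A \<omega> + deletions ?S \<omega>"
          unfolding deletions_sum[OF elim(2)] sum.distrib[symmetric]
          by (intro sum_mono) (auto simp: indicator_def)
        then show ?case using elim(1) by simp
      qed
    qed
    then have "(\<integral>\<^sup>+\<omega>. deletions L \<omega> \<partial>P) + (\<integral>\<^sup>+\<omega>. indicator ?S (X \<omega>) \<partial>P) \<le> (\<integral>\<^sup>+\<omega>. deletions ?S \<omega> \<partial>P) + (\<integral>\<^sup>+\<omega>. indicator ?S (X \<omega>) \<partial>P)"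
      by (rule add_right_mono)
    also have "\<dots> = emeasure M ?S"
      unfolding eM[OF S] m_def
      by (intro nn_integral_add[symmetric] deletions_measurable Xind S)
    also have "\<dots> \<le> ennreal \<epsilon>"
      using L(2) by (simp add: M.emeasure_eq_measure ennreal_leI)
    finally show ?thesis .
  qed
  have "(\<integral>\<^sup>+\<omega>. \<Delta> \<omega> \<partial>P) \<le> 0"
    by (rule ennreal_le_epsilon) (use small in simp)
  then have "(\<integral>\<^sup>+\<omega>. \<Delta> \<omega> \<partial>P) = 0" by simp
  then have "AE \<omega> in P. \<Delta> \<omega> = 0" using nn_integral_0_iff_AE[OF \<Delta>_meas] by simp
  then show ?thesis
    by eventually_elim (auto simp: \<Delta>_def min_def split: if_splits)
qed

end

lemma rigid_deficit_null:
  assumes "rigid P X"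
  shows "AE \<omega> in P. (INF q\<in>{j..}. window_deficit q (window j) (X \<omega> \<inter> window q)) = 0"
proof -
  \<comment> \<open>Rigidity speaks of open balls of positive radius; radius \<open>j + 1\<close>
    contains the closed ball of window \<open>j\<close> and is positive for
    \<open>j = 0\<close>.\<close>
  define b where "b = ball x0 (real j + 1)"
  have wb: "window j \<subseteq> b" by (auto simp: window_def b_def)
  have "0 < real j + 1" by simp
  with assms obtain F where F: "F \<in> measurable configurations (count_space (UNIV :: nat set))"
    and AF: "AE \<omega> in P. card (X \<omega> \<inter> b) = F (X \<omega> - b)"
    unfolding rigid_def b_def by blast
  have bb: "b \<in> sets borel" "bounded b" by (auto simp: b_def)
  define A where "A = {Y \<in> space configurations. card (Y \<inter> b) = F (Y - b)}"
  have c1: "(\<lambda>Y. real (card (Y \<inter> b))) \<in> borel_measurable configurations"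
    by (rule measurable_compose[OF measurable_card[OF proper bb]]) simp
  have c2: "(\<lambda>Y. real (F (Y - b))) \<in> borel_measurable configurations"
    by (rule measurable_compose[OF measurable_compose[OF measurable_configurations_diff[OF proper bb(1)] F]]) simp
  have A: "A \<in> sets configurations"
    using measurable_equality_set[OF c1 c2] by (simp add: A_def)
  show ?thesis
  proof (rule min_deficit_null[OF window_borel order_refl A])
    show "AE \<omega> in P. X \<omega> \<in> A"
      using AF AE_space by eventually_elim (simp add: A_def X_config)
    show "AE \<omega> in P. deletions (window j) A \<omega> = 0"
      using AF AE_space
    proof eventually_elim
      case (elim \<omega>)
      have fin: "finite (X \<omega> \<inter> b)" by (rule configuration_finite[OF proper X_config[OF elim(2)] bb(2)])
      show ?case
        unfolding deletions_sum[OF window_borel order_refl elim(2)]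
      proof (rule sum.neutral, rule ballI)
        fix x assume "x \<in> X \<omega> \<inter> window j"
        then have x: "x \<in> X \<omega> \<inter> b" using wb by auto
        have "(X \<omega> - {x}) \<inter> b = X \<omega> \<inter> b - {x}" "X \<omega> - {x} - b = X \<omega> - b" using x by auto
        moreover have "card (X \<omega> \<inter> b - {x}) < card (X \<omega> \<inter> b)" using fin x by (intro psubset_card_mono) auto
        ultimately have "X \<omega> - {x} \<notin> A" using elim(1) by (simp add: A_def)
        then show "indicator A (X \<omega> - {x}) = (0 :: ennreal)" by simp
      qed
    qed
  qed
qed

end

section \<open>Completeness of the kernels\<close>

lemma linear_spanI: "finite F \<Longrightarrow> F \<subseteq> S \<Longrightarrow> (\<lambda>x. \<Sum>f\<in>F. c f * f x) \<in> linear_span S"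
  unfolding linear_span_def by blast

lemma linear_span_zero: "(\<lambda>x. 0) \<in> linear_span S"
  using linear_spanI[of "{}" S] by simp

lemma linear_span_base: "f \<in> S \<Longrightarrow> f \<in> linear_span S"
  using linear_spanI[of "{f}" S "\<lambda>_. 1"] by simp

lemma linear_span_scale:
  assumes "f \<in> linear_span S" shows "(\<lambda>x. a * f x) \<in> linear_span S"
proof -
  obtain F c where F: "finite F" "F \<subseteq> S" "f = (\<lambda>x. \<Sum>g\<in>F. c g * g x)"
    using assms unfolding linear_span_def by blast
  then have "(\<lambda>x. a * f x) = (\<lambda>x. \<Sum>g\<in>F. (a * c g) * g x)" by (simp add: sum_distrib_left mult.assoc)
  then show ?thesis using linear_spanI[OF F(1,2), of "\<lambda>g. a * c g"] by simp
qed

lemma linear_span_add: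
  assumes "f \<in> linear_span S" "g \<in> linear_span S" shows "(\<lambda>x. f x + g x) \<in> linear_span S"
proof -
  obtain F c where F: "finite F" "F \<subseteq> S" "f = (\<lambda>x. \<Sum>h\<in>F. c h * h x)"
    using assms(1) unfolding linear_span_def by blast
  obtain G d where G: "finite G" "G \<subseteq> S" "g = (\<lambda>x. \<Sum>h\<in>G. d h * h x)"
    using assms(2) unfolding linear_span_def by blast
  let ?e = "\<lambda>h. (if h \<in> F then c h else 0) + (if h \<in> G then d h else 0)"
  have "f x + g x = (\<Sum>h\<in>F \<union> G. ?e h * h x)" for x
  proof -
    have "(\<Sum>h\<in>F \<union> G. (if h \<in> F then c h else 0) * h x) = (\<Sum>h\<in>F. c h * h x)"
      by (rule sum.mono_neutral_cong_right) (use F G in auto)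
    moreover have "(\<Sum>h\<in>F \<union> G. (if h \<in> G then d h else 0) * h x) = (\<Sum>h\<in>G. d h * h x)"
      by (rule sum.mono_neutral_cong_right) (use F G in auto)
    ultimately show ?thesis by (simp only: F(3) G(3) distrib_right sum.distrib)
  qed
  then show ?thesis using linear_spanI[of "F \<union> G" S ?e] F G by simp
qed

lemma linear_span_sum:
  "finite I \<Longrightarrow> (\<And>i. i \<in> I \<Longrightarrow> f i \<in> linear_span S) \<Longrightarrow> (\<lambda>x. \<Sum>i\<in>I. c i * f i x) \<in> linear_span S"
proof (induction I rule: finite_induct)
  case (insert i I)
  then show ?case using linear_span_add[OF linear_span_scale[of "f i" S "c i"], of "\<lambda>x. \<Sum>i\<in>I. c i * f i x"] by simp
qed (simp add: linear_span_zero)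

context rkhs
begin

lemma linear_span_subset:
  assumes S: "S \<subseteq> H" shows "linear_span S \<subseteq> H"
proof
  fix f assume "f \<in> linear_span S"
  then obtain F c where F: "finite F" "F \<subseteq> S" "f = (\<lambda>x. \<Sum>g\<in>F. c g * g x)"
    unfolding linear_span_def by blast
  show "f \<in> H" unfolding F(3) by (rule H_sum[OF F(1)]) (use F(2) S in blast)
qed

text \<open>The component \<open>r\<close> of \<open>f\<close> orthogonal to the kernels at
  \<open>Z\<close> vanishes at each \<open>t\<close> whose kernel is approximable, since
  \<open>r t\<close> is an inner product with that kernel. Thus \<open>r = 0\<close>, and the
  partial sums of the projection are the approximants.\<close>

lemma dense_if_kernels_approximable:
  assumes Z: "countable Z" and f: "f \<in> H"
    and approx: "AE t in \<mu>. \<forall>\<epsilon>>0. \<exists>F c. finite F \<and> F \<subseteq> Z \<and> nrm (\<lambda>y. K y t - (\<Sum>x\<in>F. c x * K y x)) < \<epsilon>"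
    and \<epsilon>: "0 < \<epsilon>"
  shows "\<exists>g\<in>linear_span {ker x | x. x \<in> Z}. nrm (\<lambda>y. f y - g y) < \<epsilon>"
proof -
  let ?S = "{ker x | x. x \<in> Z}"
  \<comment> \<open>The enumeration of a finite \<open>Z\<close> repeats points, which Gram-Schmidt
    sends to functions of norm 0; the zero function covers an empty \<open>Z\<close>.\<close>
  define v where "v i = (if Z = {} then (\<lambda>_. 0) else ker (from_nat_into Z i))" for i
  have v: "v i \<in> H" for i unfolding v_def using H_zero ker_H by simp
  have v_span: "v i \<in> linear_span ?S" for i
    unfolding v_def using linear_span_zero[of ?S] from_nat_into[of Z i]
    by (cases "Z = {}") (auto intro!: linear_span_base)
  define e where "e = gram_schmidt v"
  have e: "ortho e" unfolding e_def by (rule gram_schmidt_ortho) (rule v)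
  obtain s where s: "s \<in> H" "(\<lambda>N. nrm (\<lambda>x. s x - (\<Sum>i<N. ip f (e i) * e i x))) \<longlonglongrightarrow> 0"
      "\<And>i. ip s (e i) = ip f (e i)"
  proof (rule projection[OF e f])
    fix s assume "s \<in> H" "(\<lambda>N. nrm (\<lambda>x. s x - (\<Sum>i<N. ip f (e i) * e i x))) \<longlonglongrightarrow> 0"
      "\<And>i. ip s (e i) = ip f (e i)"
    then show thesis by (rule that)
  qed
  define r where "r y = f y - s y" for y
  have rH: "r \<in> H" unfolding r_def[abs_def] by (rule H_diff[OF f s(1)])
  have re: "ip (e i) r = 0" for i
  proof -
    have "ip r (e i) = 0"
      unfolding r_def[abs_def] by (subst L2_inner_diff) (use f s orthoD(1)[OF e] in auto)
    then show ?thesis using L2_inner_cnj[of \<mu> r "e i"] by simp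
  qed
  have rv: "ip (v n) r = 0" for n
  proof -
    obtain a where a: "\<forall>y. v n y = (\<Sum>i\<in>{..n}. a i * e i y)"
      using gram_schmidt_expand[of v n, OF v] unfolding e_def by blast
    have "v n = (\<lambda>y. \<Sum>i\<in>{..n}. a i * e i y)" by (rule ext) (rule a[rule_format])
    then have "ip (v n) r = (\<Sum>i\<in>{..n}. a i * ip (e i) r)"
      by (simp only:) (rule L2_inner_sum, use orthoD(1)[OF e] rH in auto)
    then show ?thesis by (simp add: re)
  qed
  have rZ: "ip (ker x) r = 0" if x: "x \<in> Z" for x
  proof -
    obtain i where i: "from_nat_into Z i = x" using from_nat_into_surj[OF Z x] by blast
    have "v i = ker x" unfolding v_def i using x by auto
    then show ?thesis using rv[of i] by simp
  qed
  have "AE t in \<mu>. r t = 0"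
    using approx
  proof eventually_elim
    case (elim t)
    have "cmod (r t) \<le> 0"
    proof (rule field_le_epsilon)
      fix \<delta> :: real assume \<delta>: "0 < \<delta>"
      \<comment> \<open>The added 1 keeps the denominator positive when \<open>r\<close> has norm
        0.\<close>
      define \<eta> where "\<eta> = \<delta> / (nrm r + 1)"
      have nr: "0 \<le> nrm r" by simp
      have "0 < \<eta>" using \<delta> nr unfolding \<eta>_def by (intro divide_pos_pos) linarith+
      then obtain F c where F: "finite F" "F \<subseteq> Z" "nrm (\<lambda>y. K y t - (\<Sum>x\<in>F. c x * K y x)) < \<eta>"
        using elim by blast
      let ?g = "\<lambda>y. \<Sum>x\<in>F. c x * K y x"
      have g: "?g \<in> H" by (rule H_sum[OF F(1) ker_H])
      have "ip ?g r = (\<Sum>x\<in>F. c x * ip (ker x) r)"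
        by (rule L2_inner_sum[OF F(1)]) (use ker_H rH in auto)
      also have "\<dots> = 0" using rZ F(2) by (intro sum.neutral) auto
      finally have g0: "ip ?g r = 0" .
      have "ip (\<lambda>y. K y t - ?g y) r = ip (ker t) r - ip ?g r"
        by (rule L2_inner_diff) (use ker_H g rH in auto)
      then have "cmod (ip (ker t) r) = cmod (ip (\<lambda>y. K y t - ?g y) r)" using g0 by simp
      also have "\<dots> \<le> nrm (\<lambda>y. K y t - ?g y) * nrm r"
        by (rule L2_Cauchy_Schwarz) (use H_diff[OF ker_H g] rH in auto)
      also have "\<dots> \<le> \<eta> * nrm r" using F(3) by (intro mult_right_mono) auto
      also have "\<dots> \<le> \<delta>"
      proof -
        have "\<eta> * nrm r \<le> \<eta> * (nrm r + 1)" using \<open>0 < \<eta>\<close> by (intro mult_left_mono) auto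
        also have "\<dots> = \<delta>" unfolding \<eta>_def using nr by (simp add: add_nonneg_eq_0_iff)
        finally show ?thesis .
      qed
      finally have "cmod (ip (ker t) r) \<le> \<delta>" .
      moreover have "r t = cnj (ip (ker t) r)" unfolding L2_inner_cnj by (rule reproducing[OF rH])
      ultimately show "cmod (r t) \<le> 0 + \<delta>" by simp
    qed
    then show ?case by simp
  qed
  then have "r y = 0" for y by (rule eq_if_AE_eq[OF rH H_zero])
  then have fs: "f = s" by (simp add: r_def fun_eq_iff)
  have "\<forall>\<^sub>F N in sequentially. nrm (\<lambda>x. s x - (\<Sum>i<N. ip f (e i) * e i x)) < \<epsilon>"
    using order_tendstoD(2)[OF s(2) \<epsilon>] .
  then obtain N where N: "nrm (\<lambda>x. s x - (\<Sum>i<N. ip f (e i) * e i x)) < \<epsilon>"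
    unfolding eventually_sequentially by blast
  have "e i \<in> linear_span ?S" for i
  proof -
    obtain b where b: "\<forall>y. e i y = (\<Sum>j\<in>{..i}. b j * v j y)"
      using gram_schmidt_span[of v i] unfolding e_def by blast
    have "e i = (\<lambda>y. \<Sum>j\<in>{..i}. b j * v j y)" by (rule ext) (rule b[rule_format])
    moreover have "(\<lambda>y. \<Sum>j\<in>{..i}. b j * v j y) \<in> linear_span ?S"
      by (rule linear_span_sum) (rule finite_atMost, rule v_span)
    ultimately show ?thesis by (simp only:)
  qed
  then have "(\<lambda>x. \<Sum>i<N. ip f (e i) * e i x) \<in> linear_span ?S" by (rule linear_span_sum[OF finite_lessThan])
  moreover have "nrm (\<lambda>x. f x - (\<Sum>i<N. ip f (e i) * e i x)) < \<epsilon>" using N by (simp only: fs)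
  ultimately show ?thesis by (intro bexI[of _ "\<lambda>x. \<Sum>i<N. ip f (e i) * e i x"])
qed

end

lemma (in dpp_window) gain_section_measurable:
  assumes "z \<in> space (\<mu>n {..<n})"
  shows "(\<lambda>t. ennreal (gain kD n z t)) \<in> borel_measurable \<mu>"
  unfolding gain_def
  by (intro measurable_compose[OF _ measurable_ennreal] borel_measurable_divide borel_measurable_const
      measurable_compose[OF upd_measurable[OF assms] dens_measurable])

lemma (in dpp_window) gain_norm:
  assumes z: "z \<in> distinct_tuples n Z" and Z: "Z \<subseteq> D" and t: "t \<in> D" and nd: "dens n z \<noteq> 0"
  shows "\<exists>c. gain kD n z t = (nrm (\<lambda>y. K y t - (\<Sum>x\<in>z ` {..<n}. c x * K y x)))\<^sup>2"
proof -
  have zD: "z ` {..<n} \<subseteq> D" and inj: "inj_on z {..<n}" using z Z by (auto simp: distinct_tuples_def)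
  have "z i \<in> D" if "i < n" for i using zD that by auto
  then have "det_on {..<n} (\<lambda>i j. kD (z i) (z j)) = det_on {..<n} (\<lambda>i j. K (z i) (z j))"
    by (intro det_on_cong) (simp add: compressed_kernel_def)
  then have "Re (det_on {..<n} (\<lambda>i j. K (z i) (z j))) \<noteq> 0" using nd by simp
  then obtain f c where f: "\<forall>y. f y = K y t - (\<Sum>x\<in>z ` {..<n}. c x * K y x)" "gain K n z t = (nrm f)\<^sup>2"
    using gain_residual[OF inj, of t] by blast
  have "f = (\<lambda>y. K y t - (\<Sum>x\<in>z ` {..<n}. c x * K y x))" by (rule ext) (rule f(1)[rule_format])
  then show ?thesis using f(2) unfolding gain_compressed[OF zD t] by blast
qed

context dpp_locally_finite
begin

text \<open>The integral of an infimum is at most the infimum of the integrals, which rigidity makes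
  0. So for almost every \<open>t\<close> the squared distances to the spans over the windows have
  infimum 0.\<close>

lemma kernels_approximable:
  assumes "rigid P X"
  shows "AE \<omega> in P. AE t in \<mu>. \<forall>\<epsilon>>0. \<exists>F c. finite F \<and> F \<subseteq> X \<omega> \<and> nrm (\<lambda>y. K y t - (\<Sum>x\<in>F. c x * K y x)) < \<epsilon>"
proof -
  have 1: "AE \<omega> in P. \<forall>j. (INF q\<in>{j..}. window_deficit q (window j) (X \<omega> \<inter> window q)) = 0"
    using rigid_deficit_null[OF assms] by (simp add: AE_all_countable)
  have 2: "AE \<omega> in P. \<forall>q. \<forall>n. \<forall>z\<in>distinct_tuples n (X \<omega> \<inter> window q).
      Re (det_on {..<n} (\<lambda>i j. compressed_kernel (window q) K (z i) (z j))) \<noteq> 0"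
    using dpp_window.AE_dens_nonzero[OF dpp_window] by (simp add: AE_all_countable)
  show ?thesis
    using 1 2 AE_space
  proof eventually_elim
    case (elim \<omega>)
    define Z where "Z q = X \<omega> \<inter> window q" for q
    have Z: "finite (Z q)" "Z q \<subseteq> window q" for q
      unfolding Z_def using dpp_window.finite_XD[OF dpp_window elim(3)] by auto
    have "distinct_tuples (card (Z q)) (Z q) \<noteq> {}" for q
      using card_distinct_tuples[OF Z(1), of "card (Z q)" q] by auto
    then have "\<forall>q. \<exists>z. z \<in> distinct_tuples (card (Z q)) (Z q)" by blast
    \<comment> \<open>One ordering per window is enough, since almost surely the deficit is the same
      for all orderings.\<close>
    from choice[OF this] obtain z where z: "\<And>q. z q \<in> distinct_tuples (card (Z q)) (Z q)" by blast
    have nd: "Re (det_on {..<n} (\<lambda>i j. compressed_kernel (window q) K (w i) (w j))) \<noteq> 0" if "w \<in> distinct_tuples n (Z q)" for q n w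
      using elim(2) that unfolding Z_def by blast
    let ?G = "\<lambda>q t. ennreal (gain (compressed_kernel (window q) K) (card (Z q)) (z q) t)"
    have meas: "?G q \<in> borel_measurable \<mu>" for q
      by (rule dpp_window.gain_section_measurable[OF dpp_window])
        (use z[of q] in \<open>auto simp: distinct_tuples_def space_PiM space_mu\<close>)
    have "AE t in \<mu>. \<forall>j. t \<in> window j \<longrightarrow> (INF q\<in>{j..}. ?G q t) = 0"
      unfolding AE_all_countable
    proof
      fix j
      let ?I = "indicator (window j) :: 'a \<Rightarrow> ennreal"
      have I: "?I \<in> borel_measurable \<mu>" using window_borel sets_mu by simp
      have d: "window_deficit q (window j) (Z q) = (\<integral>\<^sup>+t. ?G q t * ?I t \<partial>\<mu>)" if "j \<le> q" for q
        using dpp_window.total_deficit_eq[OF dpp_window Z window_mono[OF that] z nd]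
        unfolding dpp_window.deficit_def[OF dpp_window] .
      have "(\<integral>\<^sup>+t. (INF q\<in>{j..}. ?G q t * ?I t) \<partial>\<mu>) \<le> (INF q\<in>{j..}. window_deficit q (window j) (Z q))"
      proof (rule INF_greatest)
        fix q assume q: "q \<in> {j..}"
        then have "(\<integral>\<^sup>+t. (INF q\<in>{j..}. ?G q t * ?I t) \<partial>\<mu>) \<le> (\<integral>\<^sup>+t. ?G q t * ?I t \<partial>\<mu>)"
          by (intro nn_integral_mono INF_lower)
        then show "(\<integral>\<^sup>+t. (INF q\<in>{j..}. ?G q t * ?I t) \<partial>\<mu>) \<le> window_deficit q (window j) (Z q)" using d q by simp
      qed
      also have "\<dots> = 0" using elim(1) unfolding Z_def by blast
      finally have "(\<integral>\<^sup>+t. (INF q\<in>{j..}. ?G q t * ?I t) \<partial>\<mu>) = 0" by simp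
      moreover have "(\<lambda>t. INF q\<in>{j..}. ?G q t * ?I t) \<in> borel_measurable \<mu>"
        by (intro borel_measurable_INF borel_measurable_times_ennreal meas I) simp
      ultimately have "AE t in \<mu>. (INF q\<in>{j..}. ?G q t * ?I t) = 0" by (simp add: nn_integral_0_iff_AE)
      then show "AE t in \<mu>. t \<in> window j \<longrightarrow> (INF q\<in>{j..}. ?G q t) = 0"
      proof eventually_elim
        case (elim t)
        then show ?case by (cases "t \<in> window j") simp_all
      qed
    qed
    then show ?case
    proof eventually_elim
      case (elim t)
      show ?case
      proof (intro allI impI)
        fix \<epsilon> :: real assume \<epsilon>: "0 < \<epsilon>"
        obtain j where j: "t \<in> window j" using window_cover by blast
        then have "(INF q\<in>{j..}. ?G q t) < ennreal (\<epsilon>\<^sup>2)" using elim \<epsilon> by simp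
        then obtain q where q: "j \<le> q" "?G q t < ennreal (\<epsilon>\<^sup>2)" by (auto simp: INF_less_iff)
        have tq: "t \<in> window q" using j window_mono[OF q(1)] by auto
        obtain c where c: "gain (compressed_kernel (window q) K) (card (Z q)) (z q) t =
            (nrm (\<lambda>y. K y t - (\<Sum>x\<in>z q ` {..<card (Z q)}. c x * K y x)))\<^sup>2"
          using dpp_window.gain_norm[OF dpp_window z Z(2) tq nd[OF z]] by blast
        have "(nrm (\<lambda>y. K y t - (\<Sum>x\<in>z q ` {..<card (Z q)}. c x * K y x)))\<^sup>2 < \<epsilon>\<^sup>2"
          using q(2) unfolding c by (simp add: ennreal_less_iff)
        then have "nrm (\<lambda>y. K y t - (\<Sum>x\<in>z q ` {..<card (Z q)}. c x * K y x)) < \<epsilon>"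
          by (rule power2_less_imp_less) (use \<epsilon> in simp)
        moreover have "z q ` {..<card (Z q)} \<subseteq> X \<omega>" using image_tuple_eq[OF Z(1) refl z, of q] unfolding Z_def by blast
        ultimately show "\<exists>F c. finite F \<and> F \<subseteq> X \<omega> \<and> nrm (\<lambda>y. K y t - (\<Sum>x\<in>F. c x * K y x)) < \<epsilon>"
          by (intro exI[of _ "z q ` {..<card (Z q)}"] exI[of _ c] conjI finite_imageI finite_lessThan)
      qed
    qed
  qed
qed

lemma X_countable:
  assumes \<omega>: "\<omega> \<in> space P" shows "countable (X \<omega>)"
proof (rule countable_subset)
  show "X \<omega> \<subseteq> (\<Union>q. X \<omega> \<inter> window q)"
  proof
    fix x assume x: "x \<in> X \<omega>"
    obtain q where "x \<in> window q" using window_cover by blast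
    with x show "x \<in> (\<Union>q. X \<omega> \<inter> window q)" by (intro UN_I[of q]) simp_all
  qed
  have "countable (X \<omega> \<inter> window q)" for q
    by (rule countable_finite) (rule dpp_window.finite_XD[OF dpp_window \<omega>])
  then show "countable (\<Union>q. X \<omega> \<inter> window q)" by (rule countable_UN[OF countableI_type])
qed

end

text \<open>The sequence consists of the projections to \<open>H\<close> of indicators from a
  countable family. For \<open>f\<close> in \<open>H\<close>, orthogonality to such a projection is
  orthogonality to the indicator itself; so the integrals of \<open>f\<close> over the family
  vanish, hence \<open>f\<close> almost everywhere, hence everywhere.\<close>

lemma rkhs_countable_total:
  fixes \<mu> :: "'a::{metric_space, second_countable_topology} measure"
  assumes "rkhs \<mu> K H" and sf: "sigma_finite_measure \<mu>" and sets_mu: "sets \<mu> = sets borel"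
    and ball: "\<And>n::nat. emeasure \<mu> (cball x0 (real n)) < \<infinity>"
    and proj: "\<And>f. f \<in> L2 \<mu> \<Longrightarrow> \<exists>h\<in>H. \<forall>g\<in>H. L2_inner \<mu> (\<lambda>x. f x - h x) g = 0"
  shows "\<exists>h :: nat \<Rightarrow> 'a \<Rightarrow> complex. (\<forall>i. h i \<in> H) \<and> (\<forall>f\<in>H. (\<forall>i. L2_inner \<mu> f (h i) = 0) \<longrightarrow> (\<forall>y. f y = 0))"
proof -
  interpret rkhs \<mu> K H by fact
  obtain \<B> :: "'a set set" where \<B>: "countable \<B>" "topological_basis \<B>" using ex_countable_basis by blast
  \<comment> \<open>Finite intersections of basic open sets, with \<open>UNIV\<close> as the empty
    intersection, form the intersection-stable generator that Dynkin's lemma requires.\<close>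
  define \<G> where "\<G> = (\<lambda>F. \<Inter>F) ` {F. finite F \<and> F \<subseteq> \<B>}"
  have \<G>: "countable \<G>" unfolding \<G>_def using countable_Collect_finite_subset[OF \<B>(1)] by simp
  have \<G>_open: "open U" if "U \<in> \<G>" for U
    using that topological_basis_open[OF \<B>(2)] by (auto simp: \<G>_def intro!: open_Inter)
  have Int: "Int_stable \<G>"
  proof (rule Int_stableI)
    fix a b assume "a \<in> \<G>" "b \<in> \<G>"
    then obtain F F' where "finite F" "F \<subseteq> \<B>" "a = \<Inter>F" "finite F'" "F' \<subseteq> \<B>" "b = \<Inter>F'" by (auto simp: \<G>_def)
    then show "a \<inter> b \<in> \<G>" by (auto simp: \<G>_def Inter_Un_distrib intro!: image_eqI[of _ _ "F \<union> F'"])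
  qed
  have sigma: "sets borel = sigma_sets UNIV \<G>"
  proof -
    have "sets borel = sigma_sets UNIV \<B>" by (simp add: borel_eq_countable_basis[OF \<B>])
    also have "\<dots> \<subseteq> sigma_sets UNIV \<G>"
    proof (rule sigma_sets_mono')
      show "\<B> \<subseteq> \<G>"
      proof
        fix b assume "b \<in> \<B>"
        then show "b \<in> \<G>" unfolding \<G>_def by (intro image_eqI[of _ _ "{b}"]) auto
      qed
    qed
    finally have "sets borel \<subseteq> sigma_sets UNIV \<G>" .
    moreover have "\<G> \<subseteq> sets borel" by (rule subsetI) (rule borel_open[OF \<G>_open])
    then have "sigma_sets UNIV \<G> \<subseteq> sets borel" using sets.sigma_sets_subset[of \<G> borel] by simp
    ultimately show ?thesis by (rule subset_antisym)
  qed
  \<comment> \<open>Intersecting with balls makes the measure finite, so that the indicators lie in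
    \<open>L2 \<mu>\<close>.\<close>
  define \<A> where "\<A> = (\<lambda>(U, n). U \<inter> cball x0 (real n)) ` (\<G> \<times> (UNIV :: nat set))"
  have \<A>: "countable \<A>" unfolding \<A>_def using \<G> by simp
  have UNIV_\<G>: "UNIV \<in> \<G>" by (auto simp: \<G>_def intro!: image_eqI[of _ _ "{}"])
  then have ne: "\<A> \<noteq> {}" by (auto simp: \<A>_def)
  have \<A>_fin: "A \<in> sets \<mu> \<and> emeasure \<mu> A < \<infinity>" if "A \<in> \<A>" for A
  proof -
    obtain U n where A: "U \<in> \<G>" "A = U \<inter> cball x0 (real n)" using \<open>A \<in> \<A>\<close> by (auto simp: \<A>_def)
    have "A \<in> sets \<mu>" using A \<G>_open sets_mu by simp
    moreover have "emeasure \<mu> A \<le> emeasure \<mu> (cball x0 (real n))"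
      using A sets_mu by (intro emeasure_mono) auto
    ultimately show ?thesis using ball[of n] by (auto intro: le_less_trans)
  qed
  have ind_L2: "indicator A \<in> L2 \<mu>" if "A \<in> \<A>" for A
  proof -
    have "integrable \<mu> (indicator A :: 'a \<Rightarrow> real)" using \<A>_fin[OF that] by simp
    moreover have "(\<lambda>x. (cmod (indicator A x))\<^sup>2) = indicator A" by (auto simp: indicator_def)
    moreover have "(indicator A :: 'a \<Rightarrow> complex) \<in> borel_measurable \<mu>"
      using \<A>_fin[OF that] by (intro borel_measurable_indicator) simp
    ultimately show ?thesis by (simp add: L2_def)
  qed
  have "\<forall>A\<in>\<A>. \<exists>h. h \<in> H \<and> (\<forall>g\<in>H. ip (\<lambda>x. indicator A x - h x) g = 0)"
    using proj[OF ind_L2] by blast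
  then obtain \<eta> where \<eta>: "\<And>A. A \<in> \<A> \<Longrightarrow> \<eta> A \<in> H" "\<And>A g. A \<in> \<A> \<Longrightarrow> g \<in> H \<Longrightarrow> ip (\<lambda>x. indicator A x - \<eta> A x) g = 0"
    by metis
  define h where "h i = \<eta> (from_nat_into \<A> i)" for i
  have hH: "h i \<in> H" for i unfolding h_def by (rule \<eta>(1)[OF from_nat_into[OF ne]])
  have "f y = 0" if f: "f \<in> H" and 0: "\<And>i. ip f (h i) = 0" for f y
  proof -
    have fL2: "f \<in> L2 \<mu>" using f by simp
    have f\<A>: "(\<integral>x. indicator A x * f x \<partial>\<mu>) = 0" if A: "A \<in> \<A>" for A
    proof -
      obtain i where "from_nat_into \<A> i = A" using from_nat_into_surj[OF \<A> A] by blast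
      then have "ip f (\<eta> A) = 0" using 0[of i] by (simp add: h_def)
      then have "ip (\<eta> A) f = 0" using L2_inner_cnj[of \<mu> f "\<eta> A"] by simp
      moreover have "ip (\<lambda>x. indicator A x - \<eta> A x) f = ip (indicator A) f - ip (\<eta> A) f"
        by (rule L2_inner_diff[OF ind_L2[OF A] in_L2[OF \<eta>(1)[OF A]] fL2])
      ultimately have "ip (indicator A) f = 0" using \<eta>(2)[OF A f] by simp
      then have "ip f (indicator A) = 0" using L2_inner_cnj[of \<mu> "indicator A" f] by simp
      moreover have "f x * cnj (indicator A x) = indicator A x * f x" for x by (simp split: split_indicator)
      ultimately show ?thesis by (simp add: L2_inner_def)
    qed
    \<comment> \<open>On a fixed ball \<open>f\<close> is integrable, so the sets over which its
      integral vanishes form a Dynkin system containing \<open>\<G>\<close>.\<close>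
    have zero_ball: "AE x in \<mu>. indicator (cball x0 (real n)) x *\<^sub>R f x = 0" for n
    proof -
      let ?b = "cball x0 (real n)" and ?f = "\<lambda>x. indicator (cball x0 (real n)) x *\<^sub>R f x"
      have b: "?b \<in> sets \<mu>" using sets_mu by simp
      have bA: "?b \<in> \<A>" unfolding \<A>_def using UNIV_\<G> by (intro image_eqI[of _ _ "(UNIV, n)"]) auto
      have int: "integrable \<mu> ?f"
      proof -
        have "integrable \<mu> (\<lambda>x. f x * cnj (indicator ?b x))" by (rule L2_integrable_mult[OF fL2 ind_L2[OF bA]])
        moreover have "f x * cnj (indicator ?b x) = ?f x" for x by (simp add: indicator_def)
        ultimately show ?thesis by simp
      qed
      have int': "integrable \<mu> (\<lambda>x. indicator A x *\<^sub>R ?f x)" if "A \<in> sets borel" for A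
        by (rule integrable_mult_indicator[OF _ int]) (use that sets_mu in simp)
      have "(\<integral>x. indicator A x *\<^sub>R ?f x \<partial>\<mu>) = 0" if A: "A \<in> sets borel" for A
      proof -
        have "A \<in> sigma_sets UNIV \<G>" using A sigma by simp
        then show ?thesis
        proof (induction rule: sigma_sets_induct_disjoint[OF Int subset_UNIV[of \<G>, folded Pow_UNIV], consumes 1, case_names basic empty compl union])
        case (basic A)
        then have "A \<inter> ?b \<in> \<A>" unfolding \<A>_def by (intro image_eqI[of _ _ "(A, n)"]) auto
        from f\<A>[OF this] have "(\<integral>x. indicator (A \<inter> ?b) x * f x \<partial>\<mu>) = 0" .
        moreover have "indicator A x *\<^sub>R ?f x = indicator (A \<inter> ?b) x * f x" for x
          by (simp split: split_indicator)
        ultimately show ?case by (simp only:)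
      next
        case (compl A)
        have "(\<integral>x. indicator (UNIV - A) x *\<^sub>R ?f x \<partial>\<mu>) = (\<integral>x. ?f x - indicator A x *\<^sub>R ?f x \<partial>\<mu>)"
          by (rule Bochner_Integration.integral_cong) (auto simp: indicator_def)
        also have "\<dots> = (\<integral>x. ?f x \<partial>\<mu>) - (\<integral>x. indicator A x *\<^sub>R ?f x \<partial>\<mu>)"
          by (rule Bochner_Integration.integral_diff[OF int int']) (use compl(1) sigma in simp)
        also have "(\<integral>x. ?f x \<partial>\<mu>) = 0"
        proof -
          have "?f x = indicator ?b x * f x" for x by (simp split: split_indicator)
          then show ?thesis using f\<A>[OF bA] by (simp only:)
        qed
        finally show ?case using compl(2) by simp
      next
        case (union A)
        have A: "A i \<in> sets borel" for i using union(2) sigma by auto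
        have "(LINT x:(\<Union>i. A i)|\<mu>. ?f x) = (\<Sum>i. (LINT x:(A i)|\<mu>. ?f x))"
        proof (rule lebesgue_integral_countable_add)
          show "A i \<in> sets \<mu>" for i using A sets_mu by simp
          show "A i \<inter> A j = {}" if "i \<noteq> j" for i j using union(1) that by (auto simp: disjoint_family_on_def)
          show "set_integrable \<mu> (\<Union>i. A i) ?f" unfolding set_integrable_def by (rule int') (use A in auto)
        qed
        then show ?case using union(3) by (simp add: set_lebesgue_integral_def)
        qed auto
      qed
      then have "AE x in \<mu>. ?f x = 0"
        using sigma_finite_measure.density_zero[OF sf int] sets_mu by (simp add: set_lebesgue_integral_def)
      then show ?thesis .
    qed
    have "AE x in \<mu>. \<forall>n. indicator (cball x0 (real n)) x *\<^sub>R f x = 0"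
      by (subst AE_all_countable) (intro allI zero_ball)
    then have "AE x in \<mu>. f x = 0"
    proof eventually_elim
      case (elim x)
      obtain n :: nat where "dist x0 x \<le> real n" using real_arch_simple by blast
      then show ?case using elim[rule_format, of n] by simp
    qed
    then show ?thesis by (rule eq_if_AE_eq[OF f H_zero])
  qed
  then have "\<forall>f\<in>H. (\<forall>i. ip f (h i) = 0) \<longrightarrow> (\<forall>y. f y = 0)" by simp
  with hH show ?thesis by (intro exI[of _ h]) simp
qed

theorem theorem1p3:
  fixes \<mu> :: "'a::{metric_space, second_countable_topology} measure"
    and K :: "'a \<Rightarrow> 'a \<Rightarrow> complex"
    and H :: "('a \<Rightarrow> complex) set"
    and P :: "'w measure"
    and X :: "'w \<Rightarrow> 'a set"
  assumes "locally compact (UNIV :: 'a set)"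
    and "proper_space TYPE('a)"
    and "regular_borel_measure \<mu>"
    and "determinantal_process P X \<mu> K"
    and "L2_closed_subspace \<mu> H"
    and "orthogonal_projection_onto \<mu> (integral_op \<mu> K) H"
    and "reproducing_kernel \<mu> K H"
    and "rigid P X"
  shows "AE \<omega> in P. L2_spans \<mu> {(\<lambda>y. K y x) | x. x \<in> X \<omega>} H"
proof -
  \<comment> \<open>An arbitrary common centre for the windows.\<close>
  fix x0 :: 'a
  have sets_mu: "sets \<mu> = sets borel" and cf: "\<And>C. compact C \<Longrightarrow> emeasure \<mu> C < \<infinity>"
    using assms(3) unfolding regular_borel_measure_def by blast+
  have closure: "L2_closure \<mu> H = L2_saturation \<mu> H" and H_L2: "H \<subseteq> L2 \<mu>"
    using assms(5) unfolding L2_closed_subspace_def by blast+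
  have rk: "rkhs \<mu> K H"
  proof
    show "\<exists>h\<in>H. AE x in \<mu>. f x = h x"
      if f: "f \<in> L2 \<mu>" "\<And>\<epsilon>. \<epsilon> > 0 \<Longrightarrow> \<exists>g\<in>H. L2_norm \<mu> (\<lambda>x. f x - g x) < \<epsilon>" for f
    proof -
      have "f \<in> L2_closure \<mu> H" using f unfolding L2_closure_def by blast
      then show ?thesis unfolding closure L2_saturation_def by blast
    qed
  qed (use assms(5,7) in \<open>auto simp: L2_closed_subspace_def reproducing_kernel_def\<close>)
  have ball: "emeasure \<mu> (cball x0 (real n)) < \<infinity>" for n :: nat
    using assms(2) by (intro cf) (simp add: proper_space_def)
  have proj: "\<exists>h\<in>H. \<forall>g\<in>H. L2_inner \<mu> (\<lambda>x. f x - h x) g = 0" if "f \<in> L2 \<mu>" for f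
    using assms(6) that unfolding orthogonal_projection_onto_def by blast
  have sf: "sigma_finite_measure \<mu>"
  proof
    have "\<exists>n. x \<in> cball x0 (real n)" for x
      using real_arch_simple[of "dist x0 x"] by simp
    then have "(\<Union>n. cball x0 (real n)) = space \<mu>" using sets_eq_imp_space_eq[OF sets_mu] by auto
    then show "\<exists>A. countable A \<and> A \<subseteq> sets \<mu> \<and> \<Union>A = space \<mu> \<and> (\<forall>a\<in>A. emeasure \<mu> a \<noteq> \<infinity>)"
      using ball sets_mu by (intro exI[of _ "range (\<lambda>n. cball x0 (real n))"]) (auto simp: less_top)
  qed
  obtain h :: "nat \<Rightarrow> 'a \<Rightarrow> complex" where h: "\<And>i. h i \<in> H" "\<And>f y. f \<in> H \<Longrightarrow> (\<And>i. L2_inner \<mu> f (h i) = 0) \<Longrightarrow> f y = 0"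
    using rkhs_countable_total[OF rk sf sets_mu ball proj] by blast
  have dk: "determinantal_kernel \<mu> K" and pp: "point_process P X"
    and int: "\<And>n. n \<ge> 1 \<Longrightarrow> \<exists>\<rho>. intensity_function P X \<mu> n \<rho> \<and>
      (AE x in (\<Pi>\<^sub>M i\<in>{..<n}. \<mu>).
         complex_of_real (\<rho> x) = Determinant.det (Matrix.mat n n (\<lambda>(i, j). K (x i) (x j))))"
    using assms(4) unfolding determinantal_process_def by blast+
  have Km: "case_prod K \<in> borel_measurable (\<mu> \<Otimes>\<^sub>M \<mu>)" using dk unfolding determinantal_kernel_def by blast
  interpret rkhs \<mu> K H by (rule rk)
  interpret dpp_locally_finite \<mu> K H h P X x0
    by (intro dpp_locally_finite.intro dpp_locally_finite_axioms.intro dpp.intro dpp_axioms.intro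
        rkhs_total.intro rkhs_total_axioms.intro) (fact rk sf Km h assms(2) sets_mu pp int cf)+
  show ?thesis
    using kernels_approximable[OF assms(8)] AE_space
  proof eventually_elim
    case (elim \<omega>)
    let ?S = "{(\<lambda>y. K y x) | x. x \<in> X \<omega>}"
    have SH: "?S \<subseteq> H" using ker_H by blast
    have "L2_closure \<mu> (linear_span ?S) = L2_saturation \<mu> H"
    proof
      show "L2_closure \<mu> (linear_span ?S) \<subseteq> L2_saturation \<mu> H"
        unfolding closure[symmetric] L2_closure_def using linear_span_subset[OF SH] by blast
      \<comment> \<open>A member of the saturation is replaced by its representative in
        \<open>H\<close>, which changes no distance.\<close>
      show "L2_saturation \<mu> H \<subseteq> L2_closure \<mu> (linear_span ?S)"
      proof
        fix f assume "f \<in> L2_saturation \<mu> H"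
        then obtain g where f: "f \<in> L2 \<mu>" and g: "g \<in> H" "AE x in \<mu>. f x = g x"
          unfolding L2_saturation_def by blast
        have "\<exists>u\<in>linear_span ?S. L2_norm \<mu> (\<lambda>x. f x - u x) < \<epsilon>" if \<epsilon>: "0 < \<epsilon>" for \<epsilon>
        proof -
          obtain u where u: "u \<in> linear_span ?S" "L2_norm \<mu> (\<lambda>x. g x - u x) < \<epsilon>"
            using dense_if_kernels_approximable[OF X_countable[OF elim(2)] g(1) elim(1) \<epsilon>] by blast
          have uL2: "u \<in> L2 \<mu>" using u(1) linear_span_subset[OF SH] by auto
          have "L2_norm \<mu> (\<lambda>x. f x - u x) = L2_norm \<mu> (\<lambda>x. g x - u x)"
            unfolding L2_norm_def
          proof (intro arg_cong[where f=sqrt] integral_cong_AE)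
            show "AE x in \<mu>. (cmod (f x - u x))\<^sup>2 = (cmod (g x - u x))\<^sup>2"
              using g(2) by eventually_elim simp
          qed (use f in_L2[OF g(1)] uL2 in \<open>auto simp: L2_def\<close>)
          with u(2) have "L2_norm \<mu> (\<lambda>x. f x - u x) < \<epsilon>" by (simp only:)
          then show ?thesis using u(1) by (rule bexI)
        qed
        then show "f \<in> L2_closure \<mu> (linear_span ?S)" using f by (simp add: L2_closure_def)
      qed
    qed
    then show "L2_spans \<mu> ?S H" unfolding L2_spans_def L2_closed_span_def by (intro conjI SH)
  qed
qed

end
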